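(* Let $h_2(z)=\eta^2(z)\eta^2(2z)$, and let $\nu_\pm$ be the multiplier systems on $\Gamma^*(2)$ defined below. (a) For every integer $d>0$ with $d\equiv1\pmod4$ and each choice of sign there is a unique form $f_d^{\pm}=q^{-d/4}+\sum_{n>0,\ n\equiv3\bmod4}a_d^\pm(n)q^{n/4}\in M_2^!(\Gamma^*(2),\bar\nu_\pm)$. (b) For every integer $d>0$ with $d\equiv3\pmod4$ there are unique forms $f_d^{+}=q^{-d/4}+\sum_{n>0,\ n\equiv1\bmod4}a_d^+(n)q^{n/4}\in M_2^!(\Gamma^*(2),\nu_+)$ and $f_d^{-}=q^{-d/4}+\sum_{n\ge5,\ n\equiv1\bmod4}a_d^-(n)q^{n/4}\in M_2^!(\Gamma^*(2),\nu_-)$. (c) For every odd prime $p$ and every $n\ge1$ we have $f_1^+|T_2^{(4)}(p^n)=p^nf^+_{p^n}$. If $p^n\equiv1\pmod4$ then $f_1^-|T_2^{(4)}(p^n)=p^nf^-_{p^n}$. If $p^n\equiv3\pmod4$ then $f_1^-|T_2^{(4)}(p^n)=p^nf^-_{p^n}+a_1^-(p^n)\,h_2$.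
   Context: $q=e^{2\pi iz}$, $\eta(z)=q^{1/24}\prod_{n\ge1}(1-q^n)$. $\Gamma^*(2)$ is the Fricke group generated by $\Gamma_0(2)$ and $W_2=\begin{pmatrix}0&-1\\2&0\end{pmatrix}$ (equivalently by $\begin{pmatrix}1&1\\0&1\end{pmatrix}$ and $W_2$). $\nu_\pm$ is the character of $\Gamma^*(2)$ given by $\nu_\pm(\gamma)=i^{d(b-c/2)}$ for $\gamma=\begin{pmatrix}a&b\\c&d\end{pmatrix}\in\Gamma_0(2)$ (the multiplier system of $h_2$ on $\Gamma_0(2)$) and $\nu_\pm(W_2)=\pm1$; $\bar\nu_\pm$ is its complex conjugate. For $\gamma\in GL_2^+(\mathbb{Q})$, $f|_k\gamma(z)=(\det\gamma)^{k/2}(cz+d)^{-k}f(\gamma z)$. $M_k^!(\Gamma,\chi)$ is the space of holomorphic functions on the upper half-plane, meromorphic at the cusps, with $f|_k\gamma=\chi(\gamma)f$ for all $\gamma\in\Gamma$. For a prime $p$, $f|T_k^{(t)}(p)=p^{k/2-1}\left(\sum_{\lambda=0}^{p-1}f|_k\begin{pmatrix}1&t\lambda\\0&p\end{pmatrix}+f|_k\begin{pmatrix}p&0\\0&1\end{pmatrix}\right)$, acting on $f=\sum a(n)q^{n/t}$ by $\sum(a(pn)+p^{k-1}a(n/p))q^{n/t}$; $T_k^{(t)}(1)=\mathrm{id}$, $T_k^{(t)}(p^{n+1})=T_k^{(t)}(p^n)T_k^{(t)}(p)-p^{k-1}T_k^{(t)}(p^{n-1})$. In (c), $f^\pm_{p^n}$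 are the forms from (a) or (b) according to $p^n\bmod4$, and $a_1^-(m)$ is the coefficient of $q^{m/4}$ in $f_1^-$. *)

theory Defs
  imports "HOL-Analysis.Analysis" "HOL-Computational_Algebra.Primes"
begin

definition Hplane :: "complex set" where
  "Hplane = {z. Im z > 0}"

definition slash :: "int \<Rightarrow> real \<times> real \<times> real \<times> real \<Rightarrow> (complex \<Rightarrow> complex) \<Rightarrow> complex \<Rightarrow> complex" where
  "slash k M f z = (case M of (a, b, c, d) \<Rightarrow>
      complex_of_real ((a * d - b * c) powr (of_int k / 2))
      * (of_real c * z + of_real d) powi (- k)
      * f ((of_real a * z + of_real b) / (of_real c * z + of_real d)))"

abbreviation imat :: "int \<Rightarrow> int \<Rightarrow> int \<Rightarrow> int \<Rightarrow> real \<times> real \<times> real \<times> real" where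
  "imat a b c d \<equiv> (of_int a, of_int b, of_int c, of_int d)"

definition qpow :: "nat \<Rightarrow> int \<Rightarrow> complex \<Rightarrow> complex" where
  "qpow t n z = exp (2 * of_real pi * \<i> * of_int n * z / of_nat t)"

definition mero_at_infty :: "(complex \<Rightarrow> complex) \<Rightarrow> bool" where
  "mero_at_infty f \<longleftrightarrow> (\<exists>h::nat. h > 0 \<and> (\<exists>(a::int \<Rightarrow> complex) N.
      (\<forall>n. n < N \<longrightarrow> a n = 0) \<and>
      (\<forall>z\<in>Hplane. ((\<lambda>n. a n * qpow h n z) has_sum f z) UNIV)))"

definition mero_at_cusps :: "int \<Rightarrow> (complex \<Rightarrow> complex) \<Rightarrow> bool" where
  "mero_at_cusps k f \<longleftrightarrow> (\<forall>a b c d. a * d - b * c = 1 \<longrightarrow> mero_at_infty (slash k (imat a b c d) f))"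

definition nu0 :: "int \<Rightarrow> int \<Rightarrow> int \<Rightarrow> int \<Rightarrow> complex" where
  "nu0 a b c d = \<i> powi (d * (b - c div 2))"

definition nu0_conj :: "int \<Rightarrow> int \<Rightarrow> int \<Rightarrow> int \<Rightarrow> complex" where
  "nu0_conj a b c d = cnj (nu0 a b c d)"

text \<open>M_k^!(Gamma*(2), chi), where chi is given by its values chi0 on Gamma_0(2)
  and its value w on the Fricke involution W_2 = (0,-1;2,0); since Gamma*(2) is generated
  by Gamma_0(2) and W_2, the transformation law is required on these generators.\<close>
definition wh_form :: "int \<Rightarrow> (int \<Rightarrow> int \<Rightarrow> int \<Rightarrow> int \<Rightarrow> complex) \<Rightarrow> complex \<Rightarrow> (complex \<Rightarrow> complex) \<Rightarrow> bool" where
  "wh_form k chi0 w f \<longleftrightarrow>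
     f holomorphic_on Hplane \<and>
     (\<forall>a b c d. a * d - b * c = 1 \<and> even c \<longrightarrow>
        (\<forall>z\<in>Hplane. slash k (imat a b c d) f z = chi0 a b c d * f z)) \<and>
     (\<forall>z\<in>Hplane. slash k (imat 0 (-1) 2 0) f z = w * f z) \<and>
     mero_at_cusps k f"

definition qexp_coeffs :: "nat \<Rightarrow> nat set \<Rightarrow> (nat \<Rightarrow> complex) \<Rightarrow> (complex \<Rightarrow> complex) \<Rightarrow> bool" where
  "qexp_coeffs d S a f \<longleftrightarrow>
     (\<forall>z\<in>Hplane. ((\<lambda>n. a n * qpow 4 (int n) z) has_sum (f z - qpow 4 (- int d) z)) S)"

definition qexp_shape :: "nat \<Rightarrow> nat set \<Rightarrow> (complex \<Rightarrow> complex) \<Rightarrow> bool" where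
  "qexp_shape d S f \<longleftrightarrow> (\<exists>a. qexp_coeffs d S a f)"

definition S1 :: "nat set" where "S1 = {n. n > 0 \<and> n mod 4 = 1}"
definition S3 :: "nat set" where "S3 = {n. n > 0 \<and> n mod 4 = 3}"
definition S5 :: "nat set" where "S5 = {n. n \<ge> 5 \<and> n mod 4 = 1}"

text \<open>The defining property of f_d^s (s = 1 for +, s = -1 for -), according to d mod 4:
  part (a) if d = 1 mod 4, part (b) if d = 3 mod 4.\<close>
definition fd_prop :: "complex \<Rightarrow> nat \<Rightarrow> (complex \<Rightarrow> complex) \<Rightarrow> bool" where
  "fd_prop s d f \<longleftrightarrow>
     (if d mod 4 = 1 then wh_form 2 nu0_conj s f \<and> qexp_shape d S3 f
      else wh_form 2 nu0 s f \<and> qexp_shape d (if s = 1 then S1 else S5) f)"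

definition eta :: "complex \<Rightarrow> complex" where
  "eta z = exp (2 * of_real pi * \<i> * z / 24) * prodinf (\<lambda>n. 1 - exp (2 * of_real pi * \<i> * z) ^ Suc n)"

definition h2 :: "complex \<Rightarrow> complex" where
  "h2 z = eta z ^ 2 * eta (2 * z) ^ 2"

definition heckeP :: "int \<Rightarrow> nat \<Rightarrow> nat \<Rightarrow> (complex \<Rightarrow> complex) \<Rightarrow> complex \<Rightarrow> complex" where
  "heckeP k t p f z = complex_of_real (real p powr (of_int k / 2 - 1)) *
     ((\<Sum>j<p. slash k (1, real (t * j), 0, real p) f z) + slash k (real p, 0, 0, 1) f z)"

fun hecke :: "int \<Rightarrow> nat \<Rightarrow> nat \<Rightarrow> nat \<Rightarrow> (complex \<Rightarrow> complex) \<Rightarrow> complex \<Rightarrow> complex" where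
  "hecke k t p 0 f = f"
| "hecke k t p (Suc 0) f = heckeP k t p f"
| "hecke k t p (Suc (Suc n)) f =
     (\<lambda>z. heckeP k t p (hecke k t p (Suc n) f) z
          - complex_of_real (real p powr (of_int k - 1)) * hecke k t p n f z)"

end

theory Submission
  imports Defs "HOL-Complex_Analysis.Complex_Analysis" "HOL-Real_Asymp.Real_Asymp" "HOL-Number_Theory.Cong"
begin

text \<open>
  With \<open>\<psi>(z) = (\<eta>(z) / \<eta>(2z))\<^sup>1\<^sup>2\<close> one has \<open>h\<^sub>2(-1/2z) = -2z\<^sup>2 h\<^sub>2(z)\<close> and
  \<open>\<psi>(-1/2z) = 64 / \<psi>(z)\<close>, so \<open>h\<^sub>2 (\<psi>\<^sup>k - s 64\<^sup>k \<psi>\<^sup>-\<^sup>k)\<close> transforms correctly for the sign \<open>s\<close>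
  and begins with \<open>q\<^sup>-\<^sup>d\<^sup>/\<^sup>4\<close> for \<open>d = 2k - 1\<close>; Gaussian elimination among these functions and \<open>h\<^sub>2\<close>
  gives all \<open>f\<^sub>d\<close>.  Conversely, a form without principal part becomes, after division by the
  zero-free \<open>h\<^sub>2\<close>, a function whose modulus is invariant and which has a limit at infinity, so the
  maximum principle makes it a multiple of \<open>h\<^sub>2\<close>, and zero unless the multiplier is \<open>\<nu>\<^sub>-\<close>.  Since the Hecke
  operators preserve the transformation laws, the Hecke relations only require comparing principal
  parts and the coefficient of \<open>q\<^sup>1\<^sup>/\<^sup>4\<close>.  The law of \<open>\<eta>\<^sup>2\<close> under \<open>z \<mapsto> -1/z\<close> comes from its logarithmic
  derivative, i.e. from Eisenstein's conditionally convergent double series.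
\<close>

section \<open>Partial fractions\<close>

text \<open>The sign explains the asymmetry of the statement. \<open>h2\<close> itself has
  multiplier nu and sign -1. Hence for sign +1 the principal part already forces the coefficient of
  q^(1/4), whereas for sign -1 and multiplier nu any multiple of \<open>h2\<close> may be added;
  demanding that this coefficient vanish (\<open>S5\<close> in place of \<open>S1\<close>) singles
  out one form. For the conjugate multiplier the exponents are 3 mod 4, so q^(1/4) cannot occur.
  T(p^n) turns the multiplier nu^e into nu^(p^n e) and keeps the sign, so it carries f_1 into the
  space of f_(p^n). There the coefficient of q^(1/4) in the image of f_1^- is a_1^-(p^n) when p^n =
  3 mod 4, while f_(p^n)^- has none: this is the \<open>h2\<close> term. The working notion of a
  form records only the class of the exponents mod 4, i.e. the effect of z -> z + 1, and the law
  under W_2. Both can be verified directly for eta quotients, and for T(p) by permuting coset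
  representatives; the law on all of Gamma_0(2) is recovered once, by a Euclidean descent on the
  bottom row.\<close>

lemma pi_cot_eq_Digamma:
  fixes z :: complex
  assumes "z \<notin> \<int>"
  shows "of_real pi * cot (of_real pi * z) = Digamma (1 - z) - Digamma z"
proof -
  have nz: "z \<notin> \<int>\<^sub>\<le>\<^sub>0" "1 - z \<notin> \<int>\<^sub>\<le>\<^sub>0"
    using assms by (auto dest: nonpos_Ints_Int)
  have rg: "rGamma z * rGamma (1 - z) \<noteq> 0"
    using nz by (simp add: rGamma_eq_zero_iff)
  \<comment> \<open>Both sides of the reflection formula
    \<open>rGamma z * rGamma (1 - z) = sin (pi * z) / pi\<close> are differentiated; dividing the
    resulting identity by the formula itself yields the cotangent.\<close>
  have "((\<lambda>z. rGamma z * rGamma (1 - z)) has_field_derivative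
      (- rGamma z * Digamma z * rGamma (1 - z) + rGamma z * (rGamma (1 - z) * Digamma (1 - z)))) (at z)"
    using nz by (auto intro!: derivative_eq_intros has_field_derivative_rGamma_no_nonpos_int
        DERIV_chain2[where f = rGamma])
  moreover have "((\<lambda>z. sin (of_real pi * z) / of_real pi) has_field_derivative cos (of_real pi * z)) (at z)"
    by (auto intro!: derivative_eq_intros)
  ultimately have "cos (of_real pi * z) =
      - rGamma z * Digamma z * rGamma (1 - z) + rGamma z * (rGamma (1 - z) * Digamma (1 - z))"
    unfolding rGamma_reflection_complex by (metis DERIV_unique)
  hence "cos (of_real pi * z) = rGamma z * rGamma (1 - z) * (Digamma (1 - z) - Digamma z)"
    by (simp add: right_diff_distrib mult_ac del: rGamma_reflection_complex)
  with rg show ?thesis unfolding rGamma_reflection_complex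
    by (auto simp: cot_def field_simps)
qed

text \<open>In the difference of the Euler limits for \<open>Digamma (1 - z)\<close> and
  \<open>Digamma z\<close> the logarithms cancel and partial sums of simple fractions
  remain.\<close>

lemma pi_cot_partial_fractions:
  fixes z :: complex
  assumes "z \<notin> \<int>"
  shows "(\<lambda>n. 2 * z / (z\<^sup>2 - of_nat (Suc n) ^ 2)) sums (of_real pi * cot (of_real pi * z) - 1 / z)"
proof -
  have nz: "z + of_nat n \<noteq> 0" "z - of_nat n \<noteq> 0" for n
    using assms by (metis Ints_of_nat Ints_minus add_eq_0_iff minus_minus, metis Ints_of_nat assms eq_iff_diff_eq_0)
  have z1: "z \<noteq> 0" "1 - z \<noteq> 0" using assms by auto
  have "(\<lambda>m. (of_real (ln (real m)) - (\<Sum>n<m. inverse (1 - z + of_nat n))) -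
        (of_real (ln (real m)) - (\<Sum>n<m. inverse (z + of_nat n)))) \<longlonglongrightarrow> Digamma (1 - z) - Digamma z"
    by (intro tendsto_diff Digamma_LIMSEQ z1)
  also have "(\<lambda>m. (of_real (ln (real m)) - (\<Sum>n<m. inverse (1 - z + of_nat n))) -
        (of_real (ln (real m)) - (\<Sum>n<m. inverse (z + of_nat n))))
      = (\<lambda>m. \<Sum>n<m. inverse (z + of_nat n) + inverse (z - of_nat (Suc n)))"
  proof (rule ext)
    fix m
    have "inverse (1 - z + of_nat n) = - inverse (z - of_nat (Suc n))" for n
      by (metis (no_types) add.commute add_diff_eq inverse_minus_eq minus_diff_eq of_nat_Suc)
    thus "(of_real (ln (real m)) - (\<Sum>n<m. inverse (1 - z + of_nat n))) -
        (of_real (ln (real m)) - (\<Sum>n<m. inverse (z + of_nat n)))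
      = (\<Sum>n<m. inverse (z + of_nat n) + inverse (z - of_nat (Suc n)))"
      by (simp add: sum.distrib sum_negf)
  qed
  finally have 1: "(\<lambda>m. \<Sum>n<m. inverse (z + of_nat n) + inverse (z - of_nat (Suc n))) \<longlonglongrightarrow>
      of_real pi * cot (of_real pi * z)"
    using pi_cot_eq_Digamma[OF assms] by simp
  \<comment> \<open>The limit so far pairs 1/(z + n) with 1/(z - n - 1). Adding the null sequence
    1/(z + m) and removing 1/z shifts this to the symmetric pairing of z + n + 1 with z - n -
    1.\<close>
  have "(\<lambda>m. inverse (z + of_nat m)) \<longlonglongrightarrow> 0"
    by (intro tendsto_inverse_0_at_top filterlim_compose[OF tendsto_inverse_0]
        tendsto_add_filterlim_at_infinity[OF tendsto_const] tendsto_of_nat)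
  from tendsto_add[OF 1 tendsto_diff[OF this tendsto_const[of "1/z"]]]
  have "(\<lambda>m. (\<Sum>n<m. inverse (z + of_nat n) + inverse (z - of_nat (Suc n))) +
      (inverse (z + of_nat m) - 1 / z)) \<longlonglongrightarrow> of_real pi * cot (of_real pi * z) - 1 / z"
    by simp
  also have "(\<lambda>m. (\<Sum>n<m. inverse (z + of_nat n) + inverse (z - of_nat (Suc n))) + (inverse (z + of_nat m) - 1 / z))
      = (\<lambda>m. \<Sum>n<m. 2 * z / (z\<^sup>2 - of_nat (Suc n) ^ 2))"
  proof (rule ext)
    fix m show "(\<Sum>n<m. inverse (z + of_nat n) + inverse (z - of_nat (Suc n))) + (inverse (z + of_nat m) - 1 / z)
      = (\<Sum>n<m. 2 * z / (z\<^sup>2 - of_nat (Suc n) ^ 2))" (is "?L m = _")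
    proof (induction m)
      case 0 then show ?case by (simp add: divide_inverse)
    next
      case (Suc m)
      have "inverse (z - of_nat (Suc m)) + inverse (z + of_nat (Suc m)) = 2 * z / (z\<^sup>2 - of_nat (Suc m) ^ 2)"
        using nz(1)[of "Suc m"] nz(2)[of "Suc m"]
        by (simp add: divide_simps power2_eq_square square_diff_square_factored del: of_nat_Suc)
      moreover have "S + (x + y) + (w - t) = S + (x - t) + (y + w)" for S x y w t :: complex
        by simp
      ultimately have "?L (Suc m) = ?L m + 2 * z / (z\<^sup>2 - of_nat (Suc m) ^ 2)"
        unfolding sum.lessThan_Suc by (simp only:)
      with Suc.IH show ?case by (simp del: of_nat_Suc)
    qed
  qed
  finally show ?thesis by (simp add: sums_def)
qed

text \<open>Differentiating the cotangent identity gives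
  \<open>Polygamma 1 z + Polygamma 1 (1 - z)\<close>, and these are series of inverse squares by
  definition; the term n = 0 of the first one is the 1/z^2 that is split off.\<close>

lemma pi_square_over_sin_square_sums:
  fixes z :: complex
  assumes "z \<notin> \<int>"
  shows "(\<lambda>n. 1 / (z + of_nat (Suc n))\<^sup>2 + 1 / (z - of_nat (Suc n))\<^sup>2) sums
     (of_real pi ^ 2 / sin (of_real pi * z) ^ 2 - 1 / z ^ 2)"
proof -
  have nz: "z \<notin> \<int>\<^sub>\<le>\<^sub>0" "1 - z \<notin> \<int>\<^sub>\<le>\<^sub>0"
    using assms by (auto dest: nonpos_Ints_Int)
  have z1: "z \<noteq> 0" "1 - z \<noteq> 0" using assms by auto
  have op: "open (- \<int> :: complex set)" by (simp add: closed_Ints open_Compl)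
  have sn: "sin (of_real pi * z) \<noteq> 0"
    using assms rGamma_reflection_complex[of z] nz by (auto simp: rGamma_eq_zero_iff)
  have D1: "((\<lambda>z. Digamma (1 - z) - Digamma z) has_field_derivative
      (- Polygamma 1 (1 - z) - Polygamma 1 z)) (at z)"
    using nz by (auto intro!: derivative_eq_intros)
  have D2: "((\<lambda>z. of_real pi * cot (of_real pi * z)) has_field_derivative
     - (of_real pi ^ 2 / sin (of_real pi * z) ^ 2)) (at z)"
    using sn by (auto intro!: derivative_eq_intros DERIV_chain2[OF DERIV_cot]
        simp: divide_simps power2_eq_square)
  have "((\<lambda>z. Digamma (1 - z) - Digamma z) has_field_derivative
     - (of_real pi ^ 2 / sin (of_real pi * z) ^ 2)) (at z)"
    by (rule has_field_derivative_transform_within_open[OF D2 op])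
       (use assms in \<open>auto simp: pi_cot_eq_Digamma\<close>)
  from DERIV_unique[OF D1 this]
  have eq: "of_real pi ^ 2 / sin (of_real pi * z) ^ 2 = Polygamma 1 (1 - z) + Polygamma 1 z"
    by (simp add: algebra_simps neg_eq_iff_add_eq_0)
  have s: "(\<lambda>k. inverse ((w + of_nat k)\<^sup>2)) sums Polygamma 1 w" if "w \<noteq> 0" for w :: complex
    using Polygamma_converges'[OF that, of 2] by (simp add: Polygamma_def sums_iff numeral_2_eq_2)
  have "(\<lambda>k. inverse ((z + of_nat (Suc k))\<^sup>2)) sums (Polygamma 1 z - 1 / z^2)"
    using s[OF z1(1)] by (subst sums_Suc_iff) (simp add: divide_inverse)
  from sums_add[OF this s[OF z1(2)]]
  have "(\<lambda>k. inverse ((z + of_nat (Suc k))\<^sup>2) + inverse ((1 - z + of_nat k)\<^sup>2)) sums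
     (of_real pi ^ 2 / sin (of_real pi * z) ^ 2 - 1 / z^2)" by (simp add: eq add_ac add_diff_eq)
  moreover have "(1 - z + of_nat k)\<^sup>2 = (z - of_nat (Suc k))\<^sup>2" for k
    by (simp add: power2_eq_square algebra_simps)
  ultimately show ?thesis by (simp add: divide_inverse)
qed

section \<open>Exchanging the order of summation in the weight two Eisenstein series\<close>

text \<open>The majorant for the corrected Eisenstein double series: cubic decay is shared equally,
  3/2 > 1 for each index.\<close>

lemma summable_on_product_powr:
  "(\<lambda>(m, n). C * real (Suc m) powr (-3/2) * real (Suc n) powr (-3/2)) summable_on (UNIV \<times> UNIV)"
proof -
  define S where "S = (\<Sum>\<^sub>\<infinity>n. real (Suc n) powr (-3/2))"
  have "summable (\<lambda>n. real (Suc n) powr (-3/2))"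
    by (subst summable_Suc_iff[of "\<lambda>n. real n powr (-3/2)"]) (simp add: summable_real_powr_iff)
  hence s: "(\<lambda>n. real (Suc n) powr (-3/2)) summable_on UNIV"
    by (rule summable_nonneg_imp_summable_on) auto
  have "(\<lambda>(m, n). real (Suc m) powr (-3/2) * real (Suc n) powr (-3/2)) summable_on (UNIV \<times> UNIV)"
  proof (rule summable_on_SigmaI)
    fix m :: nat
    show "((\<lambda>n. case (m, n) of (m, n) \<Rightarrow> real (Suc m) powr (-3/2) * real (Suc n) powr (-3/2)) has_sum
       real (Suc m) powr (-3/2) * S) UNIV"
      unfolding S_def using s by (auto intro!: has_sum_cmult_right)
  next
    show "(\<lambda>m. real (Suc m) powr (-3/2) * S) summable_on UNIV"
      using s by (rule summable_on_cmult_left)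
  qed auto
  from summable_on_cmult_right[OF this, of C] show ?thesis
    by (simp add: case_prod_unfold mult.assoc)
qed

text \<open>The imaginary part controls m, and then k = (m z + k) - m z is controlled through the
  bound on m. One constant serves both estimates, so that powers of the norm can later be
  distributed freely over m and k.\<close>

lemma lattice_norm_lower_bound:
  fixes z :: complex
  assumes "Im z > 0"
  obtains c where "c > 0" "\<And>(m::real) k. m \<ge> 0 \<Longrightarrow> norm (of_real m * z + of_real k) \<ge> c * m"
    "\<And>(m::real) k. m \<ge> 0 \<Longrightarrow> norm (of_real m * z + of_real k) \<ge> c * \<bar>k\<bar>"
proof -
  define c where "c = min (Im z) (1 / (1 + norm z / Im z))"
  have t: "1 + norm z / Im z > 0" using assms by (intro add_pos_nonneg) auto
  hence c: "c > 0" "c \<le> Im z" "c * (1 + norm z / Im z) \<le> 1"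
    using assms by (auto simp: c_def pos_le_divide_eq[OF t, symmetric])
  have 1: "norm (of_real m * z + of_real k) \<ge> Im z * m" if "m \<ge> 0" for m k :: real
    using abs_Im_le_cmod[of "of_real m * z + of_real k"] that assms by (simp add: mult.commute)
  show thesis
  proof (rule that[OF c(1)])
    fix m k :: real assume m: "m \<ge> 0"
    show "norm (of_real m * z + of_real k) \<ge> c * m"
      using 1[OF m, of k] mult_right_mono[OF c(2) m] by linarith
    let ?x = "norm (of_real m * z + of_real k)"
    have "\<bar>k\<bar> = norm ((of_real m * z + of_real k) - of_real m * z)" by simp
    also have "\<dots> \<le> ?x + m * norm z"
      using norm_triangle_ineq4[of "of_real m * z + of_real k" "of_real m * z"] m by (simp add: norm_mult)
    also have "m * norm z = (Im z * m) * (norm z / Im z)" using assms by (simp add: field_simps)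
    also have "\<dots> \<le> ?x * (norm z / Im z)"
      using assms by (intro mult_right_mono 1 m) auto
    finally have "\<bar>k\<bar> \<le> ?x * (1 + norm z / Im z)" by (simp add: algebra_simps)
    hence "c * \<bar>k\<bar> \<le> c * (?x * (1 + norm z / Im z))" using c by (intro mult_left_mono) auto
    also have "\<dots> = ?x * (c * (1 + norm z / Im z))" by (simp add: algebra_simps)
    also have "\<dots> \<le> ?x * 1" by (intro mult_left_mono c) auto
    finally show "c * \<bar>k\<bar> \<le> ?x" by simp
  qed
qed

lemma lattice_nonzero:
  fixes z :: complex
  assumes "Im z > 0" "m > (0::real)"
  shows "of_real m * z + of_real k \<noteq> 0"
proof
  assume "of_real m * z + of_real k = 0"
  hence "Im (of_real m * z + of_real k) = 0" by simp
  thus False using assms by simp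
qed

context
  fixes z :: complex assumes z: "Im z > 0"
begin

text \<open>
  The correction \<open>v m n\<close> telescopes in \<open>n\<close>: its sum over \<open>n\<close> is \<open>0\<close>, whereas summing over \<open>m\<close> first leaves
  the limit of a cotangent, and \<open>u - v\<close> is absolutely summable.
\<close>

private definition u where
  "u m n = 1 / (of_nat (Suc m) * z + of_nat (Suc n))\<^sup>2 + 1 / (of_nat (Suc m) * z - of_nat (Suc n))\<^sup>2"

private definition g where
  "g n m = 1 / (of_nat (Suc m) * z - of_nat n) - 1 / (of_nat (Suc m) * z + of_nat n)"

private definition v where "v m n = g (Suc n) m - g n m"

private lemma nz: "of_nat (Suc m) * z + of_nat n \<noteq> 0" "of_nat (Suc m) * z - of_nat n \<noteq> 0"
  using lattice_nonzero[OF z, of "Suc m" n] lattice_nonzero[OF z, of "Suc m" "- n"] by simp_all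

text \<open>With y = x + 1 or y = x - 1, the difference of 1/x and 1/y is 1/(x y) up to sign, so
  subtracting it from 1/x^2 leaves a term of size 1/(x^2 y). The decay rises from quadratic to
  cubic, which is what absolute convergence over a lattice requires.\<close>

private lemma u_minus_v:
  "u m n - v m n = 1 / ((of_nat (Suc m) * z - of_nat (Suc n))\<^sup>2 * (of_nat (Suc m) * z - of_nat n))
      - 1 / ((of_nat (Suc m) * z + of_nat (Suc n))\<^sup>2 * (of_nat (Suc m) * z + of_nat n))"
proof -
  have A: "1 / x\<^sup>2 - (1 / x - 1 / y) = 1 / (x\<^sup>2 * y)" if "x \<noteq> 0" "y \<noteq> 0" "x + 1 = y" for x y :: complex
    using that by (simp add: divide_simps power2_eq_square, simp flip: that(3) add: algebra_simps)
  have B: "1 / x\<^sup>2 - (1 / y - 1 / x) = - 1 / (x\<^sup>2 * y)" if "x \<noteq> 0" "y \<noteq> 0" "x = y + 1" for x y :: complex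
    using that(1,2) by (simp add: divide_simps power2_eq_square) (simp add: that(3) algebra_simps)
  have e: "of_nat (Suc m) * z - of_nat (Suc n) + 1 = of_nat (Suc m) * z - of_nat n" by simp
  note A' = A[OF nz(2) nz(2) e]
  have e': "of_nat (Suc m) * z + of_nat (Suc n) = (of_nat (Suc m) * z + of_nat n) + 1" by simp
  note B' = B[OF nz(1) nz(1) e']
  have *: "a + b - (c - d - (e - f)) = (b - (c - e)) + (a - (f - d))" for a b c d e f :: complex by simp
  have **: "x + - 1 / y = x - 1 / y" for x y :: complex by simp
  show ?thesis unfolding u_def v_def g_def * A' B' ** ..
qed

private lemma summable_u_minus_v: "(\<lambda>(m, n). u m n - v m n) summable_on (UNIV \<times> UNIV)"
proof -
  obtain c where c: "c > 0" "\<And>(m::real) k. m \<ge> 0 \<Longrightarrow> norm (of_real m * z + of_real k) \<ge> c * m"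
    "\<And>(m::real) k. m \<ge> 0 \<Longrightarrow> norm (of_real m * z + of_real k) \<ge> c * \<bar>k\<bar>"
    using lattice_norm_lower_bound[OF z] by blast
  have bd: "norm (1 / ((of_real M * z + of_real k)\<^sup>2 * (of_real M * z + of_real l))) \<le>
       1 / c ^ 3 * M powr (-3/2) * N powr (-3/2)"
    if "\<bar>k\<bar> = N" "M > 0" "N > 0" for M N k l :: real
  proof -
    define x where "x = norm (of_real M * z + of_real k)"
    define y where "y = norm (of_real M * z + of_real l)"
    have x: "x \<ge> c * M" "x \<ge> c * N" "y \<ge> c * M"
      unfolding x_def y_def using that c(2)[of M k] c(2)[of M l] c(3)[of M k] by auto
    have pos: "c * M > 0" "c * N > 0" using that c by auto
    hence "x > 0" "y > 0" using x by linarith+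
    \<comment> \<open>The denominator x^2 y is split as x^(1/2) x^(3/2) y: the outer factors are
      bounded below by powers of M, together M^(3/2), and the middle one by N^(3/2).\<close>
    have "c ^ 3 * M powr (3/2) * N powr (3/2) = (c * M) powr (1/2) * (c * N) powr (3/2) * (c * M)"
    proof -
      have "c ^ 3 = c powr 3" using c by simp
      also have "c powr 3 = c powr (1/2) * c powr (3/2) * c powr 1"
        by (simp only: flip: powr_add) simp
      finally have 1: "c ^ 3 = c powr (1/2) * c powr (3/2) * c" using c by simp
      have "M powr (3/2) = M powr (1/2) * M powr 1" by (simp only: flip: powr_add) simp
      hence 2: "M powr (3/2) = M powr (1/2) * M" using that by simp
      show ?thesis unfolding 1 2 using that c by (simp add: powr_mult)
    qed
    also have "\<dots> \<le> x powr (1/2) * x powr (3/2) * y"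
      using x pos \<open>x > 0\<close> \<open>y > 0\<close> by (intro mult_mono powr_mono2) auto
    also have "x powr (1/2) * x powr (3/2) = x powr 2" by (simp only: flip: powr_add) simp
    also have "x powr 2 = x\<^sup>2" using \<open>x > 0\<close> by simp
    finally have "c ^ 3 * M powr (3/2) * N powr (3/2) \<le> x\<^sup>2 * y" .
    hence "1 / (x\<^sup>2 * y) \<le> 1 / (c ^ 3 * M powr (3/2) * N powr (3/2))"
      using that c \<open>x > 0\<close> \<open>y > 0\<close> by (intro divide_left_mono mult_pos_pos zero_less_power) auto
    also have "\<dots> = 1 / c ^ 3 * M powr (-3/2) * N powr (-3/2)"
      using powr_minus_divide[of M "3/2"] powr_minus_divide[of N "3/2"] by simp
    finally show ?thesis unfolding x_def y_def by (simp only: norm_divide norm_mult norm_power norm_one)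
  qed
  show ?thesis
  proof (rule abs_summable_summable, rule Infinite_Sum.abs_summable_on_comparison_test')
    show "(\<lambda>(m, n). 2 / c ^ 3 * real (Suc m) powr (-3/2) * real (Suc n) powr (-3/2)) summable_on (UNIV \<times> UNIV)"
      by (rule summable_on_product_powr)
    fix p :: "nat \<times> nat"
    obtain m n where p: "p = (m, n)" by (cases p)
    have "norm (u m n - v m n) \<le> 1 / c ^ 3 * real (Suc m) powr (-3/2) * real (Suc n) powr (-3/2)
       + 1 / c ^ 3 * real (Suc m) powr (-3/2) * real (Suc n) powr (-3/2)"
      unfolding u_minus_v
      using bd[of "- real (Suc n)" "real (Suc n)" "real (Suc m)" "- real n"]
        bd[of "real (Suc n)" "real (Suc n)" "real (Suc m)" "real n"]
      by (intro order.trans[OF norm_triangle_ineq4] add_mono)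
         (simp_all only: of_real_minus of_real_of_nat_eq abs_minus_cancel abs_of_nat
             add_uminus_conv_diff of_nat_0_less_iff zero_less_Suc simp_thms)
    thus "norm (case p of (m, n) \<Rightarrow> u m n - v m n) \<le>
        (case p of (m, n) \<Rightarrow> 2 / c ^ 3 * real (Suc m) powr (-3/2) * real (Suc n) powr (-3/2))"
      unfolding p by simp
  qed
qed

private lemma v_sums: "(\<lambda>n. v m n) sums 0"
proof -
  have "(\<lambda>n. g n m) \<longlonglongrightarrow> 0 - 0"
    unfolding g_def
    by (intro tendsto_diff tendsto_divide_0[OF tendsto_const]
          filterlim_compose[OF tendsto_add_filterlim_at_infinity[OF tendsto_const] tendsto_of_nat]
        tendsto_add_filterlim_at_infinity[OF tendsto_const] tendsto_of_nat
        tendsto_add_filterlim_at_infinity[OF tendsto_const, where g = "\<lambda>n. - of_nat n", simplified])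
       (simp_all add: filterlim_at_infinity_conv_norm_at_top filterlim_real_sequentially)
  from telescope_sums[OF this] show ?thesis by (simp add: v_def g_def)
qed

private lemma not_Ints: "of_nat (Suc n) / z \<notin> \<int>"
proof
  assume "of_nat (Suc n) / z \<in> \<int>"
  then obtain k where k: "of_nat (Suc n) / z = of_int k" by (auto elim: Ints_cases)
  have "z \<noteq> 0" using z by auto
  hence "of_nat (Suc n) = of_int k * z" using k by (simp add: field_simps del: of_nat_Suc)
  hence "Im (of_nat (Suc n)) = Im (of_int k * z)" by simp
  hence "k = 0" using z by simp
  with k \<open>z \<noteq> 0\<close> show False by (simp del: of_nat_Suc)
qed

text \<open>The sum of \<open>g n m\<close> over m, obtained from the cotangent series at n / z. For
  n = 0 the two fractions in \<open>g\<close> cancel, so the true value 0 is inserted where the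
  formula would divide by 0.\<close>

private definition G where
  "G n = (if n = 0 then 0 else - (of_real pi * cot (of_real pi * (of_nat n / z)) - z / of_nat n) / z)"

private lemma g_sums: "(\<lambda>m. g n m) sums G n"
proof (cases n)
  case 0 thus ?thesis by (simp add: g_def G_def)
next
  case (Suc k)
  have z0: "z \<noteq> 0" using z by auto
  define w where "w = of_nat n / z"
  have w: "w \<notin> \<int>" unfolding w_def Suc by (rule not_Ints)
  have "- 1 / z * (of_real pi * cot (of_real pi * w) - 1 / w) = G n"
    using Suc unfolding G_def w_def by (simp add: diff_divide_distrib del: of_nat_Suc)
  with sums_mult[OF pi_cot_partial_fractions[OF w], of "- 1 / z"]
  have "(\<lambda>m. - 1 / z * (2 * w / (w\<^sup>2 - (of_nat (Suc m))\<^sup>2))) sums G n"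
    by (simp only:)
  moreover have "- 1 / z * (2 * w / (w\<^sup>2 - (of_nat (Suc m))\<^sup>2)) = g n m" for m
  proof -
    have "w\<^sup>2 - (of_nat (Suc m))\<^sup>2 = - ((of_nat (Suc m) * z + of_nat n) * (of_nat (Suc m) * z - of_nat n)) / z\<^sup>2"
      using z0 unfolding w_def by (simp add: field_simps power2_eq_square del: of_nat_Suc)
    hence "- 1 / z * (2 * w / (w\<^sup>2 - (of_nat (Suc m))\<^sup>2)) =
       2 * of_nat n / ((of_nat (Suc m) * z + of_nat n) * (of_nat (Suc m) * z - of_nat n))"
      using z0 nz[of m n] unfolding w_def by (simp add: power2_eq_square del: of_nat_Suc)
    also have "\<dots> = g n m" unfolding g_def using nz[of m n]
      by (simp add: divide_simps del: of_nat_Suc)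
    finally show ?thesis .
  qed
  ultimately show ?thesis by simp
qed

text \<open>The points n / z run to infinity in the lower half-plane, where the cotangent tends to
  i: it equals i (1 + r^n) / (1 - r^n) with |r| < 1. This limit is the origin of the anomalous term
  in the inversion law of E_2.\<close>

private lemma G_lim: "G \<longlonglongrightarrow> - of_real pi * \<i> / z"
proof -
  have z0: "z \<noteq> 0" using z by auto
  define r where "r = exp (- 2 * \<i> * of_real pi / z)"
  have Iz: "Im (1 / z) < 0" using z z0 by (simp add: Im_divide divide_simps zero_less_power2 sum_power2_gt_zero_iff complex_eq_iff)
  have "norm r = exp (2 * pi * Im (1 / z))"
  proof -
    have "Re (- 2 * \<i> * of_real pi / z) = Re (- 2 * \<i> * of_real pi * (1 / z))" by simp
    also have "\<dots> = 2 * pi * Im (1 / z)" by (simp only: times_complex.sel) simp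
    finally show ?thesis by (simp add: r_def)
  qed
  hence r1: "norm r < 1" using Iz by (simp add: mult_pos_neg)
  have ct: "cot (of_real pi * (of_nat n / z)) = \<i> * (1 + r ^ n) / (1 - r ^ n)" if "n > 0" for n
  proof -
    define t where "t = of_real pi * (of_nat n / z)"
    have E: "exp (-(2 * \<i> * t)) = r ^ n"
      unfolding r_def t_def exp_of_nat_mult[symmetric] by (simp add: algebra_simps)
    have e2: "r ^ n = exp (-(\<i> * t)) / exp (\<i> * t)" unfolding E[symmetric]
      by (simp add: exp_minus divide_inverse flip: exp_add mult_exp_exp power2_eq_square exp_double)
         (simp add: mult.assoc exp_double power2_eq_square)
    have "norm (r ^ n) < 1" using r1 that by (simp add: norm_power power_less_one_iff)
    hence ne: "1 - r ^ n \<noteq> 0" by auto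
    have "cot t = \<i> * (exp (\<i> * t) + exp (-(\<i> * t))) / (exp (\<i> * t) - exp (-(\<i> * t)))"
      unfolding cot_def sin_exp_eq cos_exp_eq by (simp add: divide_simps)
    also have "\<dots> = \<i> * (1 + r ^ n) / (1 - r ^ n)" unfolding e2
      using ne unfolding e2 by (simp add: divide_simps)
    finally show ?thesis unfolding t_def .
  qed
  have rn: "(\<lambda>n. r ^ n) \<longlonglongrightarrow> 0" using r1 by (rule LIMSEQ_power_zero)
  have "(\<lambda>n. - (of_real pi * (\<i> * (1 + r ^ n) / (1 - r ^ n)) - z / of_nat n) / z) \<longlonglongrightarrow>
     - (of_real pi * (\<i> * (1 + 0) / (1 - 0)) - 0) / z"
    by (intro tendsto_intros rn tendsto_divide_0[OF tendsto_const] tendsto_of_nat) (use z0 in auto)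
  hence *: "(\<lambda>n. - (of_real pi * (\<i> * (1 + r ^ n) / (1 - r ^ n)) - z / of_nat n) / z) \<longlonglongrightarrow> - of_real pi * \<i> / z"
    by simp
  show ?thesis
    by (rule Lim_transform_eventually[OF *], rule eventually_mono[OF eventually_gt_at_top[of 0]])
       (simp only: G_def ct if_False gr_implies_not0)
qed

private lemma v_sums': "(\<lambda>m. v m n) sums (G (Suc n) - G n)"
  unfolding v_def by (intro sums_diff g_sums)

private lemma Sum_inner: "(\<lambda>n. G (Suc n) - G n) sums (- of_real pi * \<i> / z)"
  using telescope_sums[OF G_lim] by (simp add: G_def)

text \<open>The two orders of summation agree for \<open>u - v\<close>. The rows of \<open>v\<close>
  sum to 0, but its columns sum to G (n + 1) - G n, which telescopes to the limit of
  \<open>G\<close>; that limit is the whole discrepancy.\<close>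

lemma double_series_swap:
  fixes a b :: "nat \<Rightarrow> complex"
  assumes a: "\<And>m. (\<lambda>n. 1 / (of_nat (Suc m) * z + of_nat (Suc n))\<^sup>2 +
         1 / (of_nat (Suc m) * z - of_nat (Suc n))\<^sup>2) sums a m"
  assumes b: "\<And>n. (\<lambda>m. 1 / (of_nat (Suc m) * z + of_nat (Suc n))\<^sup>2 +
         1 / (of_nat (Suc m) * z - of_nat (Suc n))\<^sup>2) sums b n"
  assumes A: "a sums A"
  shows "b sums (A - of_real pi * \<i> / z)"
proof -
  define S where "S = (\<Sum>\<^sub>\<infinity>(m, n)\<in>UNIV \<times> UNIV. u m n - v m n)"
  have S: "((\<lambda>(m, n). u m n - v m n) has_sum S) (UNIV \<times> UNIV)"
    unfolding S_def using summable_u_minus_v by simp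
  have S': "((\<lambda>(n, m). u m n - v m n) has_sum S) (UNIV \<times> UNIV)"
    using S by (subst (asm) has_sum_swap) simp
  have "(a has_sum S) UNIV"
  proof (rule has_sum_SigmaD[OF S])
    fix m
    have "(\<lambda>n. u m n - v m n) summable_on UNIV"
      using summable_on_SigmaD1[OF summable_u_minus_v] by auto
    hence h: "((\<lambda>n. u m n - v m n) has_sum (\<Sum>\<^sub>\<infinity>n. u m n - v m n)) UNIV" by simp
    have "(\<lambda>n. u m n - v m n) sums (a m - 0)"
      using a[of m] v_sums[of m] unfolding u_def by (rule sums_diff)
    from sums_unique2[OF has_sum_imp_sums[OF h] this] h
    show "((\<lambda>n. case (m, n) of (m, n) \<Rightarrow> u m n - v m n) has_sum a m) UNIV" by simp
  qed
  from sums_unique2[OF has_sum_imp_sums[OF this] A] have SA: "S = A" .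
  have "((\<lambda>n. b n - (G (Suc n) - G n)) has_sum S) UNIV"
  proof (rule has_sum_SigmaD[OF S'])
    fix n
    have "(\<lambda>(n, m). u m n - v m n) summable_on (UNIV \<times> UNIV)"
      using S' unfolding summable_on_def by blast
    hence "(\<lambda>m. u m n - v m n) summable_on UNIV"
      by (rule summable_on_SigmaD1[of "\<lambda>n m. u m n - v m n"]) auto
    hence h: "((\<lambda>m. u m n - v m n) has_sum (\<Sum>\<^sub>\<infinity>m. u m n - v m n)) UNIV" by simp
    have "(\<lambda>m. u m n - v m n) sums (b n - (G (Suc n) - G n))"
      using b[of n] v_sums'[of n] unfolding u_def by (rule sums_diff)
    from sums_unique2[OF has_sum_imp_sums[OF h] this] h
    show "((\<lambda>m. case (n, m) of (n, m) \<Rightarrow> u m n - v m n) has_sum b n - (G (Suc n) - G n)) UNIV" by simp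
  qed
  from sums_add[OF has_sum_imp_sums[OF this] Sum_inner]
  show ?thesis by (simp add: SA)
qed

end

section \<open>The eta function under inversion\<close>

definition euler_phi :: "complex \<Rightarrow> complex" where
  "euler_phi x = prodinf (\<lambda>n. 1 - x ^ Suc n)"

lemma norm_power_Suc_less_one: "norm (x :: complex) < 1 \<Longrightarrow> norm (x ^ Suc n) < 1"
  by (metis norm_power norm_ge_zero power_Suc_less_one zero_less_Suc power_less_one_iff nat.distinct(1))

text \<open>Around each point of the disc the logarithms of the factors are dominated by a geometric
  series, so they can be summed and differentiated termwise. The product is the exponential of that
  sum, hence has no zero, and D is its logarithmic derivative.\<close>

lemma euler_phi_deriv:
  assumes "norm x < 1"
  shows "euler_phi x \<noteq> 0"
    "\<exists>D. (\<lambda>n. - of_nat (Suc n) * x ^ n / (1 - x ^ Suc n)) sums D \<and>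
         (euler_phi has_field_derivative euler_phi x * D) (at x)"
proof -
  define S where "S = ball (0::complex) 1"
  have S: "open S" by (simp add: S_def)
  have xS: "x \<in> S" using assms by (simp add: S_def)
  have ne: "1 - y ^ Suc n \<noteq> 0" if "y \<in> S" for y n
    using norm_power_Suc_less_one[of y n] that by (auto simp: S_def)
  have "\<exists>g g'. \<forall>x\<in>S. ((\<lambda>n. Ln (1 - x ^ Suc n)) sums g x) \<and>
       ((\<lambda>n. - of_nat (Suc n) * x ^ n / (1 - x ^ Suc n)) sums g' x) \<and> (g has_field_derivative g' x) (at x)"
  proof (rule series_and_derivative_comparison_local[OF S])
    fix n y assume y: "y \<in> S"
    have "norm (y ^ Suc n) < 1" using norm_power_Suc_less_one[of y n] y by (simp add: S_def)
    hence "\<bar>Re (y ^ Suc n)\<bar> < 1" using abs_Re_le_cmod[of "y ^ Suc n"] by linarith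
    hence "1 - y ^ Suc n \<notin> \<real>\<^sub>\<le>\<^sub>0" by (auto simp: complex_nonpos_Reals_iff)
    thus "((\<lambda>y. Ln (1 - y ^ Suc n)) has_field_derivative - of_nat (Suc n) * y ^ n / (1 - y ^ Suc n)) (at y)"
      using ne[OF y, of n] by (auto intro!: derivative_eq_intros simp del: power_Suc of_nat_Suc simp: divide_simps)
  next
    fix y assume y: "y \<in> S"
    define r where "r = (1 + norm y) / 2"
    have r: "0 < r" "r < 1" "norm y < r" using y by (auto simp: r_def S_def add_pos_nonneg)
    have "(\<lambda>n. r ^ n) \<longlonglongrightarrow> 0" using r by (intro LIMSEQ_power_zero) auto
    hence "(\<lambda>n. r ^ Suc n) \<longlonglongrightarrow> 0" by (rule LIMSEQ_Suc)
    hence ev: "\<forall>\<^sub>F n in sequentially. r ^ Suc n < 1 / 2" by (rule order_tendstoD) auto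
    have bd: "\<forall>\<^sub>F n in sequentially. \<forall>w\<in>ball y (r - norm y) \<inter> S. norm (Ln (1 - w ^ Suc n)) \<le> 2 * r ^ Suc n"
      using ev
    proof eventually_elim
      case (elim n)
      show ?case
      proof
        fix w assume w: "w \<in> ball y (r - norm y) \<inter> S"
        have "norm w \<le> norm y + dist y w" using norm_triangle_ineq2[of w y]  by (simp add: dist_norm norm_minus_commute)
        hence "norm w \<le> r" using w by simp
        hence le: "norm (w ^ Suc n) \<le> r ^ Suc n" unfolding norm_power by (intro power_mono) auto
        hence "norm (- (w ^ Suc n)) < 1 / 2" using elim by simp
        from norm_Ln_le[OF this] le show "norm (Ln (1 - w ^ Suc n)) \<le> 2 * r ^ Suc n" by simp
      qed
    qed
    have "summable (\<lambda>n. 2 * r ^ Suc n)" using r by (intro summable_mult) (simp add: summable_Suc_iff[of "\<lambda>n. r ^ n"] summable_geometric)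
    with bd r show "\<exists>d h. 0 < d \<and> summable h \<and> (\<forall>\<^sub>F n in sequentially. \<forall>w\<in>ball y d \<inter> S. norm (Ln (1 - w ^ Suc n)) \<le> h n)"
      by (intro exI[of _ "r - norm y"] exI[of _ "\<lambda>n. 2 * r ^ Suc n"]) auto
  qed
  then obtain g g' where g: "\<And>x. x \<in> S \<Longrightarrow> (\<lambda>n. Ln (1 - x ^ Suc n)) sums g x"
     "\<And>x. x \<in> S \<Longrightarrow> (\<lambda>n. - of_nat (Suc n) * x ^ n / (1 - x ^ Suc n)) sums g' x"
     "\<And>x. x \<in> S \<Longrightarrow> (g has_field_derivative g' x) (at x)" by blast
  have phi: "euler_phi y = exp (g y)" if "y \<in> S" for y
  proof -
    have "(\<lambda>n. exp (Ln (1 - y ^ Suc n))) has_prod exp (g y)"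
      using prodinf_exp[of "\<lambda>n. Ln (1 - y ^ Suc n)"] convergent_prod_exp[of "\<lambda>n. Ln (1 - y ^ Suc n)"] g(1)[OF that]
      by (simp add: has_prod_iff sums_iff del: power_Suc)
    also have "(\<lambda>n. exp (Ln (1 - y ^ Suc n))) = (\<lambda>n. 1 - y ^ Suc n)"
      using ne[OF that] by (auto simp del: power_Suc)
    finally show ?thesis unfolding euler_phi_def using has_prod_unique by metis
  qed
  show "euler_phi x \<noteq> 0" using phi[OF xS] by simp
  have "((\<lambda>y. exp (g y)) has_field_derivative exp (g x) * g' x) (at x)"
    by (auto intro!: derivative_eq_intros g(3)[OF xS])
  hence "(euler_phi has_field_derivative exp (g x) * g' x) (at x)"
    by (rule has_field_derivative_transform_within_open[OF _ S xS]) (simp add: phi)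
  thus "\<exists>D. (\<lambda>n. - of_nat (Suc n) * x ^ n / (1 - x ^ Suc n)) sums D \<and>
         (euler_phi has_field_derivative euler_phi x * D) (at x)"
    using g(2)[OF xS] phi[OF xS] by auto
qed

lemma euler_phi_holomorphic: "euler_phi holomorphic_on ball 0 1"
  unfolding holomorphic_on_open[OF open_ball] using euler_phi_deriv(2) by (metis dist_0_norm mem_ball)

lemma euler_phi_0: "euler_phi 0 = 1"
  by (simp add: euler_phi_def)

text \<open>Both series are iterated sums of (n + 1) x^((n + 1)(k + 1)): summing over k first uses
  the geometric series, summing over n first its derivative.\<close>

lemma Lambert_sigma_sums:
  fixes x :: complex
  assumes x: "norm x < 1" and S: "(\<lambda>n. of_nat (Suc n) * x ^ Suc n / (1 - x ^ Suc n)) sums S"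
  shows "(\<lambda>k. x ^ Suc k / (1 - x ^ Suc k)\<^sup>2) sums S"
proof -
  define F where "F = (\<lambda>(n, k). of_nat (Suc n) * x ^ (Suc n * Suc k))"
  define r where "r = norm x"
  have r: "0 \<le> r" "r < 1" using x by (auto simp: r_def)
  have rS: "r ^ Suc n < 1" "r ^ Suc n \<ge> 0" for n
    using norm_power_Suc_less_one[OF x, of n] by (auto simp: r_def norm_power simp del: power_Suc)
  have nF: "norm (F (n, k)) = real (Suc n) * (r ^ Suc n) ^ Suc k" for n k
    unfolding F_def r_def by (simp only: prod.case norm_mult norm_power power_mult norm_of_nat)
  have in1: "(\<lambda>k. y ^ Suc k) sums (y / (1 - y))" if "norm y < 1" for y :: "'a :: real_normed_field"
    using sums_mult[OF geometric_sums[OF that], of y] by simp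
  have "(\<lambda>p. norm (F p)) summable_on (UNIV \<times> UNIV)"
  proof (rule summable_on_SigmaI)
    fix n :: nat
    have "(\<lambda>k. norm (F (n, k))) sums (real (Suc n) * (r ^ Suc n / (1 - r ^ Suc n)))"
      unfolding nF using rS[of n] by (intro sums_mult in1) auto
    thus "((\<lambda>k. norm (F (n, k))) has_sum (real (Suc n) * (r ^ Suc n / (1 - r ^ Suc n)))) UNIV"
      by (rule sums_nonneg_imp_has_sum) auto
  next
    have 1: "summable (\<lambda>n. (1 / (1 - r)) * (r * (real (Suc n) * r ^ n)))"
      using r geometric_deriv_sums[of r] by (intro summable_mult) (auto simp: sums_iff)
    have "summable (\<lambda>n. real (Suc n) * (r ^ Suc n / (1 - r ^ Suc n)))"
    proof (rule summable_comparison_test'[OF 1])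
      fix n :: nat
      have "r ^ Suc n / (1 - r ^ Suc n) \<le> r ^ Suc n / (1 - r)"
      proof (rule divide_left_mono)
        have "r ^ Suc n \<le> r ^ 1" using r by (intro power_decreasing) auto
        thus "1 - r \<le> 1 - r ^ Suc n" by simp
      qed (use rS[of n] r in auto)
      hence "real (Suc n) * (r ^ Suc n / (1 - r ^ Suc n)) \<le> real (Suc n) * (r ^ Suc n / (1 - r))"
        by (intro mult_left_mono) auto
      also have "\<dots> = (1 / (1 - r)) * (r * (real (Suc n) * r ^ n))" by simp
      finally show "norm (real (Suc n) * (r ^ Suc n / (1 - r ^ Suc n))) \<le> (1 / (1 - r)) * (r * (real (Suc n) * r ^ n))"
        using rS[of n] by (simp add: abs_mult del: power_Suc of_nat_Suc)
    qed
    thus "(\<lambda>n. real (Suc n) * (r ^ Suc n / (1 - r ^ Suc n))) summable_on UNIV"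
      by (rule summable_nonneg_imp_summable_on) (intro mult_nonneg_nonneg divide_nonneg_nonneg, use rS in \<open>auto simp: less_imp_le simp del: power_Suc\<close>)
  qed auto
  hence sF: "F summable_on (UNIV \<times> UNIV)" by (rule abs_summable_summable)
  then obtain T where T: "(F has_sum T) (UNIV \<times> UNIV)" by (auto simp: summable_on_def)
  have i1: "((\<lambda>k. F (n, k)) has_sum (of_nat (Suc n) * x ^ Suc n / (1 - x ^ Suc n))) UNIV" for n
  proof -
    have h: "((\<lambda>k. F (n, k)) has_sum (\<Sum>\<^sub>\<infinity>k. F (n, k))) UNIV"
      using summable_on_SigmaD1[of "\<lambda>n k. F (n, k)" UNIV "\<lambda>_. UNIV" n] sF by simp
    have "(\<lambda>k. F (n, k)) sums (of_nat (Suc n) * (x ^ Suc n / (1 - x ^ Suc n)))"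
      unfolding F_def prod.case power_mult by (intro sums_mult in1 norm_power_Suc_less_one x)
    from sums_unique2[OF has_sum_imp_sums[OF h] this] h show ?thesis by simp
  qed
  from has_sum_SigmaD[OF T i1] have "T = S" using S sums_unique2 has_sum_imp_sums by blast
  have T': "((\<lambda>(k, n). F (n, k)) has_sum T) (UNIV \<times> UNIV)"
    using T by (subst (asm) has_sum_swap) simp
  hence sF': "(\<lambda>(k, n). F (n, k)) summable_on (UNIV \<times> UNIV)" unfolding summable_on_def by blast
  have i2: "((\<lambda>n. F (n, k)) has_sum (x ^ Suc k / (1 - x ^ Suc k)\<^sup>2)) UNIV" for k
  proof -
    have h: "((\<lambda>n. F (n, k)) has_sum (\<Sum>\<^sub>\<infinity>n. F (n, k))) UNIV"
      using summable_on_SigmaD1[OF sF', of k] by simp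
    have "(\<lambda>n. x ^ Suc k * (of_nat (Suc n) * (x ^ Suc k) ^ n)) sums (x ^ Suc k * (1 / (1 - x ^ Suc k)\<^sup>2))"
      by (intro sums_mult geometric_deriv_sums norm_power_Suc_less_one x)
    also have "(\<lambda>n. x ^ Suc k * (of_nat (Suc n) * (x ^ Suc k) ^ n)) = (\<lambda>n. F (n, k))"
    proof (rule ext)
      fix n
      have "x ^ (Suc n * Suc k) = (x ^ Suc k) ^ Suc n" by (simp only: mult.commute[of "Suc n"] power_mult)
      also have "\<dots> = x ^ Suc k * (x ^ Suc k) ^ n" by (rule power_Suc)
      finally show "x ^ Suc k * (of_nat (Suc n) * (x ^ Suc k) ^ n) = F (n, k)"
        unfolding F_def prod.case by (simp only: mult_ac)
    qed
    finally have "(\<lambda>n. F (n, k)) sums (x ^ Suc k / (1 - x ^ Suc k)\<^sup>2)" by simp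
    from sums_unique2[OF has_sum_imp_sums[OF h] this] h show ?thesis by simp
  qed
  have "((\<lambda>k. x ^ Suc k / (1 - x ^ Suc k)\<^sup>2) has_sum T) UNIV"
    by (rule has_sum_SigmaD[OF T']) (use i2 in auto)
  thus ?thesis using \<open>T = S\<close> has_sum_imp_sums by blast
qed

section \<open>The logarithmic derivative of eta and its behaviour under z -> -1/z\<close>

abbreviation qq :: "complex \<Rightarrow> complex" where "qq z \<equiv> exp (2 * of_real pi * \<i> * z)"

lemma norm_qq_less_1: "Im z > 0 \<Longrightarrow> norm (qq z) < 1"
  by (simp add: mult_pos_pos)

lemma eta_conv_euler_phi: "eta z = exp (2 * of_real pi * \<i> * z / 24) * euler_phi (qq z)"
  by (simp add: eta_def euler_phi_def)

lemma eta_nonzero: "Im z > 0 \<Longrightarrow> eta z \<noteq> 0"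
  unfolding eta_conv_euler_phi using euler_phi_deriv(1)[OF norm_qq_less_1] by simp

text \<open>\<open>1 + 6 / pi^2 * csc2_sum z\<close> is the Eisenstein series E_2. In this form each
  term is the sum of 1/(m z + n)^2 over one complete row of the lattice.\<close>

definition csc2_sum :: "complex \<Rightarrow> complex" where
  "csc2_sum z = (\<Sum>m. of_real pi ^ 2 / sin (of_real pi * (of_nat (Suc m) * z)) ^ 2)"

lemma not_in_Ints_upper: "Im z \<noteq> 0 \<Longrightarrow> z \<notin> \<int>"
  by (auto elim!: Ints_cases)

text \<open>Logarithmic differentiation of the product gives a Lambert series in x = q; rearranged,
  its terms are squared cosecants, because pi^2 / sin^2(pi m z) = -4 pi^2 x^m / (1 - x^m)^2.\<close>

lemma eta_logderiv:
  assumes z: "Im z > 0"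
  shows "(\<lambda>m. of_real pi ^ 2 / sin (of_real pi * (of_nat (Suc m) * z)) ^ 2) sums csc2_sum z" (is ?A)
    "(eta has_field_derivative eta z * (2 * of_real pi * \<i> / 24 * (1 + 6 / of_real pi ^ 2 * csc2_sum z))) (at z)" (is ?B)
proof -
  define x where "x = qq z"
  have x: "norm x < 1" unfolding x_def using z by (rule norm_qq_less_1)
  obtain D where D: "(\<lambda>n. - of_nat (Suc n) * x ^ n / (1 - x ^ Suc n)) sums D"
    "(euler_phi has_field_derivative euler_phi x * D) (at x)"
    using euler_phi_deriv(2)[OF x] by blast
  have "(\<lambda>n. of_nat (Suc n) * x ^ Suc n / (1 - x ^ Suc n)) sums (- x * D)"
    using sums_mult[OF D(1), of "- x"] by (simp add: mult_ac del: of_nat_Suc)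
  from Lambert_sigma_sums[OF x this]
  have L: "(\<lambda>k. x ^ Suc k / (1 - x ^ Suc k)\<^sup>2) sums (- x * D)" .
  have eq: "of_real pi ^ 2 / sin (of_real pi * (of_nat (Suc m) * z)) ^ 2 =
      - 4 * of_real pi ^ 2 * (x ^ Suc m / (1 - x ^ Suc m)\<^sup>2)" for m
  proof -
    define t where "t = of_real pi * (of_nat (Suc m) * z)"
    define e where "e = exp (\<i> * t)"
    have e0: "e \<noteq> 0" by (simp add: e_def)
    have xe: "x ^ Suc m = e ^ 2"
      unfolding x_def e_def t_def exp_of_nat_mult[symmetric] by (simp add: algebra_simps)
    have "sin t = (e - 1 / e) / (2 * \<i>)"
      unfolding sin_exp_eq e_def exp_minus inverse_eq_divide ..
    also have "\<dots> = (e ^ 2 - 1) / (2 * \<i> * e)" using e0 by (simp add: field_simps power2_eq_square)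
    finally have "sin t ^ 2 = - ((1 - e ^ 2) ^ 2) / (4 * e ^ 2)"
      by (simp add: power_divide power_mult_distrib power2_commute)
    thus ?thesis unfolding xe t_def[symmetric] by simp
  qed
  have s: "(\<lambda>m. of_real pi ^ 2 / sin (of_real pi * (of_nat (Suc m) * z)) ^ 2) sums (- 4 * of_real pi ^ 2 * (- x * D))"
    unfolding eq by (intro sums_mult L)
  hence c: "csc2_sum z = 4 * of_real pi ^ 2 * (x * D)" unfolding csc2_sum_def using sums_unique by fastforce
  show ?A using s c by simp
  have "((\<lambda>z. exp (2 * of_real pi * \<i> * z / 24) * euler_phi (qq z)) has_field_derivative
     (exp (2 * of_real pi * \<i> * z / 24) * (2 * of_real pi * \<i> / 24)) * euler_phi (qq z) +
     (euler_phi x * D * (x * (2 * of_real pi * \<i>))) * exp (2 * of_real pi * \<i> * z / 24)) (at z)"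
  proof (rule DERIV_mult)
    have dq: "(qq has_field_derivative x * (2 * of_real pi * \<i>)) (at z)"
      unfolding x_def by (auto intro!: derivative_eq_intros)
    show "((\<lambda>z. euler_phi (qq z)) has_field_derivative euler_phi x * D * (x * (2 * of_real pi * \<i>))) (at z)"
      by (rule DERIV_chain2[OF _ dq]) (use D(2) in \<open>simp add: x_def\<close>)
  qed (rule derivative_eq_intros refl | simp)+
  also have "(\<lambda>z. exp (2 * of_real pi * \<i> * z / 24) * euler_phi (qq z)) = eta"
    by (rule ext) (simp add: eta_conv_euler_phi)
  also have "(exp (2 * of_real pi * \<i> * z / 24) * (2 * of_real pi * \<i> / 24)) * euler_phi (qq z) +
     (euler_phi x * D * (x * (2 * of_real pi * \<i>))) * exp (2 * of_real pi * \<i> * z / 24) =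
     eta z * (2 * of_real pi * \<i> / 24 * (1 + 6 / of_real pi ^ 2 * csc2_sum z))"
    unfolding c eta_conv_euler_phi x_def[symmetric] by (simp add: field_simps)
  finally show ?B .
qed

text \<open>The rows of the lattice sum at -1/z are, up to the factor z^2, the columns of the sum at
  z, so the swapped double series applies. The entries 1/(m z)^2 are split off beforehand and
  account for the two terms pi^2/6 = zeta(2). In terms of E_2 this says E_2(-1/z) = z^2 E_2(z) + 6 z
  / (pi i).\<close>

lemma csc2_sum_inversion:
  assumes z: "Im z > 0"
  shows "csc2_sum (- 1 / z) = z\<^sup>2 * (of_real pi ^ 2 / 6 + csc2_sum z - of_real pi * \<i> / z) - of_real pi ^ 2 / 6"
proof -
  have z0: "z \<noteq> 0" using z by auto
  have z': "Im (- 1 / z) > 0" using z z0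
    by (simp add: Im_divide divide_simps zero_less_power2 sum_power2_gt_zero_iff complex_eq_iff)
  have "(\<lambda>n. of_real (1 / (real n + 1)\<^sup>2) :: complex) sums of_real (pi\<^sup>2 / 6)"
    using inverse_squares_sums by (simp only: sums_of_real_iff) (simp add: add.commute)
  hence zeta: "(\<lambda>n. 1 / (of_nat (Suc n))\<^sup>2 :: complex) sums (of_real pi ^ 2 / 6)"
    by (simp add: add.commute)
  define a where "a = (\<lambda>m. of_real pi ^ 2 / sin (of_real pi * (of_nat (Suc m) * z)) ^ 2 - 1 / (of_nat (Suc m) * z) ^ 2)"
  define b where "b = (\<lambda>n. (of_real pi ^ 2 / sin (of_real pi * (of_nat (Suc n) * (- 1 / z))) ^ 2 - 1 / (of_nat (Suc n) * (- 1 / z)) ^ 2) / z\<^sup>2)"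
  have a: "(\<lambda>n. 1 / (of_nat (Suc m) * z + of_nat (Suc n))\<^sup>2 +
         1 / (of_nat (Suc m) * z - of_nat (Suc n))\<^sup>2) sums a m" for m
    unfolding a_def by (rule pi_square_over_sin_square_sums, rule not_in_Ints_upper) (use z in \<open>simp del: of_nat_Suc\<close>)
  have b: "(\<lambda>m. 1 / (of_nat (Suc m) * z + of_nat (Suc n))\<^sup>2 +
         1 / (of_nat (Suc m) * z - of_nat (Suc n))\<^sup>2) sums b n" for n
  proof -
    define w where "w = of_nat (Suc n) * (- 1 / z)"
    have "Im w = real (Suc n) * Im (- 1 / z)" unfolding w_def by (simp only: times_complex.sel) simp
    hence "w \<notin> \<int>" using z' by (intro not_in_Ints_upper) (simp del: of_nat_Suc)
    from sums_divide[OF pi_square_over_sin_square_sums[OF this], of "z\<^sup>2"]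
    have "(\<lambda>m. (1 / (w + of_nat (Suc m))\<^sup>2 + 1 / (w - of_nat (Suc m))\<^sup>2) / z\<^sup>2) sums b n"
      unfolding w_def b_def .
    moreover have "(1 / (w + of_nat (Suc m))\<^sup>2 + 1 / (w - of_nat (Suc m))\<^sup>2) / z\<^sup>2 =
      1 / (of_nat (Suc m) * z + of_nat (Suc n))\<^sup>2 + 1 / (of_nat (Suc m) * z - of_nat (Suc n))\<^sup>2" for m
    proof -
      have 1: "(w + of_nat (Suc m)) * z = of_nat (Suc m) * z - of_nat (Suc n)"
        unfolding w_def using z0 by (simp add: field_simps del: of_nat_Suc)
      have "(w - of_nat (Suc m)) * z = - (of_nat (Suc m) * z + of_nat (Suc n))"
        unfolding w_def using z0 by (simp add: field_simps del: of_nat_Suc)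
      hence 2: "((w - of_nat (Suc m)) * z)\<^sup>2 = (of_nat (Suc m) * z + of_nat (Suc n))\<^sup>2"
        by (simp only: power2_minus)
      show ?thesis unfolding 1[symmetric] 2[symmetric] by (simp add: add_divide_distrib power_mult_distrib)
    qed
    ultimately show ?thesis by simp
  qed
  have A: "a sums (csc2_sum z - of_real pi ^ 2 / 6 / z\<^sup>2)"
    unfolding a_def
    using sums_diff[OF eta_logderiv(1)[OF z] sums_divide[OF zeta, of "z\<^sup>2"]] by (simp add: power_mult_distrib)
  have B: "b sums ((csc2_sum (- 1 / z) - of_real pi ^ 2 / 6 * z\<^sup>2) / z\<^sup>2)"
    unfolding b_def using sums_divide[OF sums_diff[OF eta_logderiv(1)[OF z'] sums_mult2[OF zeta, of "z\<^sup>2"]], of "z\<^sup>2"]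
    by (simp add: power_mult_distrib power_divide)
  have "(csc2_sum z - of_real pi ^ 2 / 6 / z\<^sup>2 - of_real pi * \<i> / z) * z\<^sup>2 = csc2_sum (- 1 / z) - of_real pi ^ 2 / 6 * z\<^sup>2"
    using z0 by (subst sums_unique2[OF double_series_swap[OF z a b A] B]) simp
  moreover have "(csc2_sum z - of_real pi ^ 2 / 6 / z\<^sup>2 - of_real pi * \<i> / z) * z\<^sup>2 =
     z\<^sup>2 * (csc2_sum z - of_real pi * \<i> / z) - of_real pi ^ 2 / 6"
    using z0 by (simp add: algebra_simps)
  ultimately show ?thesis by (simp add: algebra_simps)
qed

lemma Hplane_simps: "z \<in> Hplane \<longleftrightarrow> Im z > 0" "open Hplane" "convex Hplane" "connected Hplane"
proof -
  show "z \<in> Hplane \<longleftrightarrow> Im z > 0" by (simp add: Hplane_def)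
  show "open Hplane" unfolding Hplane_def by (rule open_halfspace_Im_gt)
  show "convex Hplane" unfolding Hplane_def by (rule convex_halfspace_Im_gt)
  thus "connected Hplane" by (rule convex_connected)
qed

text \<open>By the law for \<open>csc2_sum\<close> the quotient \<open>K\<close> has derivative 0,
  so it is constant, and its value is read off at the fixed point i of the inversion. The square
  avoids choosing a root of z, and \<open>h2\<close> and \<open>psi\<close> contain only even powers
  of eta.\<close>

lemma eta_square_inversion:
  assumes z: "Im z > 0"
  shows "eta (- 1 / z) ^ 2 = - \<i> * z * eta z ^ 2"
proof -
  define K where "K = (\<lambda>z. eta (- 1 / z) ^ 2 / (z * eta z ^ 2))"
  have "(K has_field_derivative 0) (at w)" if w: "w \<in> Hplane" for w
  proof -
    have Iw: "Im w > 0" using w by (simp add: Hplane_simps)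
    hence w0: "w \<noteq> 0" by auto
    have Iw': "Im (- 1 / w) > 0" using Iw w0
      by (simp add: Im_divide divide_simps zero_less_power2 sum_power2_gt_zero_iff complex_eq_iff)
    define L where "L = (\<lambda>z. 2 * of_real pi * \<i> / 24 * (1 + 6 / of_real pi ^ 2 * csc2_sum z))"
    have d1: "(eta has_field_derivative eta w * L w) (at w)"
      and d2: "(eta has_field_derivative eta (- 1 / w) * L (- 1 / w)) (at (- 1 / w))"
      using eta_logderiv(2) Iw Iw' unfolding L_def by blast+
    have d3: "((\<lambda>w. - 1 / w) has_field_derivative 1 / w ^ 2) (at w)"
      using w0 by (auto intro!: derivative_eq_intros simp: power2_eq_square)
    have d4: "((\<lambda>w. eta (- 1 / w)) has_field_derivative eta (- 1 / w) * L (- 1 / w) * (1 / w ^ 2)) (at w)"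
      using DERIV_chain2[OF d2 d3] .
    have LL: "L (- 1 / w) * (1 / w ^ 2) = L w + 1 / (2 * w)"
      unfolding L_def csc2_sum_inversion[OF Iw] using w0
      by (simp add: field_simps power2_eq_square)
    have d4': "((\<lambda>w. eta (- 1 / w)) has_field_derivative eta (- 1 / w) * (L w + 1 / (2 * w))) (at w)"
      using d4 unfolding mult.assoc LL .
    have "((\<lambda>w. F w ^ 2 / (w * eta w ^ 2)) has_field_derivative
      (((2 * (F w * F')) * (w * eta w ^ 2) - F w ^ 2 * (eta w ^ 2 + w * (2 * (eta w * (eta w * L w))))) / ((w * eta w ^ 2) * (w * eta w ^ 2)))) (at w)"
      if "(F has_field_derivative F') (at w)" for F F'
      unfolding power2_eq_square using w0 eta_nonzero[OF Iw]
      by (auto intro!: derivative_eq_intros d1 that simp: algebra_simps)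
    from this[OF d4'] have "(K has_field_derivative
      (((2 * (eta (- 1 / w) * (eta (- 1 / w) * (L w + 1 / (2 * w))))) * (w * eta w ^ 2) - eta (- 1 / w) ^ 2 * (eta w ^ 2 + w * (2 * (eta w * (eta w * L w))))) / ((w * eta w ^ 2) * (w * eta w ^ 2)))) (at w)"
      unfolding K_def .
    also have "(2 * (eta (- 1 / w) * (eta (- 1 / w) * (L w + 1 / (2 * w))))) * (w * eta w ^ 2) - eta (- 1 / w) ^ 2 * (eta w ^ 2 + w * (2 * (eta w * (eta w * L w)))) = 0"
      using w0 by (simp add: field_simps power2_eq_square)
    finally show ?thesis by simp
  qed
  then obtain c where c: "\<And>w. w \<in> Hplane \<Longrightarrow> K w = c"
    using has_field_derivative_zero_constant[of Hplane K] Hplane_simps(2-3)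
    by (metis has_field_derivative_at_within)
  have i: "\<i> \<in> Hplane" by (simp add: Hplane_simps)
  have "- 1 / \<i> = \<i>" by (simp add: field_simps)
  hence "c = - \<i>" using c[OF i] eta_nonzero[of \<i>] unfolding K_def by (simp add: divide_simps)
  hence "K z = - \<i>" using c[of z] z by (simp add: Hplane_simps)
  moreover have "eta (- 1 / z) ^ 2 = K z * (z * eta z ^ 2)"
    unfolding K_def using eta_nonzero[OF z] z by auto
  ultimately show ?thesis by simp
qed

section \<open>Forms for the Fricke group\<close>

text \<open>
  A form of weight two with multiplier \<open>\<nu>\<^sup>e\<close> on \<open>\<Gamma>\<^sub>0(2)\<close> and sign \<open>s\<close> under \<open>W\<^sub>2\<close>, together with its
  \<open>q\<^sup>1\<^sup>/\<^sup>4\<close>-expansion: the support condition on \<open>a\<close> encodes \<open>f(z + 1) = i\<^sup>e f(z)\<close>, and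
  translation and \<open>W\<^sub>2\<close> generate the group.
\<close>

definition mform :: "int \<Rightarrow> complex \<Rightarrow> (int \<Rightarrow> complex) \<Rightarrow> (complex \<Rightarrow> complex) \<Rightarrow> bool" where
  "mform e s a f \<longleftrightarrow> f holomorphic_on Hplane \<and>
     (\<forall>z\<in>Hplane. f (- 1 / (2 * z)) = 2 * s * z\<^sup>2 * f z) \<and>
     (\<forall>n. a n \<noteq> 0 \<longrightarrow> n mod 4 = e mod 4) \<and>
     (\<exists>N. \<forall>n<N. a n = 0) \<and>
     (\<forall>z\<in>Hplane. ((\<lambda>n. a n * qpow 4 n z) has_sum f z) UNIV)"

section \<open>From translation and W_2 to the transformation law on Gamma_0(2)\<close>

lemma i_powi_cong:
  assumes "m mod 4 = (n :: int) mod 4"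
  shows "\<i> powi m = \<i> powi n"
proof -
  obtain k where k: "m = n + 4 * k"
    using assms by (metis mod_eqE)
  have "\<i> powi (4 * k) = (\<i> powi 4) powi k" by (simp add: power_int_mult)
  also have "\<i> powi 4 = 1" by (simp add: power_int_def)
  finally show ?thesis by (simp add: k power_int_add)
qed

lemma exp_quarter: "exp (2 * of_real pi * \<i> * of_int n / 4) = \<i> powi n"
proof -
  have "exp (of_int n * (\<i> * of_real pi / 2)) = exp (\<i> * of_real pi / 2) powi n"
    by (simp add: exp_power_int)
  also have "exp (\<i> * of_real pi / 2) = \<i>"
    using cis_conv_exp[of "pi / 2"] by (simp add: cis_pi_half)
  finally show ?thesis by (simp add: algebra_simps)
qed

lemma mform_shift:
  assumes "mform e s a f" "z \<in> Hplane"
  shows "f (z + 1) = \<i> powi e * f z"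
proof -
  have z: "z + 1 \<in> Hplane" using assms(2) by (simp add: Hplane_simps)
  have 1: "((\<lambda>n. a n * qpow 4 n (z + 1)) has_sum f (z + 1)) UNIV" using assms(1) z by (auto simp: mform_def)
  have "((\<lambda>n. \<i> powi e * (a n * qpow 4 n z)) has_sum (\<i> powi e * f z)) UNIV"
    using assms by (intro has_sum_cmult_right) (auto simp: mform_def)
  also have "(\<lambda>n. \<i> powi e * (a n * qpow 4 n z)) = (\<lambda>n. a n * qpow 4 n (z + 1))"
  proof (rule ext)
    fix n
    show "\<i> powi e * (a n * qpow 4 n z) = a n * qpow 4 n (z + 1)"
    proof (cases "a n = 0")
      case False
      hence "n mod 4 = e mod 4" using assms(1) by (auto simp: mform_def)
      hence "\<i> powi e = exp (2 * of_real pi * \<i> * of_int n / 4)"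
        unfolding exp_quarter by (rule i_powi_cong[symmetric])
      thus ?thesis unfolding qpow_def by (simp add: ring_distribs add_divide_distrib exp_add)
    qed simp
  qed
  finally show ?thesis using 1 by (metis has_sum_unique)
qed

lemma Im_moebius:
  assumes "a * d - b * c = (1::int)" "Im z > 0"
  shows "of_int c * z + of_int d \<noteq> 0" "Im ((of_int a * z + of_int b) / (of_int c * z + of_int d)) > 0"
proof -
  show ne: "of_int c * z + of_int d \<noteq> 0"
  proof
    assume 0: "of_int c * z + of_int d = 0"
    hence "Im (of_int c * z + of_int d) = 0" by simp
    hence "c = 0" using assms by simp
    with 0 have "d = 0" by simp
    with \<open>c = 0\<close> assms show False by simp
  qed
  have "Im ((of_int a * z + of_int b) / (of_int c * z + of_int d)) =
     (of_int (a * d - b * c)) * Im z / (norm (of_int c * z + of_int d))\<^sup>2"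
    unfolding Im_divide cmod_power2 by (simp add: algebra_simps)
  also have "\<dots> > 0" using assms ne by simp
  finally show "Im ((of_int a * z + of_int b) / (of_int c * z + of_int d)) > 0" .
qed

lemma det_one_even_imp_odd:
  fixes a b c d :: int
  assumes "a * d - b * c = 1" "even c"
  shows "odd a" "odd d"
proof -
  have "a * d = 1 + b * c" using assms by simp
  hence "odd (a * d)" using assms(2) by simp
  thus "odd a" "odd d" by simp_all
qed

text \<open>This is the statement that nu is a character of Gamma_0(2). With c = 2 g and c' = 2 g'
  the determinant relations eliminate a d and a' d'; what remains is divisible by 4 because odd
  squares are 1 mod 4.\<close>

lemma nu_exponent_mult:
  fixes a b c d a' b' c' d' :: int
  assumes "a * d - b * c = 1" "even c" "a' * d' - b' * c' = 1" "even c'"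
  shows "((c * b' + d * d') * ((a * b' + b * d') - (c * a' + d * c') div 2)) mod 4 =
     (d * (b - c div 2) + d' * (b' - c' div 2)) mod 4"
proof -
  obtain g g' where g: "c = 2 * g" "c' = 2 * g'" using assms by (auto elim!: evenE)
  have odd: "odd a" "odd d" "odd a'" "odd d'" using det_one_even_imp_odd assms by blast+
  have 1: "a * d = 1 + 2 * g * b" "a' * d' = 1 + 2 * g' * b'" using assms unfolding g by (auto simp: algebra_simps)
  have h: "(c * a' + d * c') div 2 = g * a' + d * g'" unfolding g by (simp add: algebra_simps flip: distrib_left)
  have q: "4 dvd x * x - 1" if ox: "odd x" for x :: int
  proof -
    obtain k where "x = 2 * k + 1" using ox by (rule oddE)
    hence "x * x - 1 = 4 * (k * k + k)" by (simp add: algebra_simps)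
    thus ?thesis by simp
  qed
  \<comment> \<open>If g and b' are both odd, then a b' - g a' is a difference of two odd
    numbers.\<close>
  have e: "even (g * b' * (a * b' - g * a'))" using odd by auto
  have "(2 * g * b' + d * d') * ((a * b' + b * d') - (g * a' + d * g')) - (d * (b - g) + d' * (b' - g'))
     = d' * b' * (a * d) - g * d * (a' * d') + b * d * (d' * d') - (d * d) * d' * g'
        + 2 * g * b' * (a * b' + b * d' - g * a' - d * g') - (d * (b - g) + d' * (b' - g'))"
    by (simp add: algebra_simps)
  also have "\<dots> = b * d * (d' * d' - 1) - (d * d - 1) * (d' * g') + 4 * (g * b' * (b * d' - d * g'))
       + 2 * (g * b' * (a * b' - g * a'))"
    unfolding 1 by (simp add: algebra_simps)
  also have "4 dvd \<dots>"
  proof (intro dvd_add dvd_diff)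
    show "4 dvd b * d * (d' * d' - 1)" using q[OF odd(4)] by (rule dvd_mult)
    show "4 dvd (d * d - 1) * (d' * g')" using q[OF odd(2)] by (rule dvd_mult2)
    from e obtain k where "g * b' * (a * b' - g * a') = 2 * k" by (rule evenE)
    thus "4 dvd 2 * (g * b' * (a * b' - g * a'))" by simp
  qed simp
  finally show ?thesis unfolding h unfolding g by (simp add: mod_eq_dvd_iff)
qed

text \<open>The integer e treats nu (e = 1) and its conjugate (e = -1) alike, and also the powers of
  nu that Hecke operators produce. The automorphy factor stands on the right, which keeps products
  of matrices free of division.\<close>

definition g02_law :: "int \<Rightarrow> (complex \<Rightarrow> complex) \<Rightarrow> int \<Rightarrow> int \<Rightarrow> int \<Rightarrow> int \<Rightarrow> bool" where
  "g02_law e f a b c d \<longleftrightarrow> (\<forall>z\<in>Hplane. f ((of_int a * z + of_int b) / (of_int c * z + of_int d)) =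
      \<i> powi (e * (d * (b - c div 2))) * (of_int c * z + of_int d)\<^sup>2 * f z)"

lemma g02_law_mult:
  assumes "g02_law e f a b c d" "g02_law e f a' b' c' d'"
    and det: "a * d - b * c = 1" "even c" "a' * d' - b' * c' = 1" "even c'"
  shows "g02_law e f (a * a' + b * c') (a * b' + b * d') (c * a' + d * c') (c * b' + d * d')"
  unfolding g02_law_def
proof
  fix z assume z: "z \<in> Hplane"
  define u v where "u = of_int a' * z + of_int b'" and "v = of_int c' * z + of_int d'"
  have v: "v \<noteq> 0" "u / v \<in> Hplane"
    using Im_moebius[OF det(3)] z by (auto simp: u_def v_def Hplane_simps)
  have e1: "of_int (a * a' + b * c') * z + of_int (a * b' + b * d') = of_int a * u + of_int b * v"
       "of_int (c * a' + d * c') * z + of_int (c * b' + d * d') = of_int c * u + of_int d * v"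
    by (simp_all add: u_def v_def algebra_simps)
  have e2: "(of_int a * u + of_int b * v) / (of_int c * u + of_int d * v) =
       (of_int a * (u / v) + of_int b) / (of_int c * (u / v) + of_int d)"
    using v by (simp add: divide_simps)
  have e3: "of_int c * u + of_int d * v = (of_int c * (u / v) + of_int d) * v"
    using v by (simp add: field_simps)
  have "(e * ((c * b' + d * d') * (a * b' + b * d' - (c * a' + d * c') div 2))) mod 4 =
     (e * (d * (b - c div 2)) + e * (d' * (b' - c' div 2))) mod 4"
    using nu_exponent_mult[OF det] by (metis distrib_left mod_mult_right_eq)
  from i_powi_cong[OF this] have p: "\<i> powi (e * ((c * b' + d * d') * (a * b' + b * d' - (c * a' + d * c') div 2))) =
     \<i> powi (e * (d * (b - c div 2))) * \<i> powi (e * (d' * (b' - c' div 2)))"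
    by (simp only: power_int_add[OF disjI1[OF complex_i_not_zero]])
  have "f ((of_int a * u + of_int b * v) / (of_int c * u + of_int d * v)) =
     \<i> powi (e * (d * (b - c div 2))) * (of_int c * (u / v) + of_int d)\<^sup>2 * f (u / v)"
    unfolding e2 using assms(1) v by (auto simp: g02_law_def)
  also have "f (u / v) = \<i> powi (e * (d' * (b' - c' div 2))) * v\<^sup>2 * f z"
    using assms(2) z unfolding g02_law_def u_def v_def by auto
  finally show "f ((of_int (a * a' + b * c') * z + of_int (a * b' + b * d')) / (of_int (c * a' + d * c') * z + of_int (c * b' + d * d'))) =
     \<i> powi (e * ((c * b' + d * d') * (a * b' + b * d' - (c * a' + d * c') div 2))) *
     (of_int (c * a' + d * c') * z + of_int (c * b' + d * d'))\<^sup>2 * f z"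
    unfolding e1 p e3 by (simp add: power_mult_distrib mult_ac)
qed

lemma Hplane_Fricke:
  assumes z: "z \<in> Hplane"
  shows "- 1 / (2 * z) \<in> Hplane"
proof -
  have "(Re z)\<^sup>2 + (Im z)\<^sup>2 > 0" using z by (simp add: Hplane_simps sum_power2_gt_zero_iff)
  hence "Im z / (2 * ((Re z)\<^sup>2 + (Im z)\<^sup>2)) > 0" using z by (simp add: Hplane_simps)
  also have "Im z / (2 * ((Re z)\<^sup>2 + (Im z)\<^sup>2)) = Im (- 1 / (2 * z))"
    by (simp add: Im_divide power_mult_distrib divide_simps)
  finally show ?thesis by (simp add: Hplane_simps)
qed

text \<open>Subtracting multiples of 2 y always reaches absolute value at most |y|; the opposite
  parity of x and y excludes equality. Without strictness the descent below would not
  terminate.\<close>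

lemma exists_reduced_residue:
  fixes x y :: int assumes "y \<noteq> 0" "odd x \<noteq> odd y"
  shows "\<exists>n. \<bar>x + 2 * n * y\<bar> < \<bar>y\<bar>"
proof -
  define r where "r = (x + \<bar>y\<bar>) mod (2 * \<bar>y\<bar>)"
  have r: "0 \<le> r" "r < 2 * \<bar>y\<bar>" using assms by (auto simp: r_def)
  have eq: "x + \<bar>y\<bar> = r + 2 * \<bar>y\<bar> * ((x + \<bar>y\<bar>) div (2 * \<bar>y\<bar>))" by (simp add: r_def)
  have "odd (x + \<bar>y\<bar>)" using assms by auto
  hence "odd r" using eq by (metis dvd_add dvd_mult2 dvd_triv_left)
  hence "r \<noteq> 0" by auto
  define n where "n = sgn y * ((x + \<bar>y\<bar>) div (2 * \<bar>y\<bar>))"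
  have "x - (r - \<bar>y\<bar>) = 2 * \<bar>y\<bar> * ((x + \<bar>y\<bar>) div (2 * \<bar>y\<bar>))" using eq by linarith
  also have "2 * \<bar>y\<bar> * ((x + \<bar>y\<bar>) div (2 * \<bar>y\<bar>)) = 2 * n * y"
  proof -
    have "\<bar>y\<bar> = sgn y * y" by (metis abs_sgn mult.commute)
    thus ?thesis unfolding n_def by (subst (1) \<open>\<bar>y\<bar> = sgn y * y\<close>) (simp only: mult_ac)
  qed
  finally have n: "x - (r - \<bar>y\<bar>) = 2 * n * y" .
  have "x + 2 * (-n) * y = r - \<bar>y\<bar>" using n by simp
  moreover have "\<bar>r - \<bar>y\<bar>\<bar> < \<bar>y\<bar>" using r \<open>r \<noteq> 0\<close> by linarith
  ultimately show ?thesis by metis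
qed

context
  fixes f :: "complex \<Rightarrow> complex" and e :: int and s :: complex
  assumes T: "\<And>z. z \<in> Hplane \<Longrightarrow> f (z + 1) = \<i> powi e * f z"
    and W: "\<And>z. z \<in> Hplane \<Longrightarrow> f (- 1 / (2 * z)) = 2 * s * z\<^sup>2 * f z"
    and s: "s\<^sup>2 = 1"
begin

lemma shift_int: "z \<in> Hplane \<Longrightarrow> f (z + of_int n) = \<i> powi (e * n) * f z"
proof (induction n rule: int_induct[where k = 0])
  case (step1 i)
  have "z + of_int i \<in> Hplane" using step1 by (simp add: Hplane_simps)
  from T[OF this] step1 show ?case by (simp add: power_int_add distrib_left add.assoc)
next
  case (step2 i)
  have "z + of_int (i - 1) \<in> Hplane" using step2 by (simp add: Hplane_simps)
  from T[OF this] step2 have "\<i> powi e * f (z + of_int (i - 1)) = \<i> powi (e * i) * f z"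
    by (simp add: algebra_simps)
  also have "\<i> powi (e * i) = \<i> powi e * \<i> powi (e * (i - 1))"
    by (simp add: power_int_add[symmetric] algebra_simps)
  finally show ?case by simp
qed simp

lemma g02_law_T: "g02_law e f 1 n 0 1"
  unfolding g02_law_def using shift_int by simp

text \<open>(1, 0; 2m, 1) acts as W_2, then translation by -m, then W_2 again. The sign s enters
  twice and disappears.\<close>

lemma g02_law_V: "g02_law e f 1 0 (2 * m) 1"
  unfolding g02_law_def
proof
  fix z assume z: "z \<in> Hplane"
  hence z0: "z \<noteq> 0" by (auto simp: Hplane_simps)
  have nz: "of_int (2 * m) * z + 1 \<noteq> 0" using Im_moebius(1)[of 1 1 0 "2 * m" z] z by (simp add: Hplane_simps)
  define w where "w = - 1 / (2 * z) + of_int (- m)"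
  have w': "w \<in> Hplane" using Hplane_Fricke[OF z] by (simp add: w_def Hplane_simps)
  have wz: "- 2 * z * w = of_int (2 * m) * z + 1" using z0 by (simp add: w_def field_simps)
  have "z / (of_int (2 * m) * z + 1) = - 1 / (2 * w)"
    using z0 nz unfolding wz[symmetric] by (simp add: field_simps)
  also have "f \<dots> = 2 * s * w\<^sup>2 * f w" using W[OF w'] .
  also have "f w = \<i> powi (e * (- m)) * (2 * s * z\<^sup>2 * f z)"
    unfolding w_def using shift_int[OF Hplane_Fricke[OF z], of "- m"] W[OF z] by simp
  also have "2 * s * w\<^sup>2 * (\<i> powi (e * - m) * (2 * s * z\<^sup>2 * f z)) = s\<^sup>2 * \<i> powi (e * - m) * (- 2 * z * w)\<^sup>2 * f z"
    by (simp add: power2_eq_square mult_ac)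
  finally show "f ((of_int 1 * z + of_int 0) / (of_int (2 * m) * z + of_int 1)) =
      \<i> powi (e * (1 * (0 - 2 * m div 2))) * (of_int (2 * m) * z + of_int 1)\<^sup>2 * f z"
    unfolding wz s by simp
qed

text \<open>Euclidean algorithm on the bottom row by multiplication from the right: as c is even and
  d odd, (1, 2n; 0, 1) achieves |d| < |c|, and then (1, 0; 2m, 1) brings |c| below the new |d|. The
  descent on |c| ends with an upper triangular matrix, where only the sign of the diagonal is left
  open.\<close>

lemma g02_law_all:
  assumes "a * d - b * c = (1::int)" "even c"
  shows "g02_law e f a b c d"
  using assms
proof (induction "nat \<bar>c\<bar>" arbitrary: a b c d rule: less_induct)
  case less
  show ?case
  proof (cases "c = 0")
    case True
    hence "a * d = 1" using less by simp
    hence "a = 1 \<and> d = 1 \<or> a = -1 \<and> d = -1" by (rule zmult_eq_1_iff[THEN iffD1])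
    thus ?thesis
    proof
      assume "a = 1 \<and> d = 1" thus ?thesis using g02_law_T[of b] True by simp
    next
      assume ad: "a = -1 \<and> d = -1"
      have "f ((- z + of_int b) / (- 1)) = \<i> powi (e * (- b)) * f z" if "z \<in> Hplane" for z
        using shift_int[OF that, of "- b"] by simp
      thus ?thesis using ad True by (simp add: g02_law_def)
    qed
  next
    case False
    have odd: "odd d" using det_one_even_imp_odd(2)[OF less.prems] .
    obtain n where n: "\<bar>d + 2 * n * c\<bar> < \<bar>c\<bar>"
      using exists_reduced_residue[of c d] False less.prems(2) odd by auto
    define d1 where "d1 = d + 2 * n * c"
    define b1 where "b1 = b + 2 * n * a"
    have d1: "odd d1" using odd less.prems(2) by (simp add: d1_def)
    hence "d1 \<noteq> 0" by auto
    obtain m where m: "\<bar>c + 2 * m * d1\<bar> < \<bar>d1\<bar>"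
      using exists_reduced_residue[of d1 c] d1 \<open>d1 \<noteq> 0\<close> less.prems(2) by auto
    define c2 where "c2 = c + 2 * m * d1"
    define a2 where "a2 = a + 2 * m * b1"
    have det: "a2 * d1 - b1 * c2 = 1" using less by (simp add: a2_def d1_def b1_def c2_def algebra_simps)
    have ev: "even c2" using less by (simp add: c2_def)
    have "nat \<bar>c2\<bar> < nat \<bar>c\<bar>" using m n by (auto simp: c2_def d1_def)
    from less.hyps[OF this det ev] have L: "g02_law e f a2 b1 c2 d1" .
    from g02_law_mult[OF L g02_law_V[of "- m"] det ev]
    have L1: "g02_law e f a b1 c d1" by (simp add: a2_def c2_def)
    have det1: "a * d1 - b1 * c = 1" using less by (simp add: d1_def b1_def algebra_simps)
    from g02_law_mult[OF L1 g02_law_T[of "- 2 * n"] det1 less.prems(2)]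
    show ?thesis by (simp add: b1_def d1_def)
  qed
qed

end

section \<open>Slash action, cusps, and the passage between forms and coefficient sequences\<close>

lemma slash_2_det_1:
  assumes "a * d - b * c = 1"
  shows "slash 2 (imat a b c d) f z =
    f ((of_int a * z + of_int b) / (of_int c * z + of_int d)) / (of_int c * z + of_int d)\<^sup>2"
proof -
  have "real_of_int a * real_of_int d - real_of_int b * real_of_int c = real_of_int (a * d - b * c)" by simp
  also have "\<dots> = 1" using assms by simp
  finally show ?thesis
    by (simp add: slash_def power_int_minus divide_inverse power_int_def power_inverse)
qed

lemma slash_2_Fricke: "slash 2 (imat 0 (-1) 2 0) f z = f (- 1 / (2 * z)) / (2 * z\<^sup>2)"
proof -
  have "(2 * z) powi (- 2) = 1 / (4 * z\<^sup>2)"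
    by (simp add: power_int_minus power_mult_distrib inverse_eq_divide)
  thus ?thesis by (simp add: slash_def)
qed

lemma qpow_scale: "qpow (2 * h) n z = qpow h n (z / 2)"
  by (simp add: qpow_def)

lemma qpow_add: "qpow h n (z + w) = qpow h n z * qpow h n w"
  by (simp add: qpow_def ring_distribs add_divide_distrib exp_add)

lemma mform_g02_law:
  assumes "mform e s a f" "s\<^sup>2 = 1" "p * u - q * r = 1" "even r"
  shows "g02_law e f p q r u"
proof (rule g02_law_all[of f e s])
  show "f (z + 1) = \<i> powi e * f z" if "z \<in> Hplane" for z
    using mform_shift[OF assms(1) that] .
  show "f (- 1 / (2 * z)) = 2 * s * z\<^sup>2 * f z" if "z \<in> Hplane" for z
    using assms(1) that by (auto simp: mform_def)
qed (use assms in auto)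

text \<open>Gamma_0(2) has two classes of cusps. For even r the slashed form is a multiple of f; for
  odd r the cusp is equivalent to 0, W_2 leads back to infinity, and a multiple of f((z + j) / 2)
  appears, with an expansion in q^(1/8).\<close>

lemma mform_mero_at_cusps:
  assumes f: "mform e s a f" and s: "s\<^sup>2 = 1"
  shows "mero_at_cusps 2 f"
  unfolding mero_at_cusps_def
proof (intro allI impI)
  fix p q r u :: int assume det: "p * u - q * r = 1"
  from f obtain N where N: "\<And>n. n < N \<Longrightarrow> a n = 0" by (auto simp: mform_def)
  have exp: "((\<lambda>n. a n * qpow 4 n z) has_sum f z) UNIV" if "z \<in> Hplane" for z
    using f that by (auto simp: mform_def)
  show "mero_at_infty (slash 2 (imat p q r u) f)"
  proof (cases "even r")
    case True
    define k where "k = \<i> powi (e * (u * (q - r div 2)))"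
    have "((\<lambda>n. k * a n * qpow 4 n z) has_sum slash 2 (imat p q r u) f z) UNIV" if z: "z \<in> Hplane" for z
    proof -
      have "slash 2 (imat p q r u) f z = k * f z"
        unfolding slash_2_det_1[OF det] using mform_g02_law[OF f s det True] z Im_moebius(1)[OF det, of z]
        by (simp add: g02_law_def Hplane_simps k_def)
      thus ?thesis using has_sum_cmult_right[OF exp[OF z], of k] by (simp add: mult.assoc)
    qed
    moreover have "\<forall>n<N. (\<lambda>n. k * a n) n = 0" using N by simp
    ultimately show ?thesis unfolding mero_at_infty_def
      by (intro exI[of _ "4::nat"] exI[of _ "\<lambda>n. k * a n"] exI[of _ N] conjI ballI) simp_all
  next
    case False
    \<comment> \<open>As r is odd, u - j r is even, and the given matrix is the product of (-q', p;
      -u', r), which lies in Gamma_0(2), the inversion (0, -1; 1, 0) and the translation by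
      j.\<close>
    define j where "j = u mod 2"
    define q' where "q' = q - j * p"
    define u' where "u' = u - j * r"
    have ev: "even (- u')" using False unfolding u'_def j_def by (cases "even u") auto
    have det': "(- q') * r - p * (- u') = 1" using det by (simp add: q'_def u'_def algebra_simps)
    define k where "k = \<i> powi (e * (r * (p - (- u') div 2)))"
    have "((\<lambda>n. k * s / 2 * qpow 8 n (of_int j) * a n * qpow 8 n z) has_sum slash 2 (imat p q r u) f z) UNIV" if z: "z \<in> Hplane" for z
    proof -
      define y where "y = z + of_int j"
      have y: "y \<in> Hplane" "y / 2 \<in> Hplane" "y \<noteq> 0" using z by (auto simp: y_def Hplane_simps complex_eq_iff)
      have S: "- 1 / y \<in> Hplane" "f (- 1 / y) = s / 2 * y\<^sup>2 * f (y / 2)"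
        using Hplane_Fricke[OF y(2)] f y(2) by (auto simp: mform_def power_divide)
      have nz: "of_int r * z + of_int u \<noteq> 0" using Im_moebius(1)[OF det, of z] z by (simp add: Hplane_simps)
      have den: "of_int (- u') * (- 1 / y) + of_int r = (of_int r * z + of_int u) / y"
        using y(3) by (simp add: field_simps u'_def) (simp add: y_def algebra_simps)
      have num: "of_int (- q') * (- 1 / y) + of_int p = (of_int p * z + of_int q) / y"
        using y(3) by (simp add: field_simps q'_def) (simp add: y_def algebra_simps)
      have "f ((of_int (- q') * (- 1 / y) + of_int p) / (of_int (- u') * (- 1 / y) + of_int r)) =
         k * (of_int (- u') * (- 1 / y) + of_int r)\<^sup>2 * f (- 1 / y)"
        using mform_g02_law[OF f s det' ev] S(1) unfolding g02_law_def k_def by blast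
      hence "f ((of_int p * z + of_int q) / (of_int r * z + of_int u)) =
         k * (of_int r * z + of_int u)\<^sup>2 * (s / 2) * f (y / 2)"
        unfolding den num S(2) using y(3) by (simp add: power_divide)
      hence eq: "slash 2 (imat p q r u) f z = k * s / 2 * f (y / 2)"
        unfolding slash_2_det_1[OF det] using nz by simp
      have qp: "qpow 4 n (y / 2) = qpow 8 n (of_int j) * qpow 8 n z" for n
        using qpow_scale[of 4 n y] by (simp add: y_def qpow_add mult.commute)
      have "(\<lambda>n. k * s / 2 * (a n * qpow 4 n (y / 2))) = (\<lambda>n. k * s / 2 * qpow 8 n (of_int j) * a n * qpow 8 n z)"
        unfolding qp by (simp only: mult_ac)
      with has_sum_cmult_right[OF exp[OF y(2)], of "k * s / 2"] show ?thesis
        unfolding eq by (simp only:)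
    qed
    moreover have "\<forall>n<N. (\<lambda>n. k * s / 2 * qpow 8 n (of_int j) * a n) n = 0" using N by simp
    ultimately show ?thesis unfolding mero_at_infty_def
      by (intro exI[of _ "8::nat"] exI[of _ "\<lambda>n. k * s / 2 * qpow 8 n (of_int j) * a n"] exI[of _ N] conjI ballI) simp_all
  qed
qed

lemma mform_imp_wh_form:
  assumes f: "mform e s a f" and s: "s\<^sup>2 = 1"
  shows "e mod 4 = 1 \<Longrightarrow> wh_form 2 nu0 s f" "e mod 4 = 3 \<Longrightarrow> wh_form 2 nu0_conj s f"
proof -
  have cnj: "cnj (\<i> powi n) = \<i> powi (- n)" for n
  proof -
    have "cnj (\<i> powi n) = cnj \<i> powi n" by (simp add: power_int_def)
    also have "cnj \<i> = inverse \<i>" by simp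
    also have "inverse \<i> powi n = inverse (\<i> powi n)" by (rule power_int_inverse)
    also have "\<dots> = \<i> powi (- n)" by (rule power_int_minus[symmetric])
    finally show ?thesis .
  qed
  have law: "slash 2 (imat p q r u) f z = \<i> powi (e * (u * (q - r div 2))) * f z"
    if "p * u - q * r = 1" "even r" "z \<in> Hplane" for p q r u z
    unfolding slash_2_det_1[OF that(1)] using mform_g02_law[OF f s that(1,2)] that(3) Im_moebius(1)[OF that(1), of z]
    by (simp add: g02_law_def Hplane_simps)
  have W: "slash 2 (imat 0 (-1) 2 0) f z = s * f z" if "z \<in> Hplane" for z
  proof -
    have "z \<noteq> 0" using that by (auto simp: Hplane_simps)
    thus ?thesis unfolding slash_2_Fricke using f that by (simp add: mform_def)
  qed
  have hol: "f holomorphic_on Hplane" using f by (simp add: mform_def)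
  { assume e: "e mod 4 = 1"
    have "\<i> powi (e * n) = \<i> powi n" for n
      by (rule i_powi_cong) (metis e mod_mult_left_eq mult_1)
    thus "wh_form 2 nu0 s f" unfolding wh_form_def nu0_def
      using hol W law mform_mero_at_cusps[OF f s] by auto }
  { assume e: "e mod 4 = 3"
    have "\<i> powi (e * n) = \<i> powi (- n)" for n
    proof (rule i_powi_cong)
      have "e * n mod 4 = 3 * n mod 4" by (metis e mod_mult_left_eq)
      also have "\<dots> = (- n) mod 4" by presburger
      finally show "e * n mod 4 = (- n) mod 4" .
    qed
    thus "wh_form 2 nu0_conj s f" unfolding wh_form_def nu0_conj_def nu0_def cnj
      using hol W law mform_mero_at_cusps[OF f s] by auto }
qed

text \<open>Pole and tail are joined into one sequence over all integers, the format that
  \<open>mform\<close> demands.\<close>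

definition principal_coeffs :: "nat \<Rightarrow> nat set \<Rightarrow> (nat \<Rightarrow> complex) \<Rightarrow> int \<Rightarrow> complex" where
  "principal_coeffs d S a n = (if n = - int d then 1 else if n > 0 \<and> nat n \<in> S then a (nat n) else 0)"

lemma has_sum_principal_coeffs:
  assumes "S \<subseteq> {0<..}" "d > 0" and a: "((\<lambda>n. a n * qpow 4 (int n) z) has_sum (F - qpow 4 (- int d) z)) S"
  shows "((\<lambda>n. principal_coeffs d S a n * qpow 4 n z) has_sum F) UNIV"
proof -
  have "((\<lambda>n. principal_coeffs d S a n * qpow 4 n z) has_sum (F - qpow 4 (- int d) z)) (int ` S)"
    using a by (subst has_sum_reindex, simp, elim has_sum_cong[THEN iffD1, rotated])
      (use assms(1,2) in \<open>auto simp: principal_coeffs_def\<close>)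
  moreover have "((\<lambda>n. principal_coeffs d S a n * qpow 4 n z) has_sum (qpow 4 (- int d) z)) {- int d}"
    using has_sum_finite[of "{- int d}" "\<lambda>n. principal_coeffs d S a n * qpow 4 n z"]
    by (simp add: principal_coeffs_def)
  ultimately have "((\<lambda>n. principal_coeffs d S a n * qpow 4 n z) has_sum (F - qpow 4 (- int d) z + qpow 4 (- int d) z)) (int ` S \<union> {- int d})"
    by (rule has_sum_Un_disjoint) (use assms in auto)
  hence "((\<lambda>n. principal_coeffs d S a n * qpow 4 n z) has_sum F) (int ` S \<union> {- int d})" by simp
  also have "?this \<longleftrightarrow> ?thesis"
    by (rule has_sum_cong_neutral) (auto simp: principal_coeffs_def image_iff)
  finally show ?thesis .
qed

lemma wh_form_imp_mform:
  assumes wh: "wh_form 2 chi s f" and q: "qexp_coeffs d S a f" and d: "d > 0"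
    and S: "\<And>n. n \<in> S \<Longrightarrow> n > 0 \<and> int n mod 4 = e mod 4" and de: "(- int d) mod 4 = e mod 4"
  shows "mform e s (principal_coeffs d S a) f"
  unfolding mform_def
proof (intro conjI ballI allI impI)
  show "f holomorphic_on Hplane" using wh by (simp add: wh_form_def)
  fix z assume z: "z \<in> Hplane"
  hence "z \<noteq> 0" by (auto simp: Hplane_simps)
  thus "f (- 1 / (2 * z)) = 2 * s * z\<^sup>2 * f z"
    using wh z unfolding wh_form_def slash_2_Fricke by (simp add: divide_eq_eq mult_ac)
  show "((\<lambda>n. principal_coeffs d S a n * qpow 4 n z) has_sum f z) UNIV"
    using q z S d by (intro has_sum_principal_coeffs) (auto simp: qexp_coeffs_def)
next
  fix n assume "principal_coeffs d S a n \<noteq> 0"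
  thus "n mod 4 = e mod 4" using S[of "nat n"] de by (auto simp: principal_coeffs_def split: if_splits)
next
  show "\<exists>N. \<forall>n<N. principal_coeffs d S a n = 0"
    by (rule exI[of _ "- int d"]) (auto simp: principal_coeffs_def)
qed

lemma has_sum_imp_qexp_coeffs:
  assumes a: "\<And>z. z \<in> Hplane \<Longrightarrow> ((\<lambda>n. a n * qpow 4 n z) has_sum f z) UNIV"
    and d: "a (- int d) = 1" "d > 0" and nz: "\<And>n. n \<noteq> - int d \<Longrightarrow> a n \<noteq> 0 \<Longrightarrow> n > 0 \<and> nat n \<in> S"
  shows "qexp_coeffs d {n\<in>S. n > 0} (\<lambda>n. a (int n)) f"
  unfolding qexp_coeffs_def
proof
  fix z assume z: "z \<in> Hplane"
  have "((\<lambda>n. a n * qpow 4 n z) has_sum (qpow 4 (- int d) z)) {- int d}"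
    using has_sum_finite[of "{- int d}" "\<lambda>n. a n * qpow 4 n z"] d by simp
  from has_sum_Diff[OF a[OF z] this]
  have "((\<lambda>n. a n * qpow 4 n z) has_sum (f z - qpow 4 (- int d) z)) (UNIV - {- int d})" by simp
  also have "?this \<longleftrightarrow> ((\<lambda>n. a n * qpow 4 n z) has_sum (f z - qpow 4 (- int d) z)) (int ` {n\<in>S. n > 0})"
  proof (rule has_sum_cong_neutral)
    fix n assume "n \<in> UNIV - {- int d} - int ` {n\<in>S. n > 0}"
    thus "a n * qpow 4 n z = 0" using nz[of n] by (cases "a n = 0") (auto simp: image_iff)
  qed (use d in auto)
  finally show "((\<lambda>n. a (int n) * qpow 4 (int n) z) has_sum (f z - qpow 4 (- int d) z)) {n\<in>S. n > 0}"
    by (subst (asm) has_sum_reindex) (auto simp: o_def)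
qed

section \<open>The expansion principle and the building blocks\<close>

abbreviation Im_at_top :: "complex filter" where
  "Im_at_top \<equiv> filtercomap Im at_top"

lemma norm_shift_int:
  fixes G :: "complex \<Rightarrow> complex"
  assumes "\<And>z. z \<in> Hplane \<Longrightarrow> norm (G (z + 1)) = norm (G z)" "z \<in> Hplane"
  shows "norm (G (z + of_int n)) = norm (G z)"
proof (induction n rule: int_induct[where k = 0])
  case (step1 i)
  have "z + of_int i \<in> Hplane" using assms(2) by (simp add: Hplane_simps)
  from assms(1)[OF this] step1 show ?case by (simp add: add.assoc)
next
  case (step2 i)
  have "z + of_int (i - 1) \<in> Hplane" using assms(2) by (simp add: Hplane_simps)
  from assms(1)[OF this] step2 show ?case by (simp add: algebra_simps)
qed simp

text \<open>
  At height below \<open>1/4\<close> a translation followed by \<open>W\<^sub>2\<close> multiplies the height by at least \<open>8/5\<close>; aiming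
  only at \<open>1/4\<close> instead of the optimal \<open>1/2\<close> thus makes termination immediate.
\<close>

lemma Fricke_reduction:
  fixes G :: "complex \<Rightarrow> complex"
  assumes T: "\<And>z. z \<in> Hplane \<Longrightarrow> norm (G (z + 1)) = norm (G z)"
    and W: "\<And>z. z \<in> Hplane \<Longrightarrow> norm (G (- 1 / (2 * z))) = norm (G z)"
    and z: "z \<in> Hplane"
  shows "\<exists>w. \<bar>Re w\<bar> \<le> 1/2 \<and> Im w \<ge> 1/4 \<and> norm (G w) = norm (G z)"
proof -
  have tr: "\<exists>w. \<bar>Re w\<bar> \<le> 1/2 \<and> Im w = Im z \<and> norm (G w) = norm (G z)" if "z \<in> Hplane" for z
    using norm_shift_int[of G, OF T that, of "- round (Re z)"] of_int_round_abs_le[of "Re z"]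
    by (intro exI[of _ "z + of_int (- round (Re z))"]) (simp add: abs_minus_commute)
  have "\<exists>w. \<bar>Re w\<bar> \<le> 1/2 \<and> Im w \<ge> 1/4 \<and> norm (G w) = norm (G z)"
    if "Im z \<ge> (1/4) * (5/8) ^ n" "z \<in> Hplane" for n z
    using that
  proof (induction n arbitrary: z)
    case 0
    thus ?case using tr[of z] by auto
  next
    case (Suc n)
    obtain w where w: "\<bar>Re w\<bar> \<le> 1/2" "Im w = Im z" "norm (G w) = norm (G z)" using tr Suc by blast
    show ?case
    proof (cases "Im w \<ge> 1/4")
      case True thus ?thesis using w by auto
    next
      case False
      have wH: "w \<in> Hplane" using w Suc by (simp add: Hplane_simps)
      hence pos: "Im w > 0" by (simp add: Hplane_simps)
      have "(Re w)\<^sup>2 \<le> (1/2)\<^sup>2" using w(1) by (metis abs_le_square_iff abs_of_nonneg zero_le_divide_1_iff zero_le_numeral)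
      moreover have "(Im w)\<^sup>2 \<le> (1/4)\<^sup>2" using False pos by (intro power_mono) auto
      ultimately have le: "2 * ((Re w)\<^sup>2 + (Im w)\<^sup>2) \<le> 5 / 8" by (simp add: power2_eq_square)
      have gt: "2 * ((Re w)\<^sup>2 + (Im w)\<^sup>2) > 0" using pos by (intro mult_pos_pos) (simp_all add: sum_power2_gt_zero_iff)
      have "Im (- 1 / (2 * w)) = Im w / (2 * ((Re w)\<^sup>2 + (Im w)\<^sup>2))"
        by (simp add: Im_divide power_mult_distrib divide_simps)
      also have "\<dots> \<ge> Im w / (5 / 8)" using le gt pos by (intro divide_left_mono) auto
      finally have "Im (- 1 / (2 * w)) \<ge> Im w / (5 / 8)" .
      moreover have "Im w / (5/8) \<ge> (1/4) * (5/8) ^ n" using Suc.prems w(2) by simp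
      ultimately have "Im (- 1 / (2 * w)) \<ge> (1/4) * (5/8) ^ n" by linarith
      from Suc.IH[OF this Hplane_Fricke[OF wH]] W[OF wH] w(3) show ?thesis by simp
    qed
  qed
  moreover obtain n where "(5/8) ^ n < 4 * Im z"
    using real_arch_pow_inv[of "4 * Im z" "5/8"] z by (auto simp: Hplane_simps)
  hence "(1/4) * (5/8) ^ n < Im z" by simp
  ultimately show ?thesis using z by (meson less_imp_le)
qed

text \<open>If |G z0| = M > 0, then |G| < M high up, and every other value of |G| recurs in the
  compact box \<open>K\<close>. Thus |G| attains a maximum on the half-plane, G is constant, and its
  small values near infinity contradict M.\<close>

lemma Fricke_invariant_vanishing:
  assumes hol: "G holomorphic_on Hplane"
    and T: "\<And>z. z \<in> Hplane \<Longrightarrow> norm (G (z + 1)) = norm (G z)"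
    and W: "\<And>z. z \<in> Hplane \<Longrightarrow> norm (G (- 1 / (2 * z))) = norm (G z)"
    and lim: "(G \<longlongrightarrow> 0) Im_at_top" and z0: "z0 \<in> Hplane"
  shows "G z0 = 0"
proof (rule ccontr)
  assume nz: "G z0 \<noteq> 0"
  define M where "M = norm (G z0)"
  have "M > 0" using nz by (simp add: M_def)
  have "eventually (\<lambda>z. norm (G z) < M) Im_at_top"
    using tendstoD[OF lim \<open>M > 0\<close>] by simp
  then obtain Y where Y: "\<And>z. Im z \<ge> Y \<Longrightarrow> norm (G z) < M"
    by (auto simp: eventually_filtercomap_at_top_linorder)
  define K where "K = cbox (Complex (-1/2) (1/4)) (Complex (1/2) (max Y 1))"
  have KH: "K \<subseteq> Hplane" by (auto simp: K_def in_cbox_complex_iff Hplane_simps)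
  have red: "norm (G z) < M \<or> (\<exists>w\<in>K. norm (G w) = norm (G z))" if zH: "z \<in> Hplane" for z
  proof -
    obtain w where w: "\<bar>Re w\<bar> \<le> 1/2" "Im w \<ge> 1/4" "norm (G w) = norm (G z)"
      using Fricke_reduction[of G, OF T W zH] by auto
    show ?thesis
    proof (cases "Im w \<ge> Y")
      case True thus ?thesis using Y[of w] w by simp
    next
      case False
      hence "w \<in> K" using w by (auto simp: K_def in_cbox_complex_iff abs_le_iff)
      thus ?thesis using w by blast
    qed
  qed
  \<comment> \<open>At z0 itself only the second alternative is possible. The maximum over
    \<open>K\<close> is therefore at least M and dominates |G| everywhere.\<close>
  obtain w0 where w0: "w0 \<in> K" "norm (G w0) = M" using red[OF z0] by (auto simp: M_def)
  have "continuous_on K (\<lambda>z. norm (G z))"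
    using holomorphic_on_imp_continuous_on[OF hol] KH by (intro continuous_on_norm) (rule continuous_on_subset)
  moreover have "compact K" by (simp add: K_def)
  ultimately obtain \<xi> where xi: "\<xi> \<in> K" "\<And>z. z \<in> K \<Longrightarrow> norm (G z) \<le> norm (G \<xi>)"
    using continuous_attains_sup[of K "\<lambda>z. norm (G z)"] w0 by blast
  have max: "norm (G z) \<le> norm (G \<xi>)" if "z \<in> Hplane" for z
    using red[OF that] xi(2)[OF w0(1)] w0(2) xi(2) by fastforce
  have "G constant_on Hplane"
    by (rule maximum_modulus_principle[OF hol Hplane_simps(2,4,2) order_refl])
       (use xi KH max in auto)
  then obtain c where c: "\<And>z. z \<in> Hplane \<Longrightarrow> G z = c" by (auto simp: constant_on_def)
  have "Complex 0 (max Y 1) \<in> Hplane" by (simp add: Hplane_simps)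
  from c[OF this] c[OF z0] Y[of "Complex 0 (max Y 1)"] show False by (simp add: M_def)
qed

section \<open>Expansions at infinity and the eta quotients \<open>h2\<close> and
  \<open>psi\<close>\<close>

lemma norm_qpow: "norm (qpow t n z) = exp (- 2 * pi * of_int n * Im z / of_nat t)"
proof -
  have "norm (qpow t n z) = exp (Re (2 * of_real pi * \<i> * of_int n * z / of_nat t))"
    unfolding qpow_def by (rule norm_exp_eq_Re)
  also have "Re (2 * of_real pi * \<i> * of_int n * z / of_nat t) = - 2 * pi * of_int n * Im z / of_nat t"
    by (simp add: Re_divide_of_nat)
  finally show ?thesis .
qed

lemma qpow_mult: "qpow t m z * qpow t n z = qpow t (m + n) z"
  by (simp add: qpow_def ring_distribs add_divide_distrib flip: exp_add)

lemma qpow_0 [simp]: "qpow t 0 z = 1" by (simp add: qpow_def)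

text \<open>The tail is compared with the absolutely convergent series at z = i: every exponent n -
  1 >= 1 gains at least the factor exp(-(pi/2)(Im z - 1)). The estimate does not involve Re z, so
  the limit holds along the filter of growing imaginary part.\<close>

lemma leading_coeff_tendsto:
  assumes exp: "\<And>z. z \<in> Hplane \<Longrightarrow> ((\<lambda>n. a n * qpow 4 n z) has_sum F z) UNIV"
    and a: "\<And>n. n \<le> 0 \<Longrightarrow> a n = 0"
  shows "((\<lambda>z. F z * qpow 4 (-1) z) \<longlongrightarrow> a 1) Im_at_top"
proof -
  define C where "C = (\<Sum>\<^sub>\<infinity>n\<in>{2..}. norm (a n * qpow 4 (n - 1) \<i>))"
  have hs: "((\<lambda>n. a n * qpow 4 (n - 1) z) has_sum (F z * qpow 4 (-1) z - a 1)) {2..}" if "z \<in> Hplane" for z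
  proof -
    have "((\<lambda>n. a n * qpow 4 (n - 1) z) has_sum (F z * qpow 4 (-1) z)) UNIV"
      using has_sum_cmult_left[OF exp[OF that], of "qpow 4 (-1) z"] by (simp add: mult.assoc qpow_mult)
    also have "?this \<longleftrightarrow> ((\<lambda>n. a n * qpow 4 (n - 1) z) has_sum (F z * qpow 4 (-1) z)) {1..}"
      by (rule has_sum_cong_neutral) (use a in auto)
    finally have 1: "((\<lambda>n. a n * qpow 4 (n - 1) z) has_sum (F z * qpow 4 (-1) z)) {1..}" .
    have 2: "((\<lambda>n. a n * qpow 4 (n - 1) z) has_sum a 1) {1}"
      using has_sum_finite[of "{1}" "\<lambda>n. a n * qpow 4 (n - 1) z"] by simp
    have "{1..} - {1} = {2::int..}" by auto
    thus ?thesis using has_sum_Diff[OF 1 2] by simp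
  qed
  have "(\<lambda>n. a n * qpow 4 (n - 1) \<i>) summable_on {2..}"
    using hs[of \<i>] by (auto simp: summable_on_def Hplane_simps)
  hence sm: "(\<lambda>n. norm (a n * qpow 4 (n - 1) \<i>)) summable_on {2..}"
    by (simp add: summable_on_iff_abs_summable_on_complex)
  have bd: "norm (F z * qpow 4 (-1) z - a 1) \<le> C * exp (- (pi / 2) * (Im z - 1))" if "Im z \<ge> 1" for z
  proof -
    have zH: "z \<in> Hplane" using that by (simp add: Hplane_simps)
    have h: "((\<lambda>n. norm (a n * qpow 4 (n - 1) \<i>) * exp (- (pi / 2) * (Im z - 1))) has_sum
          (C * exp (- (pi / 2) * (Im z - 1)))) {2..}"
      unfolding C_def using sm by (intro has_sum_cmult_left) auto
    show ?thesis
    proof (rule norm_infsum_le[OF hs[OF zH] h])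
      fix n :: int assume n: "n \<in> {2..}"
      have "real_of_int (n - 1) * (Im z - 1) \<ge> 1 * (Im z - 1)"
        using n that by (intro mult_right_mono) auto
      hence "pi / 2 * (real_of_int (n - 1) * (Im z - 1)) \<ge> pi / 2 * (Im z - 1)"
        by (intro mult_left_mono) auto
      hence "norm (qpow 4 (n - 1) z) \<le> norm (qpow 4 (n - 1) \<i>) * exp (- (pi / 2) * (Im z - 1))"
        unfolding norm_qpow
      proof -
        have "- 2 * pi * of_int (n - 1) * Im z / of_nat 4 =
           - 2 * pi * of_int (n - 1) * Im \<i> / of_nat 4 - pi / 2 * (real_of_int (n - 1) * (Im z - 1))"
          by (simp add: field_simps)
        also have "\<dots> \<le> - 2 * pi * of_int (n - 1) * Im \<i> / of_nat 4 + - (pi / 2) * (Im z - 1)"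
          using \<open>pi / 2 * (real_of_int (n - 1) * (Im z - 1)) \<ge> pi / 2 * (Im z - 1)\<close> by linarith
        finally show "exp (- 2 * pi * of_int (n - 1) * Im z / of_nat 4) \<le>
           exp (- 2 * pi * of_int (n - 1) * Im \<i> / of_nat 4) * exp (- (pi / 2) * (Im z - 1))"
          unfolding exp_add[symmetric] by (simp only: exp_le_cancel_iff)
      qed
      thus "norm (a n * qpow 4 (n - 1) z) \<le> norm (a n * qpow 4 (n - 1) \<i>) * exp (- (pi / 2) * (Im z - 1))"
        by (simp add: norm_mult mult.assoc mult_left_mono)
    qed
  qed
  have "((\<lambda>y::real. C * exp (- (pi / 2) * (y - 1))) \<longlongrightarrow> 0) at_top"
    by real_asymp
  hence lim: "((\<lambda>z. C * exp (- (pi / 2) * (Im z - 1))) \<longlongrightarrow> 0) Im_at_top"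
    by (rule filterlim_compose) (rule filterlim_filtercomap)
  have "((\<lambda>z. F z * qpow 4 (-1) z - a 1) \<longlongrightarrow> 0) Im_at_top"
    by (rule Lim_null_comparison[OF _ lim])
       (use bd in \<open>auto simp: eventually_filtercomap_at_top_linorder\<close>)
  thus ?thesis by (simp add: LIM_zero_iff)
qed

lemma power_series_has_sum:
  assumes hol: "R holomorphic_on ball 0 1" and x: "norm x < 1"
  shows "((\<lambda>k. (deriv ^^ k) R 0 / fact k * x ^ k) has_sum R x) UNIV"
proof -
  define c where "c = (\<lambda>k. (deriv ^^ k) R 0 / fact k)"
  have sums: "(\<lambda>k. c k * y ^ k) sums R y" if "norm y < 1" for y
    using holomorphic_power_series[OF hol, of y] that by (simp add: c_def)
  define y where "y = complex_of_real ((1 + norm x) / 2)"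
  have ny: "norm y = (1 + norm x) / 2" unfolding y_def norm_of_real by simp
  have "summable (\<lambda>k. norm (c k * x ^ k))"
    by (rule powser_insidea[OF sums_summable[OF sums], of y]) (use x in \<open>simp_all add: ny\<close>)
  from norm_summable_imp_has_sum[OF this sums[OF x]] show ?thesis by (simp add: c_def)
qed

text \<open>A power series in q times q^(m/4) has exponents in m + 4 Z only; this is the support
  condition of \<open>mform\<close>.\<close>

lemma q_expansion_exists:
  assumes hol: "R holomorphic_on ball 0 1"
    and f: "\<And>z. z \<in> Hplane \<Longrightarrow> f z = qpow 4 m z * R (qq z)"
  shows "\<exists>a. (\<forall>n<m. a n = 0) \<and> a m = R 0 \<and> (\<forall>n. a n \<noteq> 0 \<longrightarrow> n mod 4 = m mod 4) \<and>
     (\<forall>z\<in>Hplane. ((\<lambda>n. a n * qpow 4 n z) has_sum f z) UNIV)"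
proof -
  define c where "c = (\<lambda>k. (deriv ^^ k) R 0 / fact k)"
  define i where "i = (\<lambda>k::nat. m + 4 * int k)"
  define a where "a = (\<lambda>n. if n \<in> range i then c (nat ((n - m) div 4)) else 0)"
  have inj: "inj i" by (auto simp: i_def inj_def)
  have ai: "a (i k) = c k" for k by (auto simp: a_def i_def)
  have "((\<lambda>n. a n * qpow 4 n z) has_sum f z) UNIV" if z: "z \<in> Hplane" for z
  proof -
    have "((\<lambda>k. qpow 4 m z * (c k * qq z ^ k)) has_sum (qpow 4 m z * R (qq z))) UNIV"
      unfolding c_def using z
      by (intro has_sum_cmult_right power_series_has_sum hol norm_qq_less_1) (simp add: Hplane_simps)
    also have "(\<lambda>k. qpow 4 m z * (c k * qq z ^ k)) = (\<lambda>n. a n * qpow 4 n z) \<circ> i"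
    proof (rule ext)
      fix k
      have "qq z ^ k = qpow 4 (4 * int k) z"
        unfolding qpow_def exp_of_nat_mult[symmetric] by (simp add: algebra_simps)
      hence "qpow 4 m z * qq z ^ k = qpow 4 (i k) z" by (simp add: qpow_mult i_def)
      thus "qpow 4 m z * (c k * qq z ^ k) = ((\<lambda>n. a n * qpow 4 n z) \<circ> i) k"
        by (simp add: ai mult_ac)
    qed
    also have "((\<lambda>n. a n * qpow 4 n z) \<circ> i has_sum (qpow 4 m z * R (qq z))) UNIV \<longleftrightarrow>
       ((\<lambda>n. a n * qpow 4 n z) has_sum (qpow 4 m z * R (qq z))) (range i)"
      by (rule has_sum_reindex[OF inj, symmetric])
    also have "\<dots> \<longleftrightarrow> ((\<lambda>n. a n * qpow 4 n z) has_sum (qpow 4 m z * R (qq z))) UNIV"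
      by (rule has_sum_cong_neutral) (auto simp: a_def)
    finally show ?thesis using f[OF z] by simp
  qed
  moreover have "a m = R 0" using ai[of 0] by (simp add: i_def c_def)
  moreover have "\<forall>n<m. a n = 0" by (auto simp: a_def i_def)
  moreover have "\<forall>n. a n \<noteq> 0 \<longrightarrow> n mod 4 = m mod 4" by (auto simp: a_def i_def)
  ultimately show ?thesis by blast
qed

text \<open>The square of \<open>psi\<close> is the classical Hauptmodul of Gamma_0(2).
  \<open>psi\<close> itself begins with q^(-1/2), so the products of \<open>h2\<close> with powers
  of \<open>psi\<close> begin with q^((1 - 2k)/4) and reach every odd numerator.\<close>

definition psi :: "complex \<Rightarrow> complex" where
  "psi z = (eta z / eta (2 * z)) ^ 12"

lemma psi_nonzero: "z \<in> Hplane \<Longrightarrow> psi z \<noteq> 0"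
  using eta_nonzero[of z] eta_nonzero[of "2 * z"] by (simp add: psi_def Hplane_simps)

lemma h2_nonzero: "z \<in> Hplane \<Longrightarrow> h2 z \<noteq> 0"
  using eta_nonzero[of z] eta_nonzero[of "2 * z"] by (simp add: h2_def Hplane_simps)

lemma eta_holomorphic: "eta holomorphic_on Hplane"
  unfolding holomorphic_on_open[OF Hplane_simps(2)] using eta_logderiv(2) Hplane_simps(1) by blast

lemma eta_double_holomorphic: "(\<lambda>z. eta (2 * z)) holomorphic_on Hplane"
proof -
  have "(eta \<circ> (\<lambda>z. 2 * z)) holomorphic_on Hplane"
    by (rule holomorphic_on_compose_gen[OF _ eta_holomorphic])
       (auto intro!: holomorphic_intros simp: Hplane_simps)
  thus ?thesis by (simp add: o_def)
qed

lemma h2_holomorphic: "h2 holomorphic_on Hplane"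
  unfolding h2_def[abs_def] by (intro holomorphic_intros eta_holomorphic eta_double_holomorphic)

lemma psi_holomorphic: "psi holomorphic_on Hplane"
  unfolding psi_def[abs_def]
  by (intro holomorphic_intros eta_holomorphic eta_double_holomorphic)
     (simp add: eta_nonzero Hplane_simps)

lemma eta_Fricke:
  assumes "z \<in> Hplane"
  shows "eta (- 1 / (2 * z)) ^ 2 = - 2 * \<i> * z * eta (2 * z) ^ 2"
    "eta (2 * (- 1 / (2 * z))) ^ 2 = - \<i> * z * eta z ^ 2"
proof -
  show "eta (- 1 / (2 * z)) ^ 2 = - 2 * \<i> * z * eta (2 * z) ^ 2"
    using eta_square_inversion[of "2 * z"] assms by (simp add: Hplane_simps)
  have "2 * (- 1 / (2 * z)) = - 1 / z" by simp
  thus "eta (2 * (- 1 / (2 * z))) ^ 2 = - \<i> * z * eta z ^ 2"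
    using eta_square_inversion[of z] assms by (simp only: Hplane_simps)
qed

lemma h2_Fricke: "z \<in> Hplane \<Longrightarrow> h2 (- 1 / (2 * z)) = - 2 * z\<^sup>2 * h2 z"
  unfolding h2_def eta_Fricke by (simp add: power2_eq_square)

lemma psi_Fricke:
  assumes z: "z \<in> Hplane"
  shows "psi (- 1 / (2 * z)) = 64 / psi z"
proof -
  have z0: "z \<noteq> 0" using z by (auto simp: Hplane_simps)
  have p: "x ^ 12 = (x ^ 2) ^ 6" for x :: complex by (simp flip: power_mult)
  \<comment> \<open>The automorphy factors -2 i z and -i z of the two squared etas have quotient 2,
    and 2^6 = 64.\<close>
  have "psi (- 1 / (2 * z)) = (2 * (eta (2 * z) ^ 2 / eta z ^ 2)) ^ 6"
    unfolding psi_def power_divide p eta_Fricke[OF z] using z0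
    by (simp add: power_mult_distrib power_divide)
  thus ?thesis unfolding psi_def p by (simp add: power_divide power_mult_distrib)
qed

text \<open>With E = exp(2 pi i z / 24) one has eta(z) = E phi(q) and eta(2 z) = E^2 phi(q^2), so
  \<open>h2\<close> carries E^6 = q^(1/4) and \<open>psi\<close> carries E^(-12) = q^(-1/2). The
  remaining factor \<open>R\<close> is holomorphic on the disc for negative k too, since phi has no
  zeros there.\<close>

lemma h2_psi_expansion:
  "\<exists>a. (\<forall>n<1 - 2 * k. a n = 0) \<and> a (1 - 2 * k) = 1 \<and> (\<forall>n. a n \<noteq> 0 \<longrightarrow> n mod 4 = (1 - 2 * k) mod 4) \<and>
     (\<forall>z\<in>Hplane. ((\<lambda>n. a n * qpow 4 n z) has_sum (h2 z * psi z powi k)) UNIV)"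
proof -
  define R where "R = (\<lambda>x. euler_phi x ^ 2 * euler_phi (x ^ 2) ^ 2 * ((euler_phi x / euler_phi (x ^ 2)) ^ 12) powi k)"
  have sq: "norm (x ^ 2) < 1" if "norm x < 1" for x :: complex
    using norm_power_Suc_less_one[OF that, of 1] by (simp add: numeral_2_eq_2)
  have "(euler_phi \<circ> (\<lambda>x. x ^ 2)) holomorphic_on ball 0 1"
    by (rule holomorphic_on_compose_gen[OF _ euler_phi_holomorphic]) (use sq in \<open>auto intro!: holomorphic_intros\<close>)
  hence hol2: "(\<lambda>x. euler_phi (x ^ 2)) holomorphic_on ball 0 1" by (simp add: o_def)
  have "R holomorphic_on ball 0 1"
    unfolding R_def
    by (intro holomorphic_intros holomorphic_on_power_int euler_phi_holomorphic hol2)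
       (use sq euler_phi_deriv(1) in auto)
  moreover have "h2 z * psi z powi k = qpow 4 (1 - 2 * k) z * R (qq z)" if "z \<in> Hplane" for z
  proof -
    have q2: "qq (2 * z) = qq z ^ 2" unfolding exp_double[symmetric] by (simp add: mult_ac)
    define E where "E = exp (2 * of_real pi * \<i> * z / 24)"
    have e1: "eta z = E * euler_phi (qq z)" by (simp add: eta_conv_euler_phi E_def)
    have e2: "eta (2 * z) = E ^ 2 * euler_phi (qq z ^ 2)"
      unfolding eta_conv_euler_phi q2 E_def by (simp flip: exp_double)
    have E0: "E \<noteq> 0" by (simp add: E_def)
    have En: "E ^ n = exp (of_nat n * (2 * of_real pi * \<i> * z / 24))" for n
      unfolding E_def by (rule exp_of_nat_mult[symmetric])
    have E6: "E ^ 6 = qpow 4 1 z" unfolding En qpow_def by simp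
    have "qpow 4 2 z * qpow 4 (-2) z = 1" by (simp add: qpow_mult)
    moreover have "E ^ 12 = qpow 4 2 z" unfolding En qpow_def by (rule arg_cong[of _ _ exp]) simp
    ultimately have "(1 / E ^ 12) = qpow 4 (-2) z" by (auto simp: divide_eq_eq mult.commute)
    hence "(1 / E ^ 12) powi k = qpow 4 (- 2 * k) z"
      by (simp add: qpow_def exp_power_int algebra_simps)
    moreover have "psi z = (1 / E ^ 12) * (euler_phi (qq z) / euler_phi (qq z ^ 2)) ^ 12"
      unfolding psi_def e1 e2 using E0 by (simp add: power_mult_distrib power_divide flip: power_mult power_add)
         (simp add: divide_simps flip: power_add)
    ultimately have "psi z powi k = qpow 4 (- 2 * k) z * ((euler_phi (qq z) / euler_phi (qq z ^ 2)) ^ 12) powi k"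
      by (simp only: power_int_mult_distrib)
    moreover have "h2 z = qpow 4 1 z * (euler_phi (qq z) ^ 2 * euler_phi (qq z ^ 2) ^ 2)"
      unfolding h2_def e1 e2 E6[symmetric] by (simp add: power_mult_distrib flip: power_mult power_add)
    ultimately show ?thesis unfolding R_def
      using qpow_mult[of 4 1 z "- 2 * k"] by (simp add: mult_ac)
  qed
  moreover have "R 0 = 1" by (simp add: R_def euler_phi_0)
  ultimately show ?thesis using q_expansion_exists[of R "\<lambda>z. h2 z * psi z powi k" "1 - 2 * k"] by auto
qed

lemma h2_mform: "\<exists>a. mform 1 (-1) a h2 \<and> a 1 = 1 \<and> (\<forall>n\<le>0. a n = 0)"
proof -
  obtain a where a: "\<forall>n<1. a n = 0" "a 1 = 1" "\<forall>n. a n \<noteq> 0 \<longrightarrow> n mod 4 = 1 mod 4"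
    "\<forall>z\<in>Hplane. ((\<lambda>n. a n * qpow 4 n z) has_sum h2 z) UNIV"
    using h2_psi_expansion[of 0] by auto
  have "mform 1 (-1) a h2" unfolding mform_def
    using a h2_holomorphic h2_Fricke by auto
  thus ?thesis using a by auto
qed

text \<open>F / \<open>h2\<close> tends to \<open>a 1\<close> at infinity and acquires the sign -s
  under W_2. For s = 1 it is antisymmetric, which excludes a nonzero limit; for s = -1 the form
  \<open>h2\<close> itself shows that \<open>a 1 = 0\<close> must be assumed.\<close>

lemma mform_vanishing:
  assumes F: "mform e s a F" and s: "s = 1 \<or> s = -1" and a: "\<And>n. n \<le> 0 \<Longrightarrow> a n = 0"
    and a1: "a 1 = 0 \<or> s = 1" and z: "z \<in> Hplane"
  shows "F z = 0"
proof -
  define G where "G = (\<lambda>z. F z / h2 z)"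
  obtain b where b: "mform 1 (-1) b h2" "b 1 = 1" "\<And>n. n \<le> 0 \<Longrightarrow> b n = 0" using h2_mform by auto
  have hol: "G holomorphic_on Hplane" unfolding G_def
    using F h2_nonzero by (intro holomorphic_intros h2_holomorphic) (auto simp: mform_def)
  have "((\<lambda>z. (F z * qpow 4 (-1) z) / (h2 z * qpow 4 (-1) z)) \<longlongrightarrow> a 1 / b 1) Im_at_top"
    using F b by (intro tendsto_divide leading_coeff_tendsto) (use a in \<open>auto simp: mform_def\<close>)
  hence lim: "(G \<longlongrightarrow> a 1) Im_at_top" by (simp add: G_def b(2) qpow_def)
  have T: "G (w + 1) = \<i> powi (e - 1) * G w" if "w \<in> Hplane" for w
  proof -
    have "\<i> powi e = \<i> * \<i> powi (e - 1)" using power_int_add[of \<i> 1 "e - 1"] by simp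
    thus ?thesis using mform_shift[OF F that] mform_shift[OF b(1) that] by (simp add: G_def)
  qed
  have W: "G (- 1 / (2 * w)) = - s * G w" if "w \<in> Hplane" for w
  proof -
    have "w \<noteq> 0" using that by (auto simp: Hplane_simps)
    thus ?thesis using F that h2_Fricke[OF that] by (simp add: G_def mform_def)
  qed
  have "G z = 0"
  proof (cases "a 1 = 0")
    case True
    have "norm (G (w + 1)) = norm (G w)" "norm (G (- 1 / (2 * w))) = norm (G w)" if "w \<in> Hplane" for w
      using T[OF that] W[OF that] s by (auto simp: norm_mult norm_power_int)
    from Fricke_invariant_vanishing[OF hol this _ z] lim True show ?thesis by simp
  next
    case False \<comment> \<open>then \<open>G\<^sup>2\<close> is constant, but \<open>G\<close> vanishes at the fixed point of \<open>W\<^sub>2\<close>\<close>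
    with a1 have s1: "s = 1" by simp
    \<comment> \<open>A nonzero coefficient at 1 fixes the class of e, so G is invariant, and not
      just up to a root of unity, under z -> z + 1.\<close>
    have "1 mod 4 = e mod 4" using F False by (auto simp: mform_def)
    hence "(e - 1) mod 4 = 0 mod 4" by (metis cancel_comm_monoid_add_class.diff_cancel mod_diff_left_eq)
    from i_powi_cong[OF this] have i: "\<i> powi (e - 1) = 1" by simp
    define H where "H = (\<lambda>z. G z ^ 2 - a 1 ^ 2)"
    have "H w = 0" if w: "w \<in> Hplane" for w
    proof (rule Fricke_invariant_vanishing[OF _ _ _ _ w])
      show "H holomorphic_on Hplane" unfolding H_def by (intro holomorphic_intros hol)
      have "(H \<longlongrightarrow> a 1 ^ 2 - a 1 ^ 2) Im_at_top" unfolding H_def by (intro tendsto_intros lim)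
      thus "(H \<longlongrightarrow> 0) Im_at_top" by simp
    qed (use T W i s1 in \<open>auto simp: H_def\<close>)
    define w where "w = \<i> / of_real (sqrt 2)"
    have w: "w \<in> Hplane" by (simp add: w_def Hplane_simps)
    have "2 * w * w = - 1" unfolding w_def by (simp add: field_simps flip: of_real_mult)
    moreover have "w \<noteq> 0" using w by (auto simp: Hplane_simps)
    ultimately have "- 1 / (2 * w) = w" by (metis mult_eq_0_iff nonzero_mult_div_cancel_left zero_neq_numeral)
    with W[OF w] s1 have "G w = - G w" by simp
    hence "G w = 0" by (simp add: eq_neg_iff_add_eq_0 flip: mult_2)
    with \<open>\<And>w. w \<in> Hplane \<Longrightarrow> H w = 0\<close>[OF w] False show ?thesis by (simp add: H_def)
  qed
  thus ?thesis using h2_nonzero[OF z] by (simp add: G_def)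
qed

section \<open>Linear combinations and forms with a single pole term\<close>

lemma mform_cong_e: "mform e s a f \<Longrightarrow> e mod 4 = e' mod 4 \<Longrightarrow> mform e' s a f"
  by (simp add: mform_def)

lemma mform_add:
  assumes f: "mform e s a f" and g: "mform e s b g"
  shows "mform e s (\<lambda>n. a n + b n) (\<lambda>z. f z + g z)"
proof -
  obtain N M where N: "\<And>n. n < N \<Longrightarrow> a n = 0" "\<And>n. n < M \<Longrightarrow> b n = 0" using assms by (auto simp: mform_def)
  hence "\<forall>n<min N M. a n + b n = 0" by simp
  hence "\<exists>N. \<forall>n<N. a n + b n = 0" by blast
  moreover have "n mod 4 = e mod 4" if "a n + b n \<noteq> 0" for n
    using that f g unfolding mform_def by (metis add.right_neutral)
  ultimately show ?thesis
    using assms unfolding mform_def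
    by (intro conjI) (auto intro!: holomorphic_intros has_sum_add simp: distrib_right distrib_left)
qed

lemma mform_cmult: "mform e s a f \<Longrightarrow> mform e s (\<lambda>n. c * a n) (\<lambda>z. c * f z)"
  unfolding mform_def by (auto intro!: holomorphic_intros has_sum_cmult_right simp: mult.assoc)

lemma mform_zero: "mform e s (\<lambda>_. 0) (\<lambda>_. 0)"
  by (simp add: mform_def)

lemma mform_sum:
  "finite J \<Longrightarrow> (\<And>j. j \<in> J \<Longrightarrow> mform e s (a j) (f j)) \<Longrightarrow>
    mform e s (\<lambda>n. \<Sum>j\<in>J. a j n) (\<lambda>z. \<Sum>j\<in>J. f j z)"
  by (induction J rule: finite_induct) (auto intro: mform_zero mform_add)

text \<open>The partner under W_2 starts at q^((1 + 2k)/4), a positive exponent congruent to 1 - 2k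
  mod 4. It supplies the required sign without disturbing the principal part or the
  multiplier.\<close>

lemma basis_mform:
  fixes k :: nat
  assumes s: "s = 1 \<or> s = -1" and k: "k > 0"
  shows "\<exists>a f. mform (1 - 2 * int k) s a f \<and> a (1 - 2 * int k) = 1 \<and> (\<forall>n<1 - 2 * int k. a n = 0)"
proof -
  obtain a where a: "\<And>n. n < 1 - 2 * int k \<Longrightarrow> a n = 0" "a (1 - 2 * int k) = 1"
     "\<And>n. a n \<noteq> 0 \<Longrightarrow> n mod 4 = (1 - 2 * int k) mod 4"
     "\<And>z. z \<in> Hplane \<Longrightarrow> ((\<lambda>n. a n * qpow 4 n z) has_sum (h2 z * psi z powi int k)) UNIV"
    using h2_psi_expansion[of "int k"] by blast
  obtain b where b: "\<And>n. n < 1 + 2 * int k \<Longrightarrow> b n = 0"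
     "\<And>n. b n \<noteq> 0 \<Longrightarrow> n mod 4 = (1 + 2 * int k) mod 4"
     "\<And>z. z \<in> Hplane \<Longrightarrow> ((\<lambda>n. b n * qpow 4 n z) has_sum (h2 z * psi z powi (- int k))) UNIV"
    using h2_psi_expansion[of "- int k"] by auto
  define f where "f = (\<lambda>z. h2 z * psi z powi int k + (- s * 64 ^ k) * (h2 z * psi z powi (- int k)))"
  have "mform (1 - 2 * int k) s (\<lambda>n. a n + (- s * 64 ^ k) * b n) f"
    unfolding mform_def
  proof (intro conjI ballI allI impI)
    show "f holomorphic_on Hplane" unfolding f_def
      by (intro holomorphic_intros holomorphic_on_power_int h2_holomorphic psi_holomorphic) (use psi_nonzero in auto)
  next
    fix z assume z: "z \<in> Hplane"
    have p0: "psi z \<noteq> 0" using psi_nonzero[OF z] .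
    have f': "f w = h2 w * (psi w ^ k - s * 64 ^ k / psi w ^ k)" for w
      unfolding f_def by (simp add: power_int_minus field_simps)
    have "f (- 1 / (2 * z)) = - 2 * z\<^sup>2 * h2 z * (64 ^ k / psi z ^ k - s * psi z ^ k)"
      unfolding f' h2_Fricke[OF z] psi_Fricke[OF z] using p0 by (simp add: power_divide)
    also have "\<dots> = 2 * s * z\<^sup>2 * f z" unfolding f' using s by (auto simp: algebra_simps)
    finally show "f (- 1 / (2 * z)) = 2 * s * z\<^sup>2 * f z" .
    have "((\<lambda>n. a n * qpow 4 n z + (- s * 64 ^ k) * (b n * qpow 4 n z)) has_sum f z) UNIV"
      unfolding f_def by (intro has_sum_add has_sum_cmult_right a b z)
    thus "((\<lambda>n. (a n + - s * 64 ^ k * b n) * qpow 4 n z) has_sum f z) UNIV"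
      by (simp add: algebra_simps)
  next
    fix n assume "a n + - s * 64 ^ k * b n \<noteq> 0"
    hence "a n \<noteq> 0 \<or> b n \<noteq> 0" by auto
    moreover have "(1 + 2 * int k) mod 4 = (1 - 2 * int k) mod 4" by presburger
    ultimately show "n mod 4 = (1 - 2 * int k) mod 4" using a(3) b(2) by metis
  next
    show "\<exists>N. \<forall>n<N. a n + - s * 64 ^ k * b n = 0"
      by (rule exI[of _ "1 - 2 * int k"]) (use a(1) b(1) in auto)
  qed
  thus ?thesis using a(1,2) b(1) k
    by (intro exI[of _ "\<lambda>n. a n + (- s * 64 ^ k) * b n"] exI[of _ f]) auto
qed

text \<open>The unwanted pole terms of the building block sit at exponents 1 - 2j with j < k and j =
  k mod 2. Each reduced form for such j has a single nonzero coefficient at nonpositive exponents,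
  so the factors to subtract are read off from \<open>b\<close> directly.\<close>

lemma reduced_mform_exists:
  fixes k :: nat
  assumes s: "s = 1 \<or> s = -1" and k: "k > 0"
  shows "\<exists>a f. mform (1 - 2 * int k) s a f \<and> a (1 - 2 * int k) = 1 \<and>
     (\<forall>n\<le>0. n \<noteq> 1 - 2 * int k \<longrightarrow> a n = 0)"
  using k
proof (induction k rule: less_induct)
  case (less k)
  obtain b B where B: "mform (1 - 2 * int k) s b B" "b (1 - 2 * int k) = 1" "\<And>n. n < 1 - 2 * int k \<Longrightarrow> b n = 0"
    using basis_mform[OF s less.prems] by blast
  define J where "J = {j. 0 < j \<and> j < k \<and> (even j \<longleftrightarrow> even k)}"
  have "\<forall>j\<in>J. \<exists>p. mform (1 - 2 * int j) s (fst p) (snd p) \<and> fst p (1 - 2 * int j) = 1 \<and>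
     (\<forall>n\<le>0. n \<noteq> 1 - 2 * int j \<longrightarrow> fst p n = 0)"
    using less.IH by (auto simp: J_def)
  from bchoice[OF this] obtain p where "\<forall>j\<in>J. mform (1 - 2 * int j) s (fst (p j)) (snd (p j)) \<and>
     fst (p j) (1 - 2 * int j) = 1 \<and> (\<forall>n\<le>0. n \<noteq> 1 - 2 * int j \<longrightarrow> fst (p j) n = 0)" ..
  hence p: "\<And>j. j \<in> J \<Longrightarrow> mform (1 - 2 * int j) s (fst (p j)) (snd (p j))"
     "\<And>j. j \<in> J \<Longrightarrow> fst (p j) (1 - 2 * int j) = 1"
     "\<And>j n. j \<in> J \<Longrightarrow> n \<le> 0 \<Longrightarrow> n \<noteq> 1 - 2 * int j \<Longrightarrow> fst (p j) n = 0"
    by blast+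
  have fin: "finite J" by (auto simp: J_def)
  define a where "a = (\<lambda>n. b n + (\<Sum>j\<in>J. - b (1 - 2 * int j) * fst (p j) n))"
  define f where "f = (\<lambda>z. B z + (\<Sum>j\<in>J. - b (1 - 2 * int j) * snd (p j) z))"
  have "mform (1 - 2 * int k) s a f" unfolding a_def f_def
  proof (intro mform_add[OF B(1)] mform_sum[OF fin] mform_cmult)
    fix j assume j: "j \<in> J"
    have "(1 - 2 * int j) mod 4 = (1 - 2 * int k) mod 4"
    proof -
      have "even (int j - int k)" using j by (auto simp: J_def)
      then obtain t where "int j - int k = 2 * t" by (rule evenE)
      hence "1 - 2 * int j = 1 - 2 * int k + 4 * (- t)" by simp
      thus ?thesis by (metis mod_mult_self2)
    qed
    thus "mform (1 - 2 * int k) s (fst (p j)) (snd (p j))" using p(1)[OF j] mform_cong_e by blast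
  qed
  moreover have "a n = (if n = 1 - 2 * int k then 1 else 0)" if "n \<le> 0" for n
  proof (cases "\<exists>j\<in>J. n = 1 - 2 * int j")
    case True
    then obtain j where j: "j \<in> J" "n = 1 - 2 * int j" by blast
    have "(\<Sum>i\<in>J. - b (1 - 2 * int i) * fst (p i) n) = (\<Sum>i\<in>J. if i = j then - b n else 0)"
      using p(2) p(3)[OF _ that] j by (intro sum.cong) auto
    also have "\<dots> = - b n" using j fin by simp
    finally show ?thesis using j by (auto simp: a_def J_def)
  next
    case False
    have "(\<Sum>i\<in>J. - b (1 - 2 * int i) * fst (p i) n) = 0"
      using False p(3)[OF _ that] by (intro sum.neutral) auto
    hence an: "a n = b n" by (simp add: a_def)
    show ?thesis
    proof (cases "n = 1 - 2 * int k \<or> b n = 0")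
      case True thus ?thesis using an B(2) by auto
    next
      case nz: False
      hence "n > 1 - 2 * int k" using B(3)[of n] by force
      have "n mod 4 = (1 - 2 * int k) mod 4" using nz B(1) by (auto simp: mform_def)
      hence "4 dvd n - (1 - 2 * int k)" by (simp add: mod_eq_dvd_iff)
      then obtain t where t: "n = 1 - 2 * int k + 4 * t" by (metis add_diff_cancel_left' add_diff_inverse diff_add_cancel dvd_def add.commute)
      \<comment> \<open>An exponent n = 1 - 2k + 4t equals 1 - 2j for j = k - 2t, which has the
        parity of k that \<open>J\<close> asks for.\<close>
      define j where "j = nat (int k - 2 * t)"
      have "int j = int k - 2 * t" using t that by (simp add: j_def)
      hence "j \<in> J" "n = 1 - 2 * int j" using t that \<open>n > 1 - 2 * int k\<close> unfolding J_def
        by (auto simp: even_of_nat_iff[symmetric] simp del: even_of_nat_iff) presburger+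
      with False show ?thesis by blast
    qed
  qed
  ultimately show ?case using less.prems by (intro exI[of _ a] exI[of _ f]) auto
qed

section \<open>Hecke operators\<close>

lemma heckeP_conv:
  assumes "p > 0"
  shows "heckeP 2 4 p f z = (\<Sum>j<p. f ((z + 4 * of_nat j) / of_nat p)) / of_nat p + of_nat p * f (of_nat p * z)"
proof -
  have 1: "slash 2 (1, real (4 * j), 0, real p) f z = f ((z + 4 * of_nat j) / of_nat p) / of_nat p" for j
  proof -
    have "of_nat p powi (- 2) = (1 / of_nat p ^ 2 :: complex)"
      by (simp add: power_int_minus inverse_eq_divide)
    thus ?thesis using assms by (simp add: slash_def power2_eq_square)
  qed
  have 2: "slash 2 (real p, 0, 0, 1) f z = of_nat p * f (of_nat p * z)"
    using assms by (simp add: slash_def)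
  show ?thesis unfolding heckeP_def 1 2 using assms by (simp add: sum_divide_distrib)
qed

definition hecke_coeffs :: "nat \<Rightarrow> (int \<Rightarrow> complex) \<Rightarrow> int \<Rightarrow> complex" where
  "hecke_coeffs p a m = a (int p * m) + (if int p dvd m then of_nat p * a (m div int p) else 0)"

lemma sum_roots_of_unity:
  assumes "p > 0"
  shows "(\<Sum>j<p. exp (2 * of_real pi * \<i> * of_int n * of_nat j / of_nat p)) = (if int p dvd n then of_nat p else 0)"
proof -
  define w where "w = exp (2 * of_real pi * \<i> * of_int n / of_nat p)"
  have wj: "exp (2 * of_real pi * \<i> * of_int n * of_nat j / of_nat p) = w ^ j" for j
    unfolding w_def exp_of_nat_mult[symmetric] by (simp add: algebra_simps)
  show ?thesis
  proof (cases "int p dvd n")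
    case True
    then obtain k where k: "n = int p * k" by auto
    have "w = exp (2 * of_int k * of_real pi * \<i>)" unfolding w_def k using assms by (simp add: algebra_simps)
    also have "\<dots> = 1" using exp_integer_2pi[of "of_int k"] by simp
    finally show ?thesis unfolding wj using True by simp
  next
    case False
    have "w \<noteq> 1"
    proof
      assume "w = 1"
      then obtain k where k: "Im (2 * of_real pi * \<i> * of_int n / of_nat p) = of_int (2 * k) * pi"
        unfolding w_def exp_eq_1 by blast
      have "Im (2 * of_real pi * \<i> * of_int n / of_nat p) = 2 * pi * of_int n / of_nat p"
        by (simp add: Im_divide_of_nat)
      with k assms have "real_of_int n = real_of_int (k * int p)" by (simp add: field_simps)
      hence "n = k * int p" by (simp only: of_int_eq_iff)
      with False show False by simp
    qed
    moreover have "w ^ p = 1"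
    proof -
      have "w ^ p = exp (2 * of_int n * of_real pi * \<i>)"
        unfolding w_def exp_of_nat_mult[symmetric] using assms by (simp add: algebra_simps)
      also have "\<dots> = 1" using exp_integer_2pi[of "of_int n"] by simp
      finally show ?thesis .
    qed
    ultimately show ?thesis unfolding wj using False by (simp add: sum_gp_strict)
  qed
qed

lemma has_sum_finite_sum:
  fixes f :: "'i \<Rightarrow> 'a \<Rightarrow> 'b :: topological_comm_monoid_add"
  assumes "finite J" "\<And>j. j \<in> J \<Longrightarrow> (f j has_sum S j) A"
  shows "((\<lambda>x. \<Sum>j\<in>J. f j x) has_sum (\<Sum>j\<in>J. S j)) A"
  using assms by (induction J rule: finite_induct) (auto intro!: has_sum_add)

text \<open>Translation of z / p by 4 j / p multiplies q^(n/4) by exp(2 pi i n j / p), the 4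
  cancelling the denominator of the exponent. The average over j thus keeps just the n divisible by
  p.\<close>

lemma heckeP_has_sum:
  assumes p: "p > 0" and z: "z \<in> Hplane"
    and exp: "\<And>z. z \<in> Hplane \<Longrightarrow> ((\<lambda>n. a n * qpow 4 n z) has_sum f z) UNIV"
  shows "((\<lambda>n. hecke_coeffs p a n * qpow 4 n z) has_sum heckeP 2 4 p f z) UNIV"
proof -
  define i where "i = (\<lambda>m::int. int p * m)"
  have inj: "inj i" using p by (auto simp: i_def inj_def)
  have "((\<lambda>n. (\<Sum>j<p. a n * qpow 4 n ((z + 4 * of_nat j) / of_nat p)) / of_nat p) has_sum
       (\<Sum>j<p. f ((z + 4 * of_nat j) / of_nat p)) / of_nat p) UNIV"
    using z p unfolding divide_inverse by (intro has_sum_cmult_left has_sum_finite_sum exp) (auto simp: Hplane_simps Im_divide_of_nat)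
  also have "(\<lambda>n. (\<Sum>j<p. a n * qpow 4 n ((z + 4 * of_nat j) / of_nat p)) / of_nat p) =
     (\<lambda>n. if int p dvd n then a n * qpow 4 n (z / of_nat p) else 0)"
  proof (rule ext)
    fix n
    have "qpow 4 n ((z + 4 * of_nat j) / of_nat p) = qpow 4 n (z / of_nat p) * exp (2 * of_real pi * \<i> * of_int n * of_nat j / of_nat p)" for j
      unfolding add_divide_distrib qpow_add by (simp add: qpow_def algebra_simps)
    hence "(\<Sum>j<p. a n * qpow 4 n ((z + 4 * of_nat j) / of_nat p)) =
       a n * qpow 4 n (z / of_nat p) * (if int p dvd n then of_nat p else 0)"
      unfolding sum_roots_of_unity[OF p, symmetric] by (simp add: sum_distrib_left mult.assoc)
    thus "(\<Sum>j<p. a n * qpow 4 n ((z + 4 * of_nat j) / of_nat p)) / of_nat p =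
       (if int p dvd n then a n * qpow 4 n (z / of_nat p) else 0)" using p by simp
  qed
  also have "((\<lambda>n. if int p dvd n then a n * qpow 4 n (z / of_nat p) else 0) has_sum
       (\<Sum>j<p. f ((z + 4 * of_nat j) / of_nat p)) / of_nat p) UNIV \<longleftrightarrow>
     ((\<lambda>n. a n * qpow 4 n (z / of_nat p)) has_sum
       (\<Sum>j<p. f ((z + 4 * of_nat j) / of_nat p)) / of_nat p) (range i)"
    by (rule has_sum_cong_neutral) (auto simp: i_def)
  also have "\<dots> \<longleftrightarrow> ((\<lambda>m. a (int p * m) * qpow 4 m z) has_sum
       (\<Sum>j<p. f ((z + 4 * of_nat j) / of_nat p)) / of_nat p) UNIV"
    unfolding has_sum_reindex[OF inj] using p by (simp add: o_def i_def qpow_def)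
  finally have 1: "((\<lambda>m. a (int p * m) * qpow 4 m z) has_sum
       (\<Sum>j<p. f ((z + 4 * of_nat j) / of_nat p)) / of_nat p) UNIV" .
  have "((\<lambda>n. of_nat p * (a n * qpow 4 n (of_nat p * z))) has_sum (of_nat p * f (of_nat p * z))) UNIV"
    using z p by (intro has_sum_cmult_right exp) (auto simp: Hplane_simps)
  also have "(\<lambda>n. of_nat p * (a n * qpow 4 n (of_nat p * z))) = (\<lambda>m. of_nat p * a (m div int p) * qpow 4 m z) \<circ> i"
    using p by (auto simp: i_def qpow_def mult_ac)
  also have "((\<lambda>m. of_nat p * a (m div int p) * qpow 4 m z) \<circ> i has_sum (of_nat p * f (of_nat p * z))) UNIV \<longleftrightarrow>
     ((\<lambda>m. of_nat p * a (m div int p) * qpow 4 m z) has_sum (of_nat p * f (of_nat p * z))) (range i)"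
    by (rule has_sum_reindex[OF inj, symmetric])
  also have "\<dots> \<longleftrightarrow> ((\<lambda>m. (if int p dvd m then of_nat p * a (m div int p) else 0) * qpow 4 m z) has_sum (of_nat p * f (of_nat p * z))) UNIV"
    by (rule has_sum_cong_neutral) (auto simp: i_def)
  finally have 2: "((\<lambda>m. (if int p dvd m then of_nat p * a (m div int p) else 0) * qpow 4 m z) has_sum (of_nat p * f (of_nat p * z))) UNIV" .
  show ?thesis unfolding heckeP_conv[OF p] hecke_coeffs_def distrib_right using 1 2 by (rule has_sum_add)
qed

lemma heckeP_holomorphic:
  assumes "p > 0" "f holomorphic_on Hplane"
  shows "heckeP 2 4 p f holomorphic_on Hplane"
proof -
  have 1: "(\<lambda>z. f ((z + 4 * of_nat j) / of_nat p)) holomorphic_on Hplane" for j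
  proof -
    have "(f \<circ> (\<lambda>z. (z + 4 * of_nat j) / of_nat p)) holomorphic_on Hplane"
      using assms by (intro holomorphic_on_compose_gen[OF _ assms(2)] holomorphic_intros)
         (auto simp: Hplane_simps Im_divide_of_nat)
    thus ?thesis by (simp add: o_def)
  qed
  have 2: "(\<lambda>z. f (of_nat p * z)) holomorphic_on Hplane"
  proof -
    have "(f \<circ> (\<lambda>z. of_nat p * z)) holomorphic_on Hplane"
      using assms by (intro holomorphic_on_compose_gen[OF _ assms(2)] holomorphic_intros)
         (auto simp: Hplane_simps)
    thus ?thesis by (simp add: o_def)
  qed
  have "heckeP 2 4 p f = (\<lambda>z. (\<Sum>j<p. f ((z + 4 * of_nat j) / of_nat p)) / of_nat p + of_nat p * f (of_nat p * z))"
    using heckeP_conv[OF assms(1)] by blast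
  moreover have "(\<lambda>z. (\<Sum>j<p. f ((z + 4 * of_nat j) / of_nat p)) / of_nat p + of_nat p * f (of_nat p * z)) holomorphic_on Hplane"
    using assms(1) by (intro holomorphic_intros 1 2) auto
  ultimately show ?thesis by simp
qed

text \<open>The permutation of the representatives (1, 4j; 0, p), j > 0, that W_2 induces. The
  number 32 = 4 * 8 is the product of the off-diagonal factors in the matrix of determinant 1 that
  links j and its partner; the condition is symmetric in both, hence an involution.\<close>

lemma neg_inverse_involution:
  fixes p :: nat
  assumes p: "prime p" "odd p"
  obtains \<mu> :: "nat \<Rightarrow> nat" where
    "\<And>j. j \<in> {1..<p} \<Longrightarrow> \<mu> j \<in> {1..<p} \<and> p dvd 32 * j * \<mu> j + 1"
    "\<And>j. j \<in> {1..<p} \<Longrightarrow> \<mu> (\<mu> j) = j"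
proof -
  have p1: "p > 1" using prime_gt_1_nat[OF p(1)] .
  have cp2: "coprime 32 p"
  proof -
    have "coprime 2 p" using p by (simp add: coprime_commute)
    hence "coprime (2 ^ 5) p" by (rule coprime_power_left_iff[THEN iffD2, OF disjI1])
    thus ?thesis by simp
  qed
  have cp: "coprime (32 * j) p" if "j \<in> {1..<p}" for j
  proof -
    have "\<not> p dvd j" using that by (auto dest: dvd_imp_le)
    hence "coprime j p" using p by (metis prime_imp_coprime coprime_commute)
    thus ?thesis using cp2 by simp
  qed
  have ex: "\<exists>m. m \<in> {1..<p} \<and> p dvd 32 * j * m + 1" if j: "j \<in> {1..<p}" for j
  proof -
    obtain x where x: "[32 * j * x = 1] (mod p)" using cong_solve_coprime_nat[OF cp[OF j]] by auto
    \<comment> \<open>x inverts 32 j modulo p, and p - 1 represents -1 within the naturals.\<close>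
    define m where "m = (x * (p - 1)) mod p"
    have "[32 * j * m + 1 = 32 * j * x * (p - 1) + 1] (mod p)"
      unfolding m_def using mod_mult_right_eq[of "32 * j" "x * (p - 1)" p]
      by (intro cong_add cong_refl) (simp only: cong_def mult.assoc)
    also have "[32 * j * x * (p - 1) + 1 = 1 * (p - 1) + 1] (mod p)"
      by (intro cong_add cong_mult cong_refl x)
    also have "1 * (p - 1) + 1 = p" using p1 by simp
    finally have dv: "p dvd 32 * j * m + 1" by (simp add: cong_def dvd_eq_mod_eq_0)
    have "m \<noteq> 0"
    proof
      assume "m = 0"
      with dv have "p dvd 1" by simp
      thus False using p1 by simp
    qed
    moreover have "m < p" using p1 by (simp add: m_def)
    ultimately show ?thesis using dv by (intro exI[of _ m]) simp_all
  qed
  have un: "m = m'" if "j \<in> {1..<p}" "m \<in> {1..<p}" "m' \<in> {1..<p}" "p dvd 32 * j * m + 1" "p dvd 32 * j * m' + 1" for j m m'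
  proof -
    have "[32 * j * m + 1 = 32 * j * m' + 1] (mod p)"
      using that by (simp add: cong_def dvd_eq_mod_eq_0)
    hence "[32 * j * m = 32 * j * m'] (mod p)" by (simp only: cong_add_rcancel_nat)
    hence "[m = m'] (mod p)" using cong_mult_lcancel_nat[OF cp[OF that(1)]] by blast
    thus ?thesis using that by (simp add: cong_def)
  qed
  define \<mu> where "\<mu> = (\<lambda>j. SOME m. m \<in> {1..<p} \<and> p dvd 32 * j * m + 1)"
  have mu: "\<mu> j \<in> {1..<p} \<and> p dvd 32 * j * \<mu> j + 1" if "j \<in> {1..<p}" for j
    unfolding \<mu>_def by (rule someI_ex[OF ex[OF that]])
  show thesis
  proof (rule that[of \<mu>])
    fix j assume j: "j \<in> {1..<p}"
    show "\<mu> j \<in> {1..<p} \<and> p dvd 32 * j * \<mu> j + 1" by (rule mu[OF j])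
    have mj: "\<mu> j \<in> {1..<p}" using mu[OF j] by blast
    show "\<mu> (\<mu> j) = j"
      using mu[OF j] mu[OF mj] by (intro un[OF mj _ j]) (auto simp: mult_ac)
  qed
qed

text \<open>W_2 interchanges the representatives (1, 0; 0, p) and (p, 0; 0, 1) and permutes the
  other p - 1 through \<open>neg_inverse_involution\<close>.\<close>

lemma heckeP_Fricke:
  assumes f: "mform e s a f" and s: "s\<^sup>2 = 1" and p: "prime p" "odd p" and z: "z \<in> Hplane"
  shows "heckeP 2 4 p f (- 1 / (2 * z)) = 2 * s * z\<^sup>2 * heckeP 2 4 p f z"
proof -
  have p0: "p > 0" using p by (simp add: prime_gt_0_nat)
  have z0: "z \<noteq> 0" using z by (auto simp: Hplane_simps)
  have W: "f (- 1 / (2 * w)) = 2 * s * w\<^sup>2 * f w" if "w \<in> Hplane" for w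
    using f that by (auto simp: mform_def)
  obtain \<mu> where mu: "\<And>j. j \<in> {1..<p} \<Longrightarrow> \<mu> j \<in> {1..<p} \<and> p dvd 32 * j * \<mu> j + 1"
    "\<And>j. j \<in> {1..<p} \<Longrightarrow> \<mu> (\<mu> j) = j" using neg_inverse_involution[OF p] by blast
  define g where "g = (\<lambda>z j. f ((z + 4 * of_nat j) / of_nat p))"
  have step: "g (- 1 / (2 * z)) j = 2 * s * z\<^sup>2 * g z (\<mu> j)" if j: "j \<in> {1..<p}" for j
  proof -
    \<comment> \<open>\<open>(1, 4j; 0, p) W\<^sub>2 = (q, 4j; 8m, p) W\<^sub>2 (1, 4m; 0, p)\<close> with \<open>pq = 32jm + 1\<close>, and the
       multiplier is trivial on the first factor\<close>
    define m where "m = \<mu> j"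
    have "p dvd 32 * j * m + 1" using mu(1)[OF j] by (simp add: m_def)
    then obtain q where q: "32 * j * m + 1 = p * q" by (rule dvdE)
    have det: "int q * int p - 4 * int j * (8 * int m) = 1"
    proof -
      have "int (32 * j * m + 1) = int (p * q)" using q by (simp only:)
      thus ?thesis by (simp add: algebra_simps)
    qed
    define w where "w = (z + 4 * of_nat m) / of_nat p"
    have w: "w \<in> Hplane" using z p0 by (simp add: w_def Hplane_simps Im_divide_of_nat)
    have w0: "w \<noteq> 0" using w by (auto simp: Hplane_simps)
    have zw: "z = of_nat p * w - 4 * of_nat m" using p0 by (simp add: w_def)
    have qc: "of_nat p * of_nat q = (32 * of_nat j * of_nat m + 1 :: complex)"
    proof -
      have "of_nat (p * q) = (of_nat (32 * j * m + 1) :: complex)" using q by (simp only:)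
      thus ?thesis by simp
    qed
    have den: "of_int (8 * int m) * (- 1 / (2 * w)) + of_int (int p) = z / w"
      using w0 unfolding zw by (simp add: field_simps)
    have num: "of_int (int q) * (- 1 / (2 * w)) + of_int (4 * int j) = (8 * of_nat j * w - of_nat q) / (2 * w)"
      using w0 by (simp add: field_simps)
    have arg: "(8 * of_nat j * w - of_nat q) / (2 * w) / (z / w) = (- 1 / (2 * z) + 4 * of_nat j) / of_nat p"
    proof -
      have "of_nat p * (8 * of_nat j * w - of_nat q) = 8 * of_nat j * (of_nat p * w) - of_nat p * of_nat q"
        by (simp add: algebra_simps)
      also have "\<dots> = 8 * of_nat j * z - 1" unfolding qc zw by (simp add: algebra_simps)
      finally have e: "of_nat p * (8 * of_nat j * w - of_nat q) = 8 * of_nat j * z - 1" .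
      have "(8 * of_nat j * w - of_nat q) / (2 * w) / (z / w) = (8 * of_nat j * w - of_nat q) / (2 * z)"
        using w0 by simp
      also have "\<dots> = of_nat p * (8 * of_nat j * w - of_nat q) / (of_nat p * (2 * z))" using p0 by simp
      also have "\<dots> = (8 * of_nat j * z - 1) / (of_nat p * (2 * z))" unfolding e ..
      also have "\<dots> = (- 1 / (2 * z) + 4 * of_nat j) / of_nat p"
        using z0 p0 by (simp add: field_simps)
      finally show ?thesis .
    qed
    have L: "g02_law e f (int q) (4 * int j) (8 * int m) (int p)"
      by (rule mform_g02_law[OF f s det]) simp
    \<comment> \<open>Both 4 j and (8 m) div 2 = 4 m are divisible by 4.\<close>
    have pw: "\<i> powi (e * (int p * (4 * int j - 8 * int m div 2))) = 1"
      using i_powi_cong[of "e * (int p * (4 * int j - 8 * int m div 2))" 0] by (simp add: mod_eq_0_iff_dvd)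
    have "f ((of_int (int q) * (- 1 / (2 * w)) + of_int (4 * int j)) / (of_int (8 * int m) * (- 1 / (2 * w)) + of_int (int p))) =
      \<i> powi (e * (int p * (4 * int j - 8 * int m div 2))) * (of_int (8 * int m) * (- 1 / (2 * w)) + of_int (int p))\<^sup>2 * f (- 1 / (2 * w))"
      using bspec[OF L[unfolded g02_law_def] Hplane_Fricke[OF w]] .
    hence "f ((- 1 / (2 * z) + 4 * of_nat j) / of_nat p) = (z / w)\<^sup>2 * (2 * s * w\<^sup>2 * f w)"
      unfolding den num arg pw W[OF w] by simp
    thus ?thesis unfolding g_def m_def[symmetric] w_def[symmetric] using w0 by (simp add: power_divide)
  qed
  have sp: "(\<Sum>j<p. h j) = h 0 + (\<Sum>j\<in>{1..<p}. h j)" for h :: "nat \<Rightarrow> complex"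
    using p0 by (simp add: lessThan_atLeast0 sum.atLeast_Suc_lessThan)
  have "(\<Sum>j\<in>{1..<p}. g (- 1 / (2 * z)) j) = (\<Sum>j\<in>{1..<p}. 2 * s * z\<^sup>2 * g z (\<mu> j))"
    by (intro sum.cong refl step)
  also have "\<dots> = (\<Sum>j\<in>{1..<p}. 2 * s * z\<^sup>2 * g z j)"
    by (rule sum.reindex_bij_witness[of _ \<mu> \<mu>]) (use mu in auto)
  finally have S: "(\<Sum>j\<in>{1..<p}. g (- 1 / (2 * z)) j) = 2 * s * z\<^sup>2 * (\<Sum>j\<in>{1..<p}. g z j)"
    by (simp add: sum_distrib_left)
  have h0: "g (- 1 / (2 * z)) 0 = 2 * s * z\<^sup>2 * (of_nat p ^ 2 * f (of_nat p * z))"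
    using W[of "of_nat p * z"] z p0 by (simp add: g_def Hplane_simps power_mult_distrib mult_ac)
  have hp: "f (of_nat p * (- 1 / (2 * z))) = 2 * s * z\<^sup>2 * g z 0 / of_nat p ^ 2"
    using W[of "z / of_nat p"] z p0 by (simp add: g_def Hplane_simps power_divide Im_divide_of_nat)
  have E: "heckeP 2 4 p f w = (g w 0 + (\<Sum>j\<in>{1..<p}. g w j)) / of_nat p + of_nat p * f (of_nat p * w)" for w
    unfolding heckeP_conv[OF p0] g_def sp ..
  show ?thesis unfolding E S h0 hp using p0
    by (simp add: field_simps power2_eq_square)
qed

lemma odd_square_mod_4: "odd (p :: nat) \<Longrightarrow> (int p * int p) mod 4 = 1"
proof -
  assume "odd p"
  then obtain k where "p = 2 * k + 1" by (rule oddE)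
  hence "int p * int p = 1 + 4 * (int k * int k + int k)" by (simp add: algebra_simps)
  thus ?thesis by (simp only: mod_mult_self2) simp
qed

text \<open>The multiplier nu^e becomes nu^(p e): p^2 = 1 mod 4, so p m = e mod 4 means m = p e mod
  4, and the exponents m = p k with k = e mod 4 lie in the same class.\<close>

lemma mform_heckeP:
  assumes f: "mform e s a f" and s: "s\<^sup>2 = 1" and p: "prime p" "odd p"
  shows "mform (int p * e) s (hecke_coeffs p a) (heckeP 2 4 p f)"
proof -
  have p0: "p > 0" using p by (simp add: prime_gt_0_nat)
  have sup: "n mod 4 = e mod 4" if "a n \<noteq> 0" for n using f that by (auto simp: mform_def)
  have supp: "m mod 4 = int p * e mod 4" if nz: "hecke_coeffs p a m \<noteq> 0" for m
  proof -
    consider "a (int p * m) \<noteq> 0" | k where "m = int p * k" "a k \<noteq> 0"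
      using nz p0 unfolding hecke_coeffs_def
      by (metis add.left_neutral dvd_mult_div_cancel mult_zero_right)
    thus ?thesis
    proof cases
      case 1
      have "m mod 4 = (int p * int p) * m mod 4"
        using odd_square_mod_4[OF p(2)] by (metis mod_mult_left_eq mult_1)
      also have "\<dots> = int p * (int p * m) mod 4" by (simp add: mult.assoc)
      also have "\<dots> = int p * e mod 4" using sup[OF 1] by (metis mod_mult_right_eq)
      finally show ?thesis .
    next
      case 2
      thus ?thesis using sup[OF 2(2)] by (metis mod_mult_right_eq)
    qed
  qed
  obtain N where N: "\<And>n. n < N \<Longrightarrow> a n = 0" using f by (auto simp: mform_def)
  \<comment> \<open>Below this bound both p m and m / p are smaller than N, so both parts of the
    coefficient vanish.\<close>
  have low: "hecke_coeffs p a m = 0" if m: "m < - (int p * \<bar>N\<bar>)" for m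
  proof -
    have p1: "int p \<ge> 1" using p0 by simp
    have "1 * \<bar>N\<bar> \<le> int p * \<bar>N\<bar>" using p1 by (intro mult_right_mono) auto
    moreover have m0: "m \<le> 0" using m by (smt (verit) mult_nonneg_nonneg of_nat_0_le_iff)
    moreover have "int p * m \<le> 1 * m" using p1 m0 by (intro mult_right_mono_neg) auto
    ultimately have "int p * m < N" using m by linarith
    moreover have "k < N" if "m = int p * k" for k
    proof -
      have "int p * k < int p * (- \<bar>N\<bar>)" using m that by simp
      hence "k < - \<bar>N\<bar>" using p0 by (simp only: mult_less_cancel_left_pos of_nat_0_less_iff)
      thus ?thesis by linarith
    qed
    ultimately show ?thesis using N p0 by (auto simp: hecke_coeffs_def)
  qed
  show ?thesis unfolding mform_def
    using heckeP_holomorphic[OF p0, of f] heckeP_Fricke[OF f s p] heckeP_has_sum[OF p0, of _ a f] supp low f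
    by (intro conjI allI impI ballI) (auto simp: mform_def)
qed

text \<open>
  In terms of \<open>(U a)(m) = a(pm)\<close> and \<open>(V a)(m) = a(m/p)\<close>, where \<open>U V = 1\<close>, this is
  \<open>T(p\<^sup>n) = \<Sum>\<^sub>i p\<^sup>i V\<^sup>i U\<^sup>n\<^sup>-\<^sup>i\<close>.
\<close>

definition hecke_power_coeffs :: "nat \<Rightarrow> nat \<Rightarrow> (int \<Rightarrow> complex) \<Rightarrow> int \<Rightarrow> complex" where
  "hecke_power_coeffs p n a m = (\<Sum>i\<le>n. if int p ^ i dvd m then of_nat p ^ i * a (int p ^ (n - i) * (m div int p ^ i)) else 0)"

text \<open>Apply U + p V to the formula for T(p^(n+1)). By U V = 1 the part U yields U^(n+2) and p
  T(p^n); the part p V yields all terms of T(p^(n+2)) that contain a V.\<close>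

lemma hecke_power_coeffs_rec:
  assumes p: "p > 0"
  shows "hecke_coeffs p (hecke_power_coeffs p (Suc n) a) m =
    hecke_power_coeffs p (Suc (Suc n)) a m + of_nat p * hecke_power_coeffs p n a m"
proof -
  have 1: "hecke_power_coeffs p (Suc n) a (int p * m) = a (int p ^ Suc (Suc n) * m) + of_nat p * hecke_power_coeffs p n a m"
    unfolding hecke_power_coeffs_def sum.atMost_Suc_shift sum_distrib_left using p
    by (auto intro!: sum.cong simp: mult_ac)
  have 2: "(if int p dvd m then of_nat p * hecke_power_coeffs p (Suc n) a (m div int p) else 0) =
     (\<Sum>i\<le>Suc n. if int p ^ Suc i dvd m then of_nat p ^ Suc i * a (int p ^ (Suc n - i) * (m div int p ^ Suc i)) else 0)"
  proof (cases "int p dvd m")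
    case True
    then obtain k where k: "m = int p * k" by auto
    have "of_nat p * (if int p ^ i dvd k then of_nat p ^ i * a (int p ^ (Suc n - i) * (k div int p ^ i)) else 0) =
       (if int p ^ Suc i dvd int p * k then of_nat p ^ Suc i * a (int p ^ (Suc n - i) * (int p * k div int p ^ Suc i)) else 0)" for i
      using p by simp
    moreover have "int p * k div int p = k" using p by simp
    ultimately show ?thesis
      unfolding k hecke_power_coeffs_def if_P[OF dvd_triv_left] sum_distrib_left by (simp only:)
  next
    case False
    hence "\<not> int p ^ Suc i dvd m" for i by (metis dvd_mult_left power_Suc)
    thus ?thesis using False by simp
  qed
  have 3: "hecke_power_coeffs p (Suc (Suc n)) a m = a (int p ^ Suc (Suc n) * m) +
     (\<Sum>i\<le>Suc n. if int p ^ Suc i dvd m then of_nat p ^ Suc i * a (int p ^ (Suc n - i) * (m div int p ^ Suc i)) else 0)"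
    unfolding hecke_power_coeffs_def sum.atMost_Suc_shift[of _ "Suc n"] diff_Suc_Suc by simp
  show ?thesis unfolding hecke_coeffs_def 1 2 3 by simp
qed

lemma mform_hecke:
  assumes f: "mform e s a f" and s: "s\<^sup>2 = 1" and p: "prime p" "odd p"
  shows "mform (int p ^ n * e) s (hecke_power_coeffs p n a) (hecke 2 4 p n f)"
proof (induction n rule: induct_nat_012)
  case 0
  have "hecke_power_coeffs p 0 a = a" by (rule ext) (simp add: hecke_power_coeffs_def)
  thus ?case using f by simp
next
  case 1
  have "hecke_power_coeffs p (Suc 0) a = hecke_coeffs p a"
    by (rule ext) (simp add: hecke_power_coeffs_def hecke_coeffs_def)
  thus ?case using mform_heckeP[OF f s p] by simp
next
  case (ge2 n)
  have p0: "p > 0" using p by (simp add: prime_gt_0_nat)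
  \<comment> \<open>The two terms of the recursion have multiplier exponents p^(n+2) e and p^n e,
    which agree mod 4 because p^2 = 1 mod 4.\<close>
  have "(int p ^ n * e) mod 4 = (int p * int p) * (int p ^ n * e) mod 4"
    using odd_square_mod_4[OF p(2)] by (metis mod_mult_left_eq mult_1)
  hence "mform (int p * (int p ^ Suc n * e)) s (hecke_power_coeffs p n a) (hecke 2 4 p n f)"
    by (intro mform_cong_e[OF ge2(1)]) (simp add: mult_ac)
  from mform_add[OF mform_heckeP[OF ge2(2) s p] mform_cmult[OF this, of "- of_nat p"]]
  show ?case using p0 by (simp add: hecke_power_coeffs_rec[OF p0] mult_ac)
qed

section \<open>Comparison of principal parts: existence, uniqueness and the Hecke relations\<close>

lemma mform_eqI:
  assumes f: "mform e s a f" and g: "mform e s b g" and s: "s = 1 \<or> s = -1"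
    and ab: "\<And>n. n \<le> 0 \<Longrightarrow> a n = b n" "a 1 = b 1 \<or> s = 1" and z: "z \<in> Hplane"
  shows "f z = g z"
proof -
  have "f z + (- 1) * g z = 0"
    by (rule mform_vanishing[OF mform_add[OF f mform_cmult[OF g, of "- 1"]] s _ _ z]) (use ab in auto)
  thus ?thesis by simp
qed

lemma principal_forms_unique:
  assumes f: "wh_form 2 chi s f" "qexp_shape d S f" and g: "wh_form 2 chi s g" "qexp_shape d S g"
    and s: "s = 1 \<or> s = -1" and d: "d > 0"
    and S: "\<And>n. n \<in> S \<Longrightarrow> n > 0 \<and> int n mod 4 = (- int d) mod 4" "1 \<notin> S \<or> s = 1"
    and z: "z \<in> Hplane"
  shows "g z = f z"
proof -
  obtain a b where a: "qexp_coeffs d S a f" and b: "qexp_coeffs d S b g"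
    using f g by (auto simp: qexp_shape_def)
  show ?thesis
    by (rule mform_eqI[OF wh_form_imp_mform[OF g(1) b d S(1) refl] wh_form_imp_mform[OF f(1) a d S(1) refl] s _ _ z])
       (use S(2) d in \<open>auto simp: principal_coeffs_def\<close>)
qed

lemma S1_mod: "n \<in> S1 \<Longrightarrow> n > 0 \<and> int n mod 4 = 1"
  and S3_mod: "n \<in> S3 \<Longrightarrow> n > 0 \<and> int n mod 4 = 3"
  and S5_mod: "n \<in> S5 \<Longrightarrow> n > 0 \<and> int n mod 4 = 1"
proof -
  have "int n mod 4 = int (n mod 4)" for n by (simp add: of_nat_mod)
  thus "n \<in> S1 \<Longrightarrow> n > 0 \<and> int n mod 4 = 1" "n \<in> S3 \<Longrightarrow> n > 0 \<and> int n mod 4 = 3"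
    "n \<in> S5 \<Longrightarrow> n > 0 \<and> int n mod 4 = 1"
    by (simp_all add: S1_def S3_def S5_def)
qed

text \<open>The reduced form for k = (d + 1) / 2 has its pole at 1 - 2k = -d. A coefficient at
  q^(1/4) that must not occur can arise only for s = -1 and exponents 1 mod 4; then
  \<open>h2\<close> lies in the same space and removes it.\<close>

lemma principal_form_exists:
  assumes s: "s = 1 \<or> s = -1" and d: "odd d"
    and S: "\<And>n. n > 0 \<Longrightarrow> n mod 4 = (- int d) mod 4 \<Longrightarrow> n \<noteq> 1 \<or> s = 1 \<Longrightarrow> nat n \<in> S" "0 \<notin> S"
  shows "\<exists>a f. mform (- int d) s a f \<and> qexp_shape d S f"
proof -
  define k where "k = (d + 1) div 2"
  have k: "1 - 2 * int k = - int d" "k > 0" using d by (auto simp: k_def elim!: oddE)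
  obtain a f where f: "mform (- int d) s a f" "a (- int d) = 1" "\<And>n. n \<le> 0 \<Longrightarrow> n \<noteq> - int d \<Longrightarrow> a n = 0"
    using reduced_mform_exists[OF s k(2)] unfolding k by blast
  have d0: "d > 0" using d by (auto elim: oddE)
  have "\<exists>a f. mform (- int d) s a f \<and> a (- int d) = 1 \<and> (\<forall>n\<le>0. n \<noteq> - int d \<longrightarrow> a n = 0) \<and> (a 1 = 0 \<or> s = 1)"
  proof (cases "a 1 = 0 \<or> s = 1")
    case True thus ?thesis using f by blast
  next
    case False
    hence s': "s = -1" and "1 mod 4 = (- int d) mod 4" using s f(1) by (auto simp: mform_def)
    obtain b where b: "mform 1 (-1) b h2" "b 1 = 1" "\<forall>n\<le>0. b n = 0" using h2_mform by blast
    have "mform (- int d) s b h2" using mform_cong_e[OF b(1) \<open>1 mod 4 = _\<close>] s' by simp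
    from mform_add[OF f(1) mform_cmult[OF this, of "- a 1"]] show ?thesis
      using f(2,3) b(2,3) d0
      by (intro exI[of _ "\<lambda>n. a n + - a 1 * b n"] exI[of _ "\<lambda>z. f z + - a 1 * h2 z"]) auto
  qed
  then obtain a f where f: "mform (- int d) s a f" "a (- int d) = 1" "\<And>n. n \<le> 0 \<Longrightarrow> n \<noteq> - int d \<Longrightarrow> a n = 0"
    "a 1 = 0 \<or> s = 1" by blast
  have "qexp_coeffs d {n\<in>S. n > 0} (\<lambda>n. a (int n)) f"
  proof (rule has_sum_imp_qexp_coeffs[where a = a and f = f and S = S, OF _ f(2) d0])
    fix n assume n: "n \<noteq> - int d" "a n \<noteq> 0"
    have "n > 0" using f(3)[of n] n by force
    moreover have "n mod 4 = (- int d) mod 4" using f(1) n by (auto simp: mform_def)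
    moreover have "n \<noteq> 1 \<or> s = 1" using f(4) n by auto
    ultimately show "n > 0 \<and> nat n \<in> S" using S by blast
  qed (use f in \<open>auto simp: mform_def\<close>)
  also have "{n\<in>S. n > 0} = S" using S(2) by (auto intro: gr0I)
  finally show ?thesis using f(1) by (auto simp: qexp_shape_def)
qed

text \<open>At nonpositive indices a is nonzero at -1 alone, and p^(n-i) k = -1 forces i = n and k =
  -1. Only the term p^n V^n contributes.\<close>

lemma hecke_power_coeffs_principal:
  assumes p: "p > 1" and a: "a (-1) = 1" "\<And>n. n \<le> 0 \<Longrightarrow> n \<noteq> -1 \<Longrightarrow> a n = 0" and m: "m \<le> 0"
  shows "hecke_power_coeffs p n a m = (if m = - int (p ^ n) then of_nat (p ^ n) else 0)"
proof -
  have "(if int p ^ i dvd m then of_nat p ^ i * a (int p ^ (n - i) * (m div int p ^ i)) else 0) =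
      (if i = n then (if m = - int (p ^ n) then of_nat (p ^ n) else 0) else 0)" if i: "i \<le> n" for i
  proof (cases "int p ^ i dvd m")
    case True
    then obtain k where k: "m = int p ^ i * k" by auto
    have div: "m div int p ^ i = k" using p by (simp add: k)
    have pos: "int p ^ i > 0" "int p ^ (n - i) > 0" using p by auto
    have "k \<le> 0" using m pos(1) unfolding k by (simp add: mult_le_0_iff)
    hence le: "int p ^ (n - i) * k \<le> 0" using pos by (simp add: mult_le_0_iff)
    show ?thesis
    proof (cases "int p ^ (n - i) * k = -1")
      case e: True
      hence "int p ^ (n - i) dvd 1" by (metis dvd_minus_iff dvd_triv_left)
      hence "int p ^ (n - i) = 1" using pos by (simp add: zdvd1_eq)
      hence k1: "k = -1" using e by simp
      have "i = n" using \<open>int p ^ (n - i) = 1\<close> i p one_less_power[of "int p" "n - i"]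
        by (cases "n - i = 0") auto
      thus ?thesis using k1 a(1) div k by simp
    next
      case ne: False
      hence "a (int p ^ (n - i) * k) = 0" using a(2)[OF le] by blast
      moreover have "m \<noteq> - int (p ^ n)" if "i = n"
      proof
        assume "m = - int (p ^ n)"
        hence "int p ^ i * (k + 1) = 0" using that by (simp add: k distrib_left)
        moreover have "int p ^ i \<noteq> 0" using pos(1) by linarith
        ultimately have "k + 1 = 0" using mult_eq_0_iff by blast
        hence "k = -1" by linarith
        with ne that show False by simp
      qed
      ultimately show ?thesis using div by auto
    qed
  next
    case False
    thus ?thesis by auto
  qed
  hence "hecke_power_coeffs p n a m = (\<Sum>i\<le>n. if i = n then (if m = - int (p ^ n) then of_nat (p ^ n) else 0) else 0)"
    unfolding hecke_power_coeffs_def by (intro sum.cong refl) auto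
  thus ?thesis by simp
qed

text \<open>p^i divides 1 only for i = 0, so only the term U^n contributes.\<close>

lemma hecke_power_coeffs_1:
  assumes "p > 1"
  shows "hecke_power_coeffs p n a 1 = a (int (p ^ n))"
proof -
  have "\<not> int p ^ i dvd 1" if "i \<noteq> 0" for i
  proof -
    have "1 < int p ^ i" by (rule one_less_power) (use assms that in auto)
    thus ?thesis using zdvd_imp_le[of "int p ^ i" 1] by linarith
  qed
  hence "hecke_power_coeffs p n a 1 = (\<Sum>i\<le>n. if i = 0 then a (int p ^ n) else 0)"
    unfolding hecke_power_coeffs_def by (intro sum.cong) auto
  thus ?thesis by simp
qed

lemma int_neg_mod_4: "d mod 4 = 1 \<Longrightarrow> (- int d) mod 4 = 3" "d mod 4 = 3 \<Longrightarrow> (- int d) mod 4 = 1"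
  by presburger+

lemma S3_mod_neg: "d mod 4 = 1 \<Longrightarrow> n \<in> S3 \<Longrightarrow> n > 0 \<and> int n mod 4 = (- int d) mod 4"
  using S3_mod[of n] int_neg_mod_4(1)[of d] by metis

lemma one_notin_S3: "1 \<notin> S3"
  by (simp add: S3_def)

lemma odd_mod_4_nat: "odd (d :: nat) \<Longrightarrow> d mod 4 = 1 \<or> d mod 4 = 3"
  by presburger

lemma nat_mod_4: "n > 0 \<Longrightarrow> n mod 4 = int r \<Longrightarrow> nat n mod 4 = r"
  by (simp add: nat_mod_as_int)

text \<open>\<open>chi\<close> and \<open>S\<close> are left open so that both classes of p^n mod 4
  are covered at once. The multiple of \<open>h2\<close> matches the coefficient of q^(1/4) for s =
  -1; if p^n = 1 mod 4 that coefficient is 0 on both sides, and for s = 1 the principal part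
  decides.\<close>

lemma hecke_f1_eq:
  assumes p: "prime p" "odd p" and s: "s = 1 \<or> s = -1"
    and f: "wh_form 2 nu0_conj s f" "qexp_coeffs 1 S3 a f"
    and g: "wh_form 2 chi s g" "qexp_coeffs (p ^ n) S b g"
    and S: "\<And>m. m \<in> S \<Longrightarrow> m > 0 \<and> int m mod 4 = (- int (p ^ n)) mod 4" "1 \<notin> S \<or> s = 1"
    and z: "z \<in> Hplane"
  shows "hecke 2 4 p n f z = of_nat (p ^ n) * g z +
    (if s = -1 \<and> p ^ n mod 4 = 3 then a (p ^ n) * h2 z else 0)"
proof -
  have p1: "p > 1" using prime_gt_1_nat[OF p(1)] .
  define A where "A = principal_coeffs 1 S3 a"
  define B where "B = principal_coeffs (p ^ n) S b"
  define c where "c = (if s = -1 \<and> p ^ n mod 4 = 3 then a (p ^ n) else 0)"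
  have s2: "s\<^sup>2 = 1" using s by auto
  have F0: "mform (- 1) s A f" unfolding A_def
    by (rule wh_form_imp_mform[OF f]) (use S3_mod in auto)
  have F: "mform (- int (p ^ n)) s (hecke_power_coeffs p n A) (hecke 2 4 p n f)"
    using mform_hecke[OF F0 s2 p, of n] by simp
  have G: "mform (- int (p ^ n)) s B g" unfolding B_def
    by (rule wh_form_imp_mform[OF g _ S(1) refl]) (use p1 in auto)
  obtain h where h: "mform 1 (-1) h h2" "h 1 = 1" "\<forall>n\<le>0. h n = 0" using h2_mform by blast
  have H: "mform (- int (p ^ n)) s (\<lambda>m. c * h m) (\<lambda>z. c * h2 z)"
  proof (cases "c = 0")
    case True thus ?thesis using mform_zero by simp
  next
    case False
    hence "s = -1" "p ^ n mod 4 = 3" by (auto simp: c_def split: if_splits)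
    moreover have "1 mod 4 = (- int (p ^ n)) mod 4"
      using int_neg_mod_4(2)[OF \<open>p ^ n mod 4 = 3\<close>] by simp
    ultimately show ?thesis using mform_cmult[OF mform_cong_e[OF h(1)]] by blast
  qed
  have "hecke 2 4 p n f z = of_nat (p ^ n) * g z + c * h2 z"
  proof (rule mform_eqI[OF F mform_add[OF mform_cmult[OF G] H] s _ _ z])
    fix m :: int assume m: "m \<le> 0"
    have "hecke_power_coeffs p n A m = (if m = - int (p ^ n) then of_nat (p ^ n) else 0)"
      by (rule hecke_power_coeffs_principal[OF p1 _ _ m]) (auto simp: A_def principal_coeffs_def)
    thus "hecke_power_coeffs p n A m = of_nat (p ^ n) * B m + c * h m"
      using m h(3) by (auto simp: B_def principal_coeffs_def)
  next
    have ne: "x \<noteq> - int (p ^ n)" if "x > 0" for x using that by linarith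
    from ne[of 1] have B1: "B 1 = 0 \<or> s = 1" using S(2) unfolding B_def principal_coeffs_def by auto
    have "hecke_power_coeffs p n A 1 = A (int (p ^ n))" by (rule hecke_power_coeffs_1[OF p1])
    also have "\<dots> = (if p ^ n mod 4 = 3 then a (p ^ n) else 0)"
    proof -
      have "int (p ^ n) > 0" using p1 by simp
      moreover from this have "int (p ^ n) \<noteq> - int 1" by linarith
      ultimately show ?thesis unfolding A_def principal_coeffs_def S3_def by (simp only: nat_int) simp
    qed
    finally show "hecke_power_coeffs p n A 1 = of_nat (p ^ n) * B 1 + c * h 1 \<or> s = 1"
      using B1 s h(2) by (auto simp: c_def)
  qed
  thus ?thesis by (simp add: c_def)
qed

lemma fd_exists_unique:
  assumes s: "s = 1 \<or> s = -1"
  shows "d mod 4 = 1 \<Longrightarrow> \<exists>f. wh_form 2 nu0_conj s f \<and> qexp_shape d S3 f \<and>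
      (\<forall>g. wh_form 2 nu0_conj s g \<and> qexp_shape d S3 g \<longrightarrow> (\<forall>z\<in>Hplane. g z = f z))"
    and "d mod 4 = 3 \<Longrightarrow> S = (if s = 1 then S1 else S5) \<Longrightarrow> \<exists>f. wh_form 2 nu0 s f \<and> qexp_shape d S f \<and>
      (\<forall>g. wh_form 2 nu0 s g \<and> qexp_shape d S g \<longrightarrow> (\<forall>z\<in>Hplane. g z = f z))"
proof -
  have s2: "s\<^sup>2 = 1" using s by auto
  { assume d: "d mod 4 = 1"
    have d': "odd d" "d > 0" using d by presburger+
    obtain a f where f: "mform (- int d) s a f" "qexp_shape d S3 f"
      using principal_form_exists[OF s d'(1), of S3] int_neg_mod_4(1)[OF d] nat_mod_4[of _ 3]
      by (auto simp: S3_def)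
    have wf: "wh_form 2 nu0_conj s f" by (rule mform_imp_wh_form(2)[OF f(1) s2 int_neg_mod_4(1)[OF d]])
    show "\<exists>f. wh_form 2 nu0_conj s f \<and> qexp_shape d S3 f \<and>
      (\<forall>g. wh_form 2 nu0_conj s g \<and> qexp_shape d S3 g \<longrightarrow> (\<forall>z\<in>Hplane. g z = f z))"
    proof (intro exI[of _ f] conjI allI impI ballI wf f(2))
      fix g z assume g: "wh_form 2 nu0_conj s g \<and> qexp_shape d S3 g" and z: "z \<in> Hplane"
      show "g z = f z"
        by (rule principal_forms_unique[OF wf f(2) conjunct1[OF g] conjunct2[OF g] s d'(2) _ _ z])
           (use S3_mod_neg[OF d] one_notin_S3 in blast)+
    qed }
  { assume d: "d mod 4 = 3" and S: "S = (if s = 1 then S1 else S5)"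
    have d': "odd d" "d > 0" using d by presburger+
    have Sm: "n > 0 \<and> int n mod 4 = 1" if "n \<in> S" for n using that S S1_mod S5_mod by (auto split: if_splits)
    have inS: "nat n \<in> S" if n: "n > 0" "n mod 4 = 1" "n \<noteq> 1 \<or> s = 1" for n :: int
    proof (cases "s = 1")
      case True thus ?thesis using n nat_mod_4[of n 1] by (simp add: S S1_def)
    next
      case False
      hence "n \<ge> 5" using n by presburger
      thus ?thesis using False n nat_mod_4[of n 1] by (simp add: S S5_def nat_le_eq_zle le_nat_iff)
    qed
    have nS: "0 \<notin> S" "1 \<notin> S \<or> s = 1" by (auto simp: S S1_def S5_def)
    obtain a f where f: "mform (- int d) s a f" "qexp_shape d S f"
      using principal_form_exists[OF s d'(1), of S] int_neg_mod_4(2)[OF d] inS nS by auto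
    have wf: "wh_form 2 nu0 s f" by (rule mform_imp_wh_form(1)[OF f(1) s2 int_neg_mod_4(2)[OF d]])
    show "\<exists>f. wh_form 2 nu0 s f \<and> qexp_shape d S f \<and>
      (\<forall>g. wh_form 2 nu0 s g \<and> qexp_shape d S g \<longrightarrow> (\<forall>z\<in>Hplane. g z = f z))"
    proof (intro exI[of _ f] conjI allI impI ballI wf f(2))
      fix g z assume g: "wh_form 2 nu0 s g \<and> qexp_shape d S g" and z: "z \<in> Hplane"
      show "g z = f z"
        by (rule principal_forms_unique[OF wf f(2) conjunct1[OF g] conjunct2[OF g] s d'(2) _ nS(2) z])
           (use Sm int_neg_mod_4(2)[OF d] in metis)
    qed }
qed

lemma hecke_fd:
  assumes p: "prime p" "odd p" and s: "s = 1 \<or> s = -1"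
    and f: "wh_form 2 nu0_conj s f" "qexp_coeffs 1 S3 a f" and g: "fd_prop s (p ^ n) g" and z: "z \<in> Hplane"
  shows "hecke 2 4 p n f z = of_nat (p ^ n) * g z +
    (if s = -1 \<and> p ^ n mod 4 = 3 then a (p ^ n) * h2 z else 0)"
proof (cases "p ^ n mod 4 = 1")
  case True
  then obtain b where b: "wh_form 2 nu0_conj s g" "qexp_coeffs (p ^ n) S3 b g"
    using g by (auto simp: fd_prop_def qexp_shape_def)
  show ?thesis
    by (rule hecke_f1_eq[OF p s f b _ _ z]) (use S3_mod_neg[OF True] one_notin_S3 in blast)+
next
  case False
  have "odd (p ^ n)" using p by simp
  hence 3: "p ^ n mod 4 = 3" using False odd_mod_4_nat by blast
  define S where "S = (if s = 1 then S1 else S5)"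
  obtain b where b: "wh_form 2 nu0 s g" "qexp_coeffs (p ^ n) S b g"
    using g False by (auto simp: fd_prop_def qexp_shape_def S_def)
  have Sm: "n > 0 \<and> int n mod 4 = 1" if "n \<in> S" for n using that S1_mod S5_mod by (auto simp: S_def split: if_splits)
  have S1: "1 \<notin> S \<or> s = 1" by (simp add: S_def S5_def)
  show ?thesis
    by (rule hecke_f1_eq[OF p s f b _ _ z]) (use Sm int_neg_mod_4(2)[OF 3] S1 in metis)+
qed

theorem theorem4p1:
  shows
  "(\<forall>d::nat. d > 0 \<and> d mod 4 = 1 \<longrightarrow>
      (\<forall>s\<in>{1, -1::complex}. \<exists>f. wh_form 2 nu0_conj s f \<and> qexp_shape d S3 f \<and>
          (\<forall>g. wh_form 2 nu0_conj s g \<and> qexp_shape d S3 g \<longrightarrow> (\<forall>z\<in>Hplane. g z = f z))))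
   \<and> (\<forall>d::nat. d > 0 \<and> d mod 4 = 3 \<longrightarrow>
      (\<exists>f. wh_form 2 nu0 1 f \<and> qexp_shape d S1 f \<and>
          (\<forall>g. wh_form 2 nu0 1 g \<and> qexp_shape d S1 g \<longrightarrow> (\<forall>z\<in>Hplane. g z = f z))) \<and>
      (\<exists>f. wh_form 2 nu0 (-1) f \<and> qexp_shape d S5 f \<and>
          (\<forall>g. wh_form 2 nu0 (-1) g \<and> qexp_shape d S5 g \<longrightarrow> (\<forall>z\<in>Hplane. g z = f z))))
   \<and> (\<forall>(p::nat) (n::nat). prime p \<and> odd p \<and> n \<ge> 1 \<longrightarrow>
      (\<forall>f1 g. fd_prop 1 1 f1 \<and> fd_prop 1 (p ^ n) g \<longrightarrow>
          (\<forall>z\<in>Hplane. hecke 2 4 p n f1 z = of_nat (p ^ n) * g z)) \<and>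
      (p ^ n mod 4 = 1 \<longrightarrow> (\<forall>f1 g. fd_prop (-1) 1 f1 \<and> fd_prop (-1) (p ^ n) g \<longrightarrow>
          (\<forall>z\<in>Hplane. hecke 2 4 p n f1 z = of_nat (p ^ n) * g z))) \<and>
      (p ^ n mod 4 = 3 \<longrightarrow> (\<forall>f1 a1 g. wh_form 2 nu0_conj (-1) f1 \<and> qexp_coeffs 1 S3 a1 f1
              \<and> fd_prop (-1) (p ^ n) g \<longrightarrow>
          (\<forall>z\<in>Hplane. hecke 2 4 p n f1 z = of_nat (p ^ n) * g z + a1 (p ^ n) * h2 z))))"
proof (intro conjI allI impI ballI)
  fix d :: nat and s :: complex assume "d > 0 \<and> d mod 4 = 1" "s \<in> {1, -1}"
  thus "\<exists>f. wh_form 2 nu0_conj s f \<and> qexp_shape d S3 f \<and>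
          (\<forall>g. wh_form 2 nu0_conj s g \<and> qexp_shape d S3 g \<longrightarrow> (\<forall>z\<in>Hplane. g z = f z))"
    by (intro fd_exists_unique(1)) auto
next
  fix d :: nat assume d: "d > 0 \<and> d mod 4 = 3"
  thus "\<exists>f. wh_form 2 nu0 1 f \<and> qexp_shape d S1 f \<and>
          (\<forall>g. wh_form 2 nu0 1 g \<and> qexp_shape d S1 g \<longrightarrow> (\<forall>z\<in>Hplane. g z = f z))"
    by (intro fd_exists_unique(2)) auto
  show "\<exists>f. wh_form 2 nu0 (-1) f \<and> qexp_shape d S5 f \<and>
          (\<forall>g. wh_form 2 nu0 (-1) g \<and> qexp_shape d S5 g \<longrightarrow> (\<forall>z\<in>Hplane. g z = f z))"
    using d by (intro fd_exists_unique(2)) auto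
next
  fix p n :: nat and f1 g z
  assume p: "prime p \<and> odd p \<and> n \<ge> 1" and z: "z \<in> Hplane" and fg: "fd_prop 1 1 f1 \<and> fd_prop 1 (p ^ n) g"
  then obtain a where "wh_form 2 nu0_conj 1 f1" "qexp_coeffs 1 S3 a f1"
    by (auto simp: fd_prop_def qexp_shape_def)
  from hecke_fd[OF _ _ _ this _ z] p fg show "hecke 2 4 p n f1 z = of_nat (p ^ n) * g z" by force
next
  fix p n :: nat and f1 g z
  assume p: "prime p \<and> odd p \<and> n \<ge> 1" "p ^ n mod 4 = 1" and z: "z \<in> Hplane"
    and fg: "fd_prop (-1) 1 f1 \<and> fd_prop (-1) (p ^ n) g"
  then obtain a where "wh_form 2 nu0_conj (-1) f1" "qexp_coeffs 1 S3 a f1"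
    by (auto simp: fd_prop_def qexp_shape_def)
  from hecke_fd[OF _ _ _ this _ z] p fg show "hecke 2 4 p n f1 z = of_nat (p ^ n) * g z" by force
next
  fix p n :: nat and f1 a1 g z
  assume p: "prime p \<and> odd p \<and> n \<ge> 1" "p ^ n mod 4 = 3" and z: "z \<in> Hplane"
    and fg: "wh_form 2 nu0_conj (-1) f1 \<and> qexp_coeffs 1 S3 a1 f1 \<and> fd_prop (-1) (p ^ n) g"
  hence "wh_form 2 nu0_conj (-1) f1" "qexp_coeffs 1 S3 a1 f1" by auto
  from hecke_fd[OF _ _ _ this _ z] p fg
  show "hecke 2 4 p n f1 z = of_nat (p ^ n) * g z + a1 (p ^ n) * h2 z" by force
qed

end
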